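(* Assume we have sample access to three distributions $p,q_1,q_2$ on $[n]$, and let $\epsilon$ be a given proximity parameter. There exists a closeness tester in the presence of noise (accessible via samples) that uses $O\left(\sqrt n/\epsilon^2+n^{2/3}/\epsilon^{4/3}\right)$ samples. That is, there is a randomized algorithm that draws this many samples from $p,q_1,q_2$ and satisfies: if $p=(1-\alpha)q_1+\alpha q_2$ for some $\alpha\in[0,1]$, it outputs accept with probability at least $2/3$; if $\|p-((1-\alpha)q_1+\alpha q_2)\|_1\ge\epsilon$ for every $\alpha\in[0,1]$, it outputs reject with probability at least $2/3$. Furthermore, $\Omega\left(\sqrt n/\epsilon^2+n^{2/3}/\epsilon^{4/3}\right)$ samples are required for this task.
   Context: $[n]=\{1,\dots,n\}$. Sample access to a distribution means access to an oracle returning independent samples from it; $q_1$ and $q_2$ are not explicitly given, and the mixture parameter $\alpha$ is not given to the algorithm. A closeness tester in the presence of noise that is accessible via samples is an algorithm with the two stated accept/reject guarantees. *)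

theory Defs
  imports "HOL-Probability.Probability"
begin

text \<open>
  Distributions on \<open>[n]\<close> are probability mass functions on the naturals supported in
  \<open>{1..n}\<close>.
\<close>

definition dists_on :: "nat \<Rightarrow> nat pmf set" where
  "dists_on n = {p. set_pmf p \<subseteq> {1..n}}"

definition mixture :: "real \<Rightarrow> nat pmf \<Rightarrow> nat pmf \<Rightarrow> nat \<Rightarrow> real" where
  "mixture \<alpha> q1 q2 = (\<lambda>i. (1 - \<alpha>) * pmf q1 i + \<alpha> * pmf q2 i)"

definition l1_dist :: "nat \<Rightarrow> (nat \<Rightarrow> real) \<Rightarrow> (nat \<Rightarrow> real) \<Rightarrow> real" where
  "l1_dist n f g = (\<Sum>i\<in>{1..n}. \<bar>f i - g i\<bar>)"

text \<open>
  A randomized algorithm with access to three sample sources (for \<open>p\<close>, \<open>q1\<close> and \<open>q2\<close>)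
  is a well-founded computation tree.  At each step it either stops, or draws one fresh sample
  from a source of its choice, or makes an internal random choice with an arbitrary discrete
  distribution.  All choices may
  depend on the samples and coins seen so far, so adaptive querying and adaptive stopping
  are allowed.  Only the samples, and never the distributions themselves, influence the
  computation.
\<close>

datatype verdict = Accept | Reject

datatype source = FromP | FromQ1 | FromQ2

datatype algorithm =
    Output verdict
  | Sample source "nat \<Rightarrow> algorithm"
  | Randomize "algorithm pmf"

fun source_dist :: "nat pmf \<Rightarrow> nat pmf \<Rightarrow> nat pmf \<Rightarrow> source \<Rightarrow> nat pmf" where
  "source_dist p q1 q2 FromP = p"
| "source_dist p q1 q2 FromQ1 = q1"
| "source_dist p q1 q2 FromQ2 = q2"

text \<open>
  Joint distribution of the verdict and of the total number of samples drawn, from all three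
  sources together.  Independence of the samples comes from the monadic bind.
\<close>

primrec run :: "(source \<Rightarrow> nat pmf) \<Rightarrow> algorithm \<Rightarrow> (verdict \<times> nat) pmf" where
  "run D (Output v) = return_pmf (v, 0)"
| "run D (Sample s k) = bind_pmf (D s) (\<lambda>x. map_pmf (\<lambda>(v, m). (v, Suc m)) (run D (k x)))"
| "run D (Randomize r) = join_pmf (map_pmf (run D) r)"

definition prob_verdict ::
    "algorithm \<Rightarrow> nat pmf \<Rightarrow> nat pmf \<Rightarrow> nat pmf \<Rightarrow> verdict \<Rightarrow> real" where
  "prob_verdict A p q1 q2 v =
     measure_pmf.prob (run (source_dist p q1 q2) A) {(w, m). w = v}"

text \<open>Worst case over all inputs on \<open>[n]\<close> and over all outcomes of samples and coins.\<close>

definition uses_at_most :: "nat \<Rightarrow> algorithm \<Rightarrow> real \<Rightarrow> bool" where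
  "uses_at_most n A b \<longleftrightarrow>
     (\<forall>p\<in>dists_on n. \<forall>q1\<in>dists_on n. \<forall>q2\<in>dists_on n.
        \<forall>(v, m)\<in>set_pmf (run (source_dist p q1 q2) A). real m \<le> b)"

definition noisy_closeness_tester :: "nat \<Rightarrow> real \<Rightarrow> algorithm \<Rightarrow> bool" where
  "noisy_closeness_tester n \<epsilon> A \<longleftrightarrow>
     (\<forall>p\<in>dists_on n. \<forall>q1\<in>dists_on n. \<forall>q2\<in>dists_on n.
        ((\<exists>\<alpha>\<in>{0..1}. pmf p = mixture \<alpha> q1 q2) \<longrightarrow>
           prob_verdict A p q1 q2 Accept \<ge> 2/3) \<and>
        ((\<forall>\<alpha>\<in>{0..1}. l1_dist n (pmf p) (mixture \<alpha> q1 q2) \<ge> \<epsilon>) \<longrightarrow>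
           prob_verdict A p q1 q2 Reject \<ge> 2/3))"

definition sample_rate :: "nat \<Rightarrow> real \<Rightarrow> real" where
  "sample_rate n \<epsilon> = sqrt (real n) / \<epsilon>^2 + real n powr (2/3) / \<epsilon> powr (4/3)"

end

theory Submission
  imports Defs
begin

text \<open>
  Upper bound.  A first batch of \<open>k\<close> samples from each source flattens the distributions: weighting
  element \<open>i\<close> by \<open>w i = 1 / (1 + count i)\<close> makes the weighted norms of \<open>p\<close>, \<open>q1\<close>, \<open>q2\<close> of order
  \<open>1 / sqrt k\<close>, while the weighted squared distance stays at least \<open>\<epsilon>\<^sup>2 / (4 n)\<close> for far inputs.
  Two further independent batches of size \<open>m\<close> give an unbiased bilinear estimate of the squared
  distance from \<open>p\<close> to \<open>(1 - \<alpha>) q1 + \<alpha> q2\<close>, and the tester accepts if some \<open>\<alpha>\<close> makes it small.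
  Taking \<open>k = min n (n^(2/3) / \<epsilon>^(4/3))\<close> and \<open>m\<close> of order \<open>n / (\<epsilon>\<^sup>2 sqrt k)\<close> suffices.

  Lower bound.  Already \<open>q1 = q2\<close> is hard.  The input is random: pairs of elements carry equal mass
  under the null hypothesis and masses tilted in opposite directions for \<open>p\<close> and \<open>q1\<close> under the
  alternative.  If all pairs have the same mass, the chi-square distance of the samples is small
  for \<open>o(sqrt n / \<epsilon>\<^sup>2)\<close> samples.  If the tilted pairs are light and a random set of heavy untilted
  pairs, twice as many as there are samples, is hidden among them, then collisions are almost
  always heavy and \<open>o(n^(2/3) / \<epsilon>^(4/3))\<close> samples do not help either.  The posterior of the heavy set
  given the observed pairs is bounded deterministically, which avoids Poissonisation.
\<close>

section \<open>Non-adaptive algorithms drawing three batches\<close>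

text \<open>The unknown \<open>\<alpha>\<close> ranges over a continuum, so a union bound over
  \<open>\<alpha>\<close> is out of reach; the way around it is that the statistic is a quadratic
  polynomial in \<open>\<alpha>\<close>. Taking the two factors of the bilinear form from
  independent batches makes it exactly unbiased without diagonal corrections and reduces its
  variance to that of linear functionals, where samples of fixed size behave no worse than
  independent counts. The sizes come from the noise-to-signal ratio, of order
  \<open>n / (m * \<epsilon>^2 * sqrt k)\<close>. Keeping it small forces \<open>m\<close>, and
  balancing \<open>k\<close> against \<open>m\<close> means
  \<open>k * sqrt k = n / \<epsilon>^2\<close>. The cap \<open>k \<le> n\<close> is there because
  the guaranteed signal is \<open>\<epsilon>^2 / (n + 3 * k)\<close>; when it is active,
  \<open>m\<close> becomes of order \<open>sqrt n / \<epsilon>^2\<close>. In the lower bound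
  adaptivity costs only a constant: handing out one sample from every source at each time triples
  the number of samples and turns the algorithm into a fixed function of a tape. Random tilts cancel
  unless a pair is hit at least twice, so only collisions carry information.\<close>

lemma prob_verdict_eq:
  "prob_verdict A p q1 q2 v = pmf (map_pmf fst (run (source_dist p q1 q2) A)) v"
proof -
  have "{(w, m :: nat). w = v} = fst -` {v}" by auto
  then show ?thesis
    unfolding prob_verdict_def by (simp only: pmf_map)
qed

lemma prob_verdict_Accept_Reject:
  "prob_verdict A p q1 q2 Accept + prob_verdict A p q1 q2 Reject = 1"
proof -
  have "(\<Sum>v\<in>{Accept, Reject}. pmf (map_pmf fst (run (source_dist p q1 q2) A)) v) = 1"
    by (rule sum_pmf_eq_1) (use verdict.exhaust in auto)
  then show ?thesis by (simp add: prob_verdict_eq)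
qed

primrec draw :: "source \<Rightarrow> nat \<Rightarrow> (nat list \<Rightarrow> algorithm) \<Rightarrow> algorithm" where
  "draw s 0 c = c []"
| "draw s (Suc j) c = Sample s (\<lambda>x. draw s j (\<lambda>xs. c (x # xs)))"

lemma run_draw:
  "run D (draw s j c) =
     bind_pmf (replicate_pmf j (D s)) (\<lambda>xs. map_pmf (\<lambda>(v, m). (v, m + j)) (run D (c xs)))"
proof (induction j arbitrary: c)
  case 0
  then show ?case by (simp add: bind_return_pmf case_prod_unfold)
next
  case (Suc j)
  then show ?case
    by (simp add: map_bind_pmf bind_assoc_pmf bind_return_pmf pmf.map_comp o_def case_prod_unfold)
qed

type_synonym batch = "nat list \<times> nat list \<times> nat list"

definition draw_batch :: "nat \<Rightarrow> (batch \<Rightarrow> algorithm) \<Rightarrow> algorithm" where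
  "draw_batch j c =
     draw FromP j (\<lambda>xs. draw FromQ1 j (\<lambda>ys. draw FromQ2 j (\<lambda>zs. c (xs, ys, zs))))"

definition batch_pmf :: "nat pmf \<Rightarrow> nat pmf \<Rightarrow> nat pmf \<Rightarrow> nat \<Rightarrow> batch pmf" where
  "batch_pmf p q1 q2 j =
     pair_pmf (replicate_pmf j p) (pair_pmf (replicate_pmf j q1) (replicate_pmf j q2))"

lemma run_draw_batch:
  "run (source_dist p q1 q2) (draw_batch j c) =
     bind_pmf (batch_pmf p q1 q2 j)
       (\<lambda>\<omega>. map_pmf (\<lambda>(v, m). (v, m + 3 * j)) (run (source_dist p q1 q2) (c \<omega>)))"
proof -
  have [simp]: "m + j + j + j = m + 3 * j" for m :: nat by simp
  show ?thesis
    by (simp add: draw_batch_def batch_pmf_def run_draw pair_pmf_def map_bind_pmf bind_assoc_pmf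
        bind_return_pmf pmf.map_comp o_def case_prod_unfold)
qed

text \<open>Batch \<open>a\<close> is meant for the weights, \<open>b\<close> and \<open>c\<close>
  for the two factors of the bilinear form. Every batch queries all three sources, hence
  \<open>3 * k + 6 * m\<close> samples.\<close>

definition three_batch_test ::
    "nat \<Rightarrow> nat \<Rightarrow> (batch \<Rightarrow> batch \<Rightarrow> batch \<Rightarrow> bool) \<Rightarrow> algorithm" where
  "three_batch_test k m dec = draw_batch k (\<lambda>a. draw_batch m (\<lambda>b. draw_batch m (\<lambda>c.
     Output (if dec a b c then Accept else Reject))))"

lemma run_three_batch_test:
  "run (source_dist p q1 q2) (three_batch_test k m dec) =
     map_pmf (\<lambda>(a, b, c). (if dec a b c then Accept else Reject, 3 * k + 6 * m))
       (pair_pmf (batch_pmf p q1 q2 k) (pair_pmf (batch_pmf p q1 q2 m) (batch_pmf p q1 q2 m)))"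
  by (simp add: three_batch_test_def run_draw_batch pair_pmf_def map_bind_pmf bind_assoc_pmf
      bind_return_pmf pmf.map_comp o_def case_prod_unfold algebra_simps)

lemma prob_verdict_three_batch_test:
  "prob_verdict (three_batch_test k m dec) p q1 q2 v =
     measure_pmf.prob
       (pair_pmf (batch_pmf p q1 q2 k) (pair_pmf (batch_pmf p q1 q2 m) (batch_pmf p q1 q2 m)))
       {(a, b, c). dec a b c = (v = Accept)}"
proof -
  have "(\<lambda>(a, b, c). (if dec a b c then Accept else Reject, 3 * k + 6 * m)) -` {(w, m). w = v} =
      {(a, b, c). dec a b c = (v = Accept)}"
    by (cases v) (auto split: if_splits)
  then show ?thesis
    by (simp add: prob_verdict_def run_three_batch_test)
qed

lemma uses_at_most_three_batch_test:
  assumes "real (3 * k + 6 * m) \<le> B"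
  shows "uses_at_most n (three_batch_test k m dec) B"
  using assms by (auto simp: uses_at_most_def run_three_batch_test)

section \<open>Unbiased estimators with small linear variance\<close>

abbreviation Expect :: "'a pmf \<Rightarrow> ('a \<Rightarrow> real) \<Rightarrow> real" where
  "Expect p \<equiv> measure_pmf.expectation p"

text \<open>The sample spaces of the upper bound have finite support, so expectations are finite
  sums and no integrability conditions arise.\<close>

lemma Expect_eq_sum:
  assumes "finite (set_pmf p)"
  shows "Expect p f = (\<Sum>x\<in>set_pmf p. pmf p x * f x)"
  by (subst integral_measure_pmf[OF assms]) (auto simp: set_pmf_iff)

lemma Expect_bind:
  assumes "finite (set_pmf p)" "\<And>x. x \<in> set_pmf p \<Longrightarrow> finite (set_pmf (f x))"
  shows "Expect (bind_pmf p f) h = Expect p (\<lambda>x. Expect (f x) h)"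
  by (subst pmf_expectation_bind[OF assms order_refl]) (simp_all add: Expect_eq_sum[OF assms(1)])

lemma Expect_pair:
  assumes "finite (set_pmf p)" "finite (set_pmf q)"
  shows "Expect (pair_pmf p q) f = Expect p (\<lambda>x. Expect q (\<lambda>y. f (x, y)))"
  unfolding pair_pmf_def using assms by (subst Expect_bind; simp add: Expect_bind)+

lemma Expect_add:
  assumes "finite (set_pmf p)"
  shows "Expect p (\<lambda>x. f x + g x) = Expect p f + Expect p g"
  using assms by (simp add: Expect_eq_sum distrib_left sum.distrib)

lemma Expect_sum:
  assumes "finite (set_pmf p)"
  shows "Expect p (\<lambda>x. \<Sum>i\<in>I. f i x) = (\<Sum>i\<in>I. Expect p (f i))"
  using assms by (simp add: Expect_eq_sum sum_distrib_left sum.swap[of _ I])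

lemma Expect_mono:
  assumes "finite (set_pmf p)" "\<And>x. x \<in> set_pmf p \<Longrightarrow> f x \<le> g x"
  shows "Expect p f \<le> Expect p g"
  unfolding Expect_eq_sum[OF assms(1)] using assms(2) by (intro sum_mono mult_left_mono) auto

lemma Expect_cong:
  assumes "\<And>x. x \<in> set_pmf p \<Longrightarrow> f x = g x"
  shows "Expect p f = Expect p g"
  using assms by (intro integral_cong_AE) (auto simp: AE_measure_pmf_iff)

text \<open>Markov's inequality for an arbitrary majorant of the indicator. In
  \<open>soundness\<close> the majorant is a sum of four scaled squares, which yields a union bound
  in one step.\<close>

lemma prob_le_Expect:
  assumes "finite (set_pmf p)" "\<And>x. x \<in> set_pmf p \<Longrightarrow> 0 \<le> g x"
    "\<And>x. x \<in> set_pmf p \<Longrightarrow> x \<in> A \<Longrightarrow> 1 \<le> g x"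
  shows "measure_pmf.prob p A \<le> Expect p g"
proof -
  have "measure_pmf.prob p A = Expect p (indicator A)" by simp
  also have "\<dots> \<le> Expect p g"
    using assms by (intro Expect_mono) (auto simp: indicator_def)
  finally show ?thesis .
qed

lemma prob_pair:
  assumes "finite (set_pmf p)" "finite (set_pmf q)"
  shows "measure_pmf.prob (pair_pmf p q) {(x, y). P x y} =
    Expect p (\<lambda>x. measure_pmf.prob q {y. P x y})"
proof -
  have "measure_pmf.prob (pair_pmf p q) {(x, y). P x y} =
      Expect (pair_pmf p q) (indicator {(x, y). P x y})" by simp
  also have "\<dots> = Expect p (\<lambda>x. Expect q (indicator {y. P x y}))"
  proof -
    have "indicator {(x, y). P x y} (x, y) = (indicator {y. P x y} y :: real)" for x y
      by (simp add: indicator_def)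
    then show ?thesis by (simp only: Expect_pair[OF assms])
  qed
  finally show ?thesis by simp
qed

lemma finite_set_replicate_pmf [simp]:
  "finite (set_pmf p) \<Longrightarrow> finite (set_pmf (replicate_pmf m p))"
  by (induction m) auto

lemma finite_set_batch_pmf [simp]:
  "finite (set_pmf p) \<Longrightarrow> finite (set_pmf q1) \<Longrightarrow> finite (set_pmf q2) \<Longrightarrow>
    finite (set_pmf (batch_pmf p q1 q2 j))"
  by (simp add: batch_pmf_def)

lemma Expect_replicate_Suc:
  assumes "finite (set_pmf p)"
  shows "Expect (replicate_pmf (Suc m) p) f = Expect p (\<lambda>x. Expect (replicate_pmf m p) (\<lambda>xs. f (x # xs)))"
  using assms by (simp add: Expect_bind)

text \<open>Induction on the number of samples: the cross term is a multiple of the mean of the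
  remaining sum, which vanishes, so variances add. The second claim needs the first, hence the joint
  statement.\<close>

lemma iid_sum_moments:
  assumes p: "finite (set_pmf p)" and g: "Expect p g = 0"
  shows "Expect (replicate_pmf m p) (\<lambda>xs. \<Sum>x\<leftarrow>xs. g x) = 0 \<and>
    Expect (replicate_pmf m p) (\<lambda>xs. (\<Sum>x\<leftarrow>xs. g x)\<^sup>2) = m * Expect p (\<lambda>x. (g x)\<^sup>2)"
proof (induction m)
  case (Suc m)
  let ?R = "replicate_pmf m p"
  let ?S = "\<lambda>xs. \<Sum>x\<leftarrow>xs. g x"
  have R: "finite (set_pmf ?R)" using p by simp
  have "Expect (replicate_pmf (Suc m) p) ?S = Expect p (\<lambda>x. g x + Expect ?R ?S)"
    unfolding Expect_replicate_Suc[OF p] by (simp add: Expect_add[OF R])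
  also have "\<dots> = 0" using Suc g by simp
  finally have 1: "Expect (replicate_pmf (Suc m) p) ?S = 0" .
  have "Expect (replicate_pmf (Suc m) p) (\<lambda>xs. (?S xs)\<^sup>2) =
      Expect p (\<lambda>x. Expect ?R (\<lambda>xs. (g x)\<^sup>2 + (2 * g x * ?S xs + (?S xs)\<^sup>2)))"
    unfolding Expect_replicate_Suc[OF p] by (simp add: power2_sum algebra_simps)
  also have "\<dots> = Expect p (\<lambda>x. (g x)\<^sup>2 + (2 * g x * Expect ?R ?S + Expect ?R (\<lambda>xs. (?S xs)\<^sup>2)))"
    by (simp add: Expect_add[OF R])
  also have "\<dots> = Expect p (\<lambda>x. (g x)\<^sup>2) + m * Expect p (\<lambda>x. (g x)\<^sup>2)"
    using Suc by (simp add: Expect_add[OF p])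
  finally show ?case using 1 by (simp add: algebra_simps)
qed simp

text \<open>
  The proxy \<open>r\<close> bounds the variance of every linear functional of \<open>F\<close>; it is what survives of the
  negatively correlated multinomial counts.
\<close>
definition approximates ::
    "nat \<Rightarrow> 'a pmf \<Rightarrow> ('a \<Rightarrow> nat \<Rightarrow> real) \<Rightarrow> (nat \<Rightarrow> real) \<Rightarrow> (nat \<Rightarrow> real) \<Rightarrow> bool" where
  "approximates n \<mu> F f r \<longleftrightarrow> finite (set_pmf \<mu>) \<and>
     (\<forall>h. Expect \<mu> (\<lambda>\<omega>. \<Sum>i\<in>{1..n}. h i * (F \<omega> i - f i)) = 0 \<and>
          Expect \<mu> (\<lambda>\<omega>. (\<Sum>i\<in>{1..n}. h i * (F \<omega> i - f i))\<^sup>2) \<le> (\<Sum>i\<in>{1..n}. (h i)\<^sup>2 * r i))"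

definition empirical :: "nat \<Rightarrow> nat list \<Rightarrow> nat \<Rightarrow> real" where
  "empirical m xs i = count_list xs i / m"

lemma finite_dists_on: "p \<in> dists_on n \<Longrightarrow> finite (set_pmf p)"
  unfolding dists_on_def by (auto intro: finite_subset)

lemma sum_list_count:
  fixes h :: "nat \<Rightarrow> real"
  assumes "set xs \<subseteq> {1..n}"
  shows "(\<Sum>i\<in>{1..n}. h i * count_list xs i) = (\<Sum>x\<leftarrow>xs. h x)"
  using assms
proof (induction xs)
  case (Cons x xs)
  have "(\<Sum>i\<in>{1..n}. h i * count_list (x # xs) i) =
      (\<Sum>i\<in>{1..n}. h i * count_list xs i + (if i = x then h i else 0))"
    by (intro sum.cong refl) (simp add: algebra_simps)
  also have "\<dots> = (\<Sum>i\<in>{1..n}. h i * count_list xs i) + h x"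
    using Cons.prems by (simp add: sum.distrib)
  finally show ?case using Cons by simp
qed simp

text \<open>A linear functional of the empirical frequencies is an average of independent centred
  terms \<open>g x\<close>. Its variance is the second moment of \<open>h\<close> minus
  \<open>\<mu>\<^sup>2\<close>, divided by \<open>m\<close>; dropping \<open>\<mu>\<^sup>2\<close>
  leaves a diagonal proxy.\<close>

lemma approximates_empirical:
  assumes p: "p \<in> dists_on n" and m: "0 < m"
  shows "approximates n (replicate_pmf m p) (empirical m) (pmf p) (\<lambda>i. pmf p i / m)"
  unfolding approximates_def
proof (intro conjI allI)
  have fin: "finite (set_pmf p)" using p by (rule finite_dists_on)
  have supp: "set_pmf p \<subseteq> {1..n}" using p by (simp add: dists_on_def)
  show "finite (set_pmf (replicate_pmf m p))" using fin by simp
  fix h :: "nat \<Rightarrow> real"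
  define \<mu> where "\<mu> = Expect p h"
  define g where "g x = h x - \<mu>" for x
  have E: "Expect p f = (\<Sum>i\<in>{1..n}. pmf p i * f i)" for f
    by (subst integral_measure_pmf_real[of "{1..n}"]) (use supp in \<open>auto simp: mult.commute\<close>)
  have p1: "(\<Sum>i\<in>{1..n}. pmf p i) = 1" using supp by (simp add: sum_pmf_eq_1)
  have g0: "Expect p g = 0"
    unfolding g_def E by (simp add: right_diff_distrib sum_subtractf sum_distrib_right[symmetric])
      (use p1 in \<open>simp add: \<mu>_def E\<close>)
  have eq: "(\<Sum>i\<in>{1..n}. h i * (empirical m xs i - pmf p i)) = (\<Sum>x\<leftarrow>xs. g x) / m"
    if "xs \<in> set_pmf (replicate_pmf m p)" for xs
  proof -
    have xs: "set xs \<subseteq> {1..n}" "length xs = m"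
      using that supp by (auto simp: set_replicate_pmf)
    have "(\<Sum>i\<in>{1..n}. h i * (empirical m xs i - pmf p i)) =
        (\<Sum>i\<in>{1..n}. h i * count_list xs i) / m - \<mu>"
      by (simp add: empirical_def right_diff_distrib sum_subtractf sum_divide_distrib \<mu>_def E mult.commute)
    also have "\<dots> = (\<Sum>x\<leftarrow>xs. h x) / m - \<mu>"
      by (simp only: sum_list_count[OF xs(1)])
    also have "\<dots> = (\<Sum>x\<leftarrow>xs. g x) / m"
      using m xs by (simp add: g_def sum_list_subtractf sum_list_triv field_simps)
    finally show ?thesis .
  qed
  have "Expect (replicate_pmf m p) (\<lambda>xs. \<Sum>i\<in>{1..n}. h i * (empirical m xs i - pmf p i)) =
      Expect (replicate_pmf m p) (\<lambda>xs. (\<Sum>x\<leftarrow>xs. g x) / m)"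
    by (rule Expect_cong) (rule eq)
  then show "Expect (replicate_pmf m p) (\<lambda>xs. \<Sum>i\<in>{1..n}. h i * (empirical m xs i - pmf p i)) = 0"
    using iid_sum_moments[OF fin g0, of m] by simp
  have "Expect (replicate_pmf m p) (\<lambda>xs. (\<Sum>i\<in>{1..n}. h i * (empirical m xs i - pmf p i))\<^sup>2) =
      Expect (replicate_pmf m p) (\<lambda>xs. (\<Sum>x\<leftarrow>xs. g x)\<^sup>2 / m\<^sup>2)"
    by (rule Expect_cong) (simp only: eq power_divide of_nat_power)
  also have "\<dots> = Expect p (\<lambda>x. (g x)\<^sup>2) / m"
    using iid_sum_moments[OF fin g0, of m] m by (simp add: power2_eq_square)
  also have "Expect p (\<lambda>x. (g x)\<^sup>2) = (\<Sum>i\<in>{1..n}. pmf p i * (h i)\<^sup>2) - \<mu>\<^sup>2"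
  proof -
    have "Expect p (\<lambda>x. (g x)\<^sup>2) =
        (\<Sum>i\<in>{1..n}. pmf p i * (h i)\<^sup>2 - 2 * \<mu> * (pmf p i * h i) + \<mu>\<^sup>2 * pmf p i)"
      unfolding E g_def by (intro sum.cong refl) (simp add: power2_diff algebra_simps)
    also have "\<dots> = (\<Sum>i\<in>{1..n}. pmf p i * (h i)\<^sup>2) - 2 * \<mu> * \<mu> + \<mu>\<^sup>2"
      using p1 by (simp add: sum.distrib sum_subtractf sum_distrib_left[symmetric] \<mu>_def E)
    finally show ?thesis by (simp add: power2_eq_square)
  qed
  also have "((\<Sum>i\<in>{1..n}. pmf p i * (h i)\<^sup>2) - \<mu>\<^sup>2) / m \<le> (\<Sum>i\<in>{1..n}. pmf p i * (h i)\<^sup>2) / m"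
    by (intro divide_right_mono) auto
  also have "\<dots> = (\<Sum>i\<in>{1..n}. (h i)\<^sup>2 * (pmf p i / m))"
    by (simp add: sum_divide_distrib mult.commute)
  finally show "Expect (replicate_pmf m p)
      (\<lambda>xs. (\<Sum>i\<in>{1..n}. h i * (empirical m xs i - pmf p i))\<^sup>2) \<le>
      (\<Sum>i\<in>{1..n}. (h i)\<^sup>2 * (pmf p i / m))" .
qed

text \<open>Independence and centring kill the cross term, so the proxies add with squared
  coefficients.\<close>

lemma approximates_combination:
  assumes F: "approximates n \<mu> F f r" and G: "approximates n \<nu> G g s"
  shows "approximates n (pair_pmf \<mu> \<nu>) (\<lambda>(x, y) i. c * F x i + d * G y i)
    (\<lambda>i. c * f i + d * g i) (\<lambda>i. c\<^sup>2 * r i + d\<^sup>2 * s i)"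
  unfolding approximates_def
proof (intro conjI allI)
  have fin: "finite (set_pmf \<mu>)" "finite (set_pmf \<nu>)"
    using F G by (simp_all add: approximates_def)
  show "finite (set_pmf (pair_pmf \<mu> \<nu>))" using fin by simp
  fix h :: "nat \<Rightarrow> real"
  define X where "X x = (\<Sum>i\<in>{1..n}. h i * (F x i - f i))" for x
  define Y where "Y y = (\<Sum>i\<in>{1..n}. h i * (G y i - g i))" for y
  have X: "Expect \<mu> X = 0" "Expect \<mu> (\<lambda>x. (X x)\<^sup>2) \<le> (\<Sum>i\<in>{1..n}. (h i)\<^sup>2 * r i)"
    using F unfolding approximates_def X_def by auto
  have Y: "Expect \<nu> Y = 0" "Expect \<nu> (\<lambda>x. (Y x)\<^sup>2) \<le> (\<Sum>i\<in>{1..n}. (h i)\<^sup>2 * s i)"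
    using G unfolding approximates_def Y_def by auto
  have eq: "(\<Sum>i\<in>{1..n}. h i * ((case z of (x, y) \<Rightarrow> \<lambda>i. c * F x i + d * G y i) i -
      (c * f i + d * g i))) = c * X (fst z) + d * Y (snd z)" for z
    unfolding X_def Y_def sum_distrib_left sum.distrib[symmetric]
    by (intro sum.cong refl) (simp add: case_prod_unfold algebra_simps)
  show "Expect (pair_pmf \<mu> \<nu>) (\<lambda>z. \<Sum>i\<in>{1..n}. h i *
      ((case z of (x, y) \<Rightarrow> \<lambda>i. c * F x i + d * G y i) i - (c * f i + d * g i))) = 0"
    unfolding eq Expect_pair[OF fin] using X Y by (simp add: Expect_add[OF fin(2)] Expect_add[OF fin(1)])
  have "Expect (pair_pmf \<mu> \<nu>) (\<lambda>z. (c * X (fst z) + d * Y (snd z))\<^sup>2) =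
      Expect \<mu> (\<lambda>x. Expect \<nu> (\<lambda>y. c\<^sup>2 * (X x)\<^sup>2 + (2 * c * d * X x * Y y + d\<^sup>2 * (Y y)\<^sup>2)))"
    unfolding Expect_pair[OF fin] by (simp add: power2_sum power_mult_distrib algebra_simps)
  also have "\<dots> = c\<^sup>2 * Expect \<mu> (\<lambda>x. (X x)\<^sup>2) + d\<^sup>2 * Expect \<nu> (\<lambda>y. (Y y)\<^sup>2)"
    using X Y by (simp add: Expect_add[OF fin(2)] Expect_add[OF fin(1)])
  also have "\<dots> \<le> c\<^sup>2 * (\<Sum>i\<in>{1..n}. (h i)\<^sup>2 * r i) + d\<^sup>2 * (\<Sum>i\<in>{1..n}. (h i)\<^sup>2 * s i)"
    using X Y by (intro add_mono mult_left_mono) auto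
  also have "\<dots> = (\<Sum>i\<in>{1..n}. (h i)\<^sup>2 * (c\<^sup>2 * r i + d\<^sup>2 * s i))"
    unfolding sum_distrib_left sum.distrib[symmetric]
    by (intro sum.cong refl) (simp add: algebra_simps)
  finally show "Expect (pair_pmf \<mu> \<nu>) (\<lambda>z. (\<Sum>i\<in>{1..n}. h i *
      ((case z of (x, y) \<Rightarrow> \<lambda>i. c * F x i + d * G y i) i - (c * f i + d * g i)))\<^sup>2) \<le>
      (\<Sum>i\<in>{1..n}. (h i)\<^sup>2 * (c\<^sup>2 * r i + d\<^sup>2 * s i))"
    unfolding eq .
qed

lemma approximates_finite: "approximates n \<mu> F f r \<Longrightarrow> finite (set_pmf \<mu>)"
  by (simp add: approximates_def)

lemma approximates_second_moment:
  assumes "approximates n \<mu> F f r"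
  shows "Expect \<mu> (\<lambda>\<omega>. (\<Sum>i\<in>{1..n}. h i * (F \<omega> i - f i))\<^sup>2) \<le> (\<Sum>i\<in>{1..n}. (h i)\<^sup>2 * r i)"
  using assms by (simp add: approximates_def)

lemma approximates_mono:
  assumes "approximates n \<mu> F f r" "\<And>i. i \<in> {1..n} \<Longrightarrow> r i \<le> s i"
  shows "approximates n \<mu> F f s"
  unfolding approximates_def
proof (intro conjI allI)
  fix h :: "nat \<Rightarrow> real"
  show "Expect \<mu> (\<lambda>\<omega>. \<Sum>i\<in>{1..n}. h i * (F \<omega> i - f i)) = 0"
    using assms(1) unfolding approximates_def by blast
  have "(\<Sum>i\<in>{1..n}. (h i)\<^sup>2 * r i) \<le> (\<Sum>i\<in>{1..n}. (h i)\<^sup>2 * s i)"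
    using assms(2) by (intro sum_mono mult_left_mono) auto
  with approximates_second_moment[OF assms(1), of h]
  show "Expect \<mu> (\<lambda>\<omega>. (\<Sum>i\<in>{1..n}. h i * (F \<omega> i - f i))\<^sup>2) \<le> (\<Sum>i\<in>{1..n}. (h i)\<^sup>2 * s i)"
    by linarith
qed (use assms(1) in \<open>rule approximates_finite\<close>)

section \<open>Weighted inner products and the variance of bilinear estimates\<close>

definition inner_w :: "nat \<Rightarrow> (nat \<Rightarrow> real) \<Rightarrow> (nat \<Rightarrow> real) \<Rightarrow> (nat \<Rightarrow> real) \<Rightarrow> real" where
  "inner_w n w f g = (\<Sum>i\<in>{1..n}. w i * f i * g i)"

lemma inner_w_nonneg:
  assumes "\<And>i. i \<in> {1..n} \<Longrightarrow> 0 \<le> w i"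
  shows "0 \<le> inner_w n w f f"
  unfolding inner_w_def
proof (rule sum_nonneg)
  fix i assume "i \<in> {1..n}"
  then have "0 \<le> w i * (f i * f i)" using assms by (intro mult_nonneg_nonneg zero_le_square)
  then show "0 \<le> w i * f i * f i" by (simp add: mult.assoc)
qed

text \<open>The error splits into the product of \<open>F - f\<close> with \<open>G\<close> and that
  of \<open>f\<close> with \<open>G - g\<close>. With the other factor frozen each is a centred
  linear functional, so the proxy \<open>r\<close> bounds its variance. The bound on
  \<open>inner_w n w r r\<close> together with \<open>w i \<le> 1\<close> forces
  \<open>w i * r i \<le> b\<close> pointwise, which turns these variances into \<open>b\<close>
  times weighted norms.\<close>

lemma bilinear_variance:
  assumes F: "approximates n \<mu> F f r" and G: "approximates n \<nu> G g r"
    and w: "\<And>i. i \<in> {1..n} \<Longrightarrow> 0 \<le> w i \<and> w i \<le> 1"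
    and r: "\<And>i. i \<in> {1..n} \<Longrightarrow> 0 \<le> r i"
    and b: "0 \<le> b" "inner_w n w r r \<le> b\<^sup>2"
  shows "Expect (pair_pmf \<mu> \<nu>) (\<lambda>(x, y). (inner_w n w (F x) (G y) - inner_w n w f g)\<^sup>2)
    \<le> 4 * b * (inner_w n w f f + inner_w n w g g) + 4 * b\<^sup>2"
proof -
  have fin: "finite (set_pmf \<mu>)" "finite (set_pmf \<nu>)"
    using F G by (simp_all add: approximates_def)
  define X where "X x y = (\<Sum>i\<in>{1..n}. (w i * G y i) * (F x i - f i))" for x y
  define Y where "Y y = (\<Sum>i\<in>{1..n}. (w i * f i) * (G y i - g i))" for y
  have wr: "w i * r i \<le> b" if i: "i \<in> {1..n}" for i
  proof -
    have "(w i * r i)\<^sup>2 = w i * (w i * (r i)\<^sup>2)" by (simp add: power2_eq_square mult_ac)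
    also have "\<dots> \<le> 1 * (w i * (r i)\<^sup>2)"
      using w[OF i] by (intro mult_right_mono) auto
    also have "\<dots> \<le> inner_w n w r r"
      unfolding inner_w_def using w r i
      by (intro order_trans[OF _ member_le_sum[of i]]) (auto simp: power2_eq_square)
    finally have "(w i * r i)\<^sup>2 \<le> b\<^sup>2" using b by linarith
    then show ?thesis using b(1) by (rule power2_le_imp_le)
  qed
  have wwr: "(\<Sum>i\<in>{1..n}. (w i * h i)\<^sup>2 * r i) \<le> b * inner_w n w h h" for h
  proof -
    have "(\<Sum>i\<in>{1..n}. (w i * h i)\<^sup>2 * r i) = (\<Sum>i\<in>{1..n}. (w i * r i) * (w i * (h i)\<^sup>2))"
      by (intro sum.cong refl) (simp add: power2_eq_square mult_ac)
    also have "\<dots> \<le> (\<Sum>i\<in>{1..n}. b * (w i * (h i)\<^sup>2))"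
      using wr w by (intro sum_mono mult_right_mono) auto
    also have "\<dots> = b * inner_w n w h h"
      by (simp add: inner_w_def sum_distrib_left power2_eq_square mult_ac)
    finally show ?thesis .
  qed
  \<comment> \<open>The functional that picks out coordinate \<open>i\<close> specialises the linear
    variance bound to a coordinatewise one.\<close>
  have G2: "Expect \<nu> (\<lambda>y. (G y i)\<^sup>2) \<le> 2 * (g i)\<^sup>2 + 2 * r i" if i: "i \<in> {1..n}" for i
  proof -
    have "Expect \<nu> (\<lambda>y. (G y i - g i)\<^sup>2) \<le> r i"
      using approximates_second_moment[OF G, of "\<lambda>j. if j = i then 1 else 0"] i
      by (simp add: if_distrib[of "\<lambda>x. x * _"] if_distrib[of "\<lambda>x. x\<^sup>2"] sum.delta cong: if_cong)
    moreover have "Expect \<nu> (\<lambda>y. (G y i)\<^sup>2) \<le> Expect \<nu> (\<lambda>y. 2 * (g i)\<^sup>2 + 2 * (G y i - g i)\<^sup>2)"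
    proof (rule Expect_mono[OF fin(2)])
      fix y
      have "0 \<le> (G y i - 2 * g i)\<^sup>2" by simp
      then show "(G y i)\<^sup>2 \<le> 2 * (g i)\<^sup>2 + 2 * (G y i - g i)\<^sup>2"
        by (simp add: power2_eq_square algebra_simps)
    qed
    ultimately show ?thesis by (simp add: Expect_add[OF fin(2)])
  qed
  have EX: "Expect \<nu> (\<lambda>y. Expect \<mu> (\<lambda>x. (X x y)\<^sup>2)) \<le> 2 * b * inner_w n w g g + 2 * b\<^sup>2"
  proof -
    have "Expect \<nu> (\<lambda>y. Expect \<mu> (\<lambda>x. (X x y)\<^sup>2)) \<le>
        Expect \<nu> (\<lambda>y. \<Sum>i\<in>{1..n}. (w i * G y i)\<^sup>2 * r i)"
      unfolding X_def by (intro Expect_mono[OF fin(2)] approximates_second_moment[OF F])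
    also have "\<dots> = (\<Sum>i\<in>{1..n}. (w i)\<^sup>2 * r i * Expect \<nu> (\<lambda>y. (G y i)\<^sup>2))"
      by (simp add: Expect_sum[OF fin(2)] power_mult_distrib mult_ac)
    also have "\<dots> \<le> (\<Sum>i\<in>{1..n}. (w i)\<^sup>2 * r i * (2 * (g i)\<^sup>2 + 2 * r i))"
      using r by (intro sum_mono mult_left_mono G2) auto
    also have "\<dots> = 2 * (\<Sum>i\<in>{1..n}. (w i * g i)\<^sup>2 * r i) + 2 * (\<Sum>i\<in>{1..n}. (w i)\<^sup>2 * (r i)\<^sup>2)"
      unfolding sum_distrib_left sum.distrib[symmetric]
      by (intro sum.cong refl) (simp add: power2_eq_square algebra_simps)
    also have "\<dots> \<le> 2 * (b * inner_w n w g g) + 2 * b\<^sup>2"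
    proof (intro add_mono mult_left_mono wwr)
      have "(\<Sum>i\<in>{1..n}. (w i)\<^sup>2 * (r i)\<^sup>2) \<le> inner_w n w r r"
        unfolding inner_w_def
      proof (rule sum_mono)
        fix i assume i: "i \<in> {1..n}"
        have "(w i)\<^sup>2 * (r i)\<^sup>2 = w i * (w i * (r i)\<^sup>2)" by (simp add: power2_eq_square mult_ac)
        also have "\<dots> \<le> 1 * (w i * (r i)\<^sup>2)"
          using w[OF i] by (intro mult_right_mono) auto
        finally show "(w i)\<^sup>2 * (r i)\<^sup>2 \<le> w i * r i * r i"
          by (simp add: power2_eq_square mult_ac)
      qed
      then show "(\<Sum>i\<in>{1..n}. (w i)\<^sup>2 * (r i)\<^sup>2) \<le> b\<^sup>2" using b by linarith
    qed auto
    finally show ?thesis by simp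
  qed
  have EY: "Expect \<nu> (\<lambda>y. (Y y)\<^sup>2) \<le> b * inner_w n w f f"
    using approximates_second_moment[OF G, of "\<lambda>i. w i * f i"] wwr[of f]
    unfolding Y_def by linarith
  have dev: "inner_w n w (F x) (G y) - inner_w n w f g = X x y + Y y" for x y
    unfolding inner_w_def X_def Y_def sum.distrib[symmetric] sum_subtractf[symmetric]
    by (intro sum.cong refl) (simp add: algebra_simps)
  have "Expect (pair_pmf \<mu> \<nu>) (\<lambda>(x, y). (inner_w n w (F x) (G y) - inner_w n w f g)\<^sup>2)
      \<le> Expect (pair_pmf \<mu> \<nu>) (\<lambda>(x, y). 2 * (X x y)\<^sup>2 + 2 * (Y y)\<^sup>2)"
  proof (rule Expect_mono)
    show "finite (set_pmf (pair_pmf \<mu> \<nu>))" using fin by simp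
    have "(s + t)\<^sup>2 \<le> 2 * s\<^sup>2 + 2 * t\<^sup>2" for s t :: real
      using zero_le_power2[of "s - t"] by (simp add: power2_eq_square algebra_simps)
    then show "(case z of (x, y) \<Rightarrow> (inner_w n w (F x) (G y) - inner_w n w f g)\<^sup>2) \<le>
        (case z of (x, y) \<Rightarrow> 2 * (X x y)\<^sup>2 + 2 * (Y y)\<^sup>2)" for z
      by (simp add: case_prod_unfold dev)
  qed
  also have "\<dots> = Expect \<mu> (\<lambda>x. Expect \<nu> (\<lambda>y. 2 * (X x y)\<^sup>2 + 2 * (Y y)\<^sup>2))"
    by (simp add: Expect_pair[OF fin])
  also have "\<dots> = 2 * Expect \<mu> (\<lambda>x. Expect \<nu> (\<lambda>y. (X x y)\<^sup>2)) + 2 * Expect \<nu> (\<lambda>y. (Y y)\<^sup>2)"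
    by (simp add: Expect_add[OF fin(2)] Expect_add[OF fin(1)])
  also have "Expect \<mu> (\<lambda>x. Expect \<nu> (\<lambda>y. (X x y)\<^sup>2)) = Expect \<nu> (\<lambda>y. Expect \<mu> (\<lambda>x. (X x y)\<^sup>2))"
    unfolding Expect_eq_sum[OF fin(1)] Expect_eq_sum[OF fin(2)] sum_distrib_left
    by (subst sum.swap) (simp add: mult_ac)
  finally have "Expect (pair_pmf \<mu> \<nu>) (\<lambda>(x, y). (inner_w n w (F x) (G y) - inner_w n w f g)\<^sup>2)
      \<le> 2 * (2 * b * inner_w n w g g + 2 * b\<^sup>2) + 2 * (b * inner_w n w f f)"
    by (rule order_trans) (intro add_mono mult_left_mono EX EY; simp)
  moreover have "0 \<le> b * inner_w n w f f"
    using b w by (intro mult_nonneg_nonneg inner_w_nonneg) auto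
  ultimately show ?thesis by (simp add: algebra_simps)
qed

definition comb_est :: "nat \<Rightarrow> real \<Rightarrow> real \<Rightarrow> real \<Rightarrow> batch \<Rightarrow> nat \<Rightarrow> real" where
  "comb_est m c0 c1 c2 = (\<lambda>(xs, ys, zs) i.
     c0 * empirical m xs i + (c1 * empirical m ys i + c2 * empirical m zs i))"

text \<open>Coefficients bounded by 1 only shrink the proxies, so one proxy serves all combinations;
  \<open>bilinear_variance\<close> needs the same \<open>r\<close> for both factors.\<close>

lemma approximates_comb_est:
  assumes D: "p \<in> dists_on n" "q1 \<in> dists_on n" "q2 \<in> dists_on n" and m: "0 < m"
    and c: "\<bar>c0\<bar> \<le> 1" "\<bar>c1\<bar> \<le> 1" "\<bar>c2\<bar> \<le> 1"
  shows "approximates n (batch_pmf p q1 q2 m) (comb_est m c0 c1 c2)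
    (\<lambda>i. c0 * pmf p i + (c1 * pmf q1 i + c2 * pmf q2 i))
    (\<lambda>i. (pmf p i + pmf q1 i + pmf q2 i) / m)"
proof -
  have sq: "c0\<^sup>2 \<le> 1" "c1\<^sup>2 \<le> 1" "c2\<^sup>2 \<le> 1" using c by (simp_all add: abs_square_le_1)
  note * = approximates_combination[OF approximates_empirical[OF D(1) m]
      approximates_combination[OF approximates_empirical[OF D(2) m]
        approximates_empirical[OF D(3) m], of c1 c2], of c0 1]
  have F: "(\<lambda>(x, y) i. c0 * empirical m x i +
      1 * (case y of (x, y) \<Rightarrow> \<lambda>i. c1 * empirical m x i + c2 * empirical m y i) i) =
      comb_est m c0 c1 c2"
    by (auto simp: comb_est_def fun_eq_iff)
  have "approximates n (batch_pmf p q1 q2 m) (comb_est m c0 c1 c2)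
      (\<lambda>i. c0 * pmf p i + 1 * (c1 * pmf q1 i + c2 * pmf q2 i))
      (\<lambda>i. c0\<^sup>2 * (pmf p i / m) + 1\<^sup>2 * (c1\<^sup>2 * (pmf q1 i / m) + c2\<^sup>2 * (pmf q2 i / m)))"
    using * unfolding F batch_pmf_def .
  then have "approximates n (batch_pmf p q1 q2 m) (comb_est m c0 c1 c2)
      (\<lambda>i. c0 * pmf p i + (c1 * pmf q1 i + c2 * pmf q2 i))
      (\<lambda>i. c0\<^sup>2 * (pmf p i / m) + 1\<^sup>2 * (c1\<^sup>2 * (pmf q1 i / m) + c2\<^sup>2 * (pmf q2 i / m)))"
    by simp
  then show ?thesis
  proof (rule approximates_mono)
    fix i
    have "c0\<^sup>2 * (pmf p i / m) \<le> 1 * (pmf p i / m)"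
      "c1\<^sup>2 * (pmf q1 i / m) \<le> 1 * (pmf q1 i / m)"
      "c2\<^sup>2 * (pmf q2 i / m) \<le> 1 * (pmf q2 i / m)"
      using sq by (intro mult_right_mono; simp)+
    then show "c0\<^sup>2 * (pmf p i / m) + 1\<^sup>2 * (c1\<^sup>2 * (pmf q1 i / m) + c2\<^sup>2 * (pmf q2 i / m)) \<le>
        (pmf p i + pmf q1 i + pmf q2 i) / m"
      by (simp add: add_divide_distrib)
  qed
qed

lemma inner_w_diff_scaled:
  "inner_w n w (\<lambda>i. f i - t * v i) (\<lambda>i. f' i - t * v' i) =
     inner_w n w f f' - t * (inner_w n w f v' + inner_w n w v f') + t\<^sup>2 * inner_w n w v v'"
  unfolding inner_w_def sum_distrib_left sum.distrib[symmetric] sum_subtractf[symmetric]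
  by (intro sum.cong refl) (simp add: algebra_simps power2_eq_square)

lemma inner_w_commute: "inner_w n w f g = inner_w n w g f"
  unfolding inner_w_def by (intro sum.cong refl) simp

lemma scaled_abs_le:
  fixes c e s :: real
  assumes "(c * e)\<^sup>2 \<le> s\<^sup>2" "0 \<le> s" "0 \<le> c"
  shows "c * \<bar>e\<bar> \<le> s"
  using assms abs_le_square_iff[of "c * e" s] by (simp add: abs_mult)

text \<open>First-order optimality without derivatives: the claim says \<open>t * c \<le> 0\<close>.
  Otherwise moving a small fraction \<open>\<eta>\<close> of the way towards \<open>t\<close> would
  decrease the value.\<close>

lemma quadratic_growth_at_minimum:
  fixes s0 s1 c t :: real
  assumes s1: "0 \<le> s1" and min: "\<And>\<eta>. 0 < \<eta> \<Longrightarrow> \<eta> \<le> 1 \<Longrightarrow> s0 \<le> s0 - 2 * (\<eta> * t) * c + (\<eta> * t)\<^sup>2 * s1"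
  shows "s0 + t\<^sup>2 * s1 \<le> s0 - 2 * t * c + t\<^sup>2 * s1"
proof (rule ccontr)
  assume "\<not> ?thesis"
  then have tc: "0 < t * c" by (simp add: not_le mult.commute)
  define d where "d = t * c + t\<^sup>2 * s1"
  have d: "0 < d" "t * c \<le> d" "t\<^sup>2 * s1 \<le> d"
    using tc s1 by (auto simp: d_def add_pos_nonneg)
  \<comment> \<open>This fraction is at most 1 and makes
    \<open>\<eta> * (t\<^sup>2 * s1) \<le> t * c\<close>, whereas minimality demands at least
    \<open>2 * (t * c)\<close>.\<close>
  define \<eta> where "\<eta> = t * c / d"
  have \<eta>: "0 < \<eta>" "\<eta> \<le> 1" using tc d by (simp_all add: \<eta>_def)
  have "0 \<le> \<eta> * (\<eta> * (t\<^sup>2 * s1) - 2 * (t * c))"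
    using min[OF \<eta>] by (simp add: algebra_simps power2_eq_square)
  then have "2 * (t * c) \<le> \<eta> * (t\<^sup>2 * s1)"
    using \<eta> by (simp add: zero_le_mult_iff)
  also have "\<dots> \<le> \<eta> * d" using d \<eta> by (intro mult_left_mono) auto
  also have "\<dots> = t * c" using d by (simp add: \<eta>_def)
  finally show False using tc by linarith
qed

section \<open>The tester\<close>

definition statistic :: "nat \<Rightarrow> nat \<Rightarrow> (nat \<Rightarrow> real) \<Rightarrow> real \<Rightarrow> batch \<Rightarrow> batch \<Rightarrow> real" where
  "statistic n m w \<alpha> x y =
     inner_w n w (comb_est m 1 (- (1 - \<alpha>)) (- \<alpha>) x) (comb_est m 1 (- (1 - \<alpha>)) (- \<alpha>) y)"

text \<open>
  With the weights \<open>w\<close> fixed, \<open>b\<close> is the noise level of the estimated inner products and \<open>\<delta>\<close> the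
  weighted squared distance to be detected.
\<close>
locale flattened =
  fixes n m :: nat and p q1 q2 :: "nat pmf" and w :: "nat \<Rightarrow> real" and b \<delta> :: real
  assumes D: "p \<in> dists_on n" "q1 \<in> dists_on n" "q2 \<in> dists_on n" and m: "0 < m"
    and w: "\<And>i. i \<in> {1..n} \<Longrightarrow> 0 \<le> w i \<and> w i \<le> 1"
    and b: "0 \<le> b" "inner_w n w (\<lambda>i. (pmf p i + pmf q1 i + pmf q2 i) / m)
      (\<lambda>i. (pmf p i + pmf q1 i + pmf q2 i) / m) \<le> b\<^sup>2"
    and \<delta>: "0 < \<delta>"
begin

abbreviation "B \<equiv> batch_pmf p q1 q2 m"

abbreviation "BB \<equiv> pair_pmf B B"

definition mean :: "real \<Rightarrow> real \<Rightarrow> real \<Rightarrow> nat \<Rightarrow> real" where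
  "mean c0 c1 c2 i = c0 * pmf p i + (c1 * pmf q1 i + c2 * pmf q2 i)"

lemma finite_BB: "finite (set_pmf BB)"
  using D[THEN finite_dists_on] by simp

lemma variance:
  assumes "\<bar>c0\<bar> \<le> 1" "\<bar>c1\<bar> \<le> 1" "\<bar>c2\<bar> \<le> 1" "\<bar>d0\<bar> \<le> 1" "\<bar>d1\<bar> \<le> 1" "\<bar>d2\<bar> \<le> 1"
  shows "Expect BB (\<lambda>(x, y). (inner_w n w (comb_est m c0 c1 c2 x) (comb_est m d0 d1 d2 y) -
      inner_w n w (mean c0 c1 c2) (mean d0 d1 d2))\<^sup>2)
    \<le> 4 * b * (inner_w n w (mean c0 c1 c2) (mean c0 c1 c2) +
      inner_w n w (mean d0 d1 d2) (mean d0 d1 d2)) + 4 * b\<^sup>2"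
  unfolding mean_def
  by (rule bilinear_variance[OF approximates_comb_est[OF D m] approximates_comb_est[OF D m] w _ b])
    (use assms in auto)

text \<open>Acceptance needs only one good \<open>\<alpha>\<close>, so the true one is enough. There
  the mean vector is zero, only the \<open>4 * b\<^sup>2\<close> part of the variance survives, and
  Chebyshev at level \<open>\<delta> / 2\<close> multiplies it by
  \<open>4 / \<delta>\<^sup>2\<close>.\<close>

lemma completeness:
  assumes \<alpha>: "\<alpha> \<in> {0..1}" and p: "pmf p = mixture \<alpha> q1 q2"
  shows "measure_pmf.prob BB {(x, y). \<not> (\<exists>\<alpha>\<in>{0..1}. statistic n m w \<alpha> x y \<le> \<delta> / 2)}
    \<le> 16 * (b / \<delta>)\<^sup>2"
proof -
  let ?c1 = "- (1 - \<alpha>)" and ?c2 = "- \<alpha>"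
  have mean0: "mean 1 ?c1 ?c2 = (\<lambda>_. 0)"
    by (auto simp: mean_def p mixture_def algebra_simps)
  have inner0: "inner_w n w (mean 1 ?c1 ?c2) (mean 1 ?c1 ?c2) = 0"
    unfolding mean0 by (simp add: inner_w_def)
  have "measure_pmf.prob BB {(x, y). \<not> (\<exists>\<alpha>\<in>{0..1}. statistic n m w \<alpha> x y \<le> \<delta> / 2)}
      \<le> Expect BB (\<lambda>(x, y). 4 / \<delta>\<^sup>2 * (statistic n m w \<alpha> x y)\<^sup>2)"
  proof (rule prob_le_Expect[OF finite_BB])
    fix z assume z: "z \<in> {(x, y). \<not> (\<exists>\<alpha>\<in>{0..1}. statistic n m w \<alpha> x y \<le> \<delta> / 2)}"
    obtain x y where xy: "z = (x, y)" by (cases z)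
    have "\<not> statistic n m w \<alpha> x y \<le> \<delta> / 2" using z \<alpha> by (auto simp: xy)
    then have "\<delta> / 2 \<le> statistic n m w \<alpha> x y" by linarith
    then have "(\<delta> / 2)\<^sup>2 \<le> (statistic n m w \<alpha> x y)\<^sup>2" using \<delta> by (intro power_mono) auto
    then show "1 \<le> (case z of (x, y) \<Rightarrow> 4 / \<delta>\<^sup>2 * (statistic n m w \<alpha> x y)\<^sup>2)"
      using \<delta> by (simp add: xy field_simps)
  qed auto
  also have "\<dots> = 4 / \<delta>\<^sup>2 * Expect BB (\<lambda>(x, y). (inner_w n w (comb_est m 1 ?c1 ?c2 x)
      (comb_est m 1 ?c1 ?c2 y) - inner_w n w (mean 1 ?c1 ?c2) (mean 1 ?c1 ?c2))\<^sup>2)"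
    unfolding inner0 statistic_def case_prod_unfold diff_zero by simp
  also have "\<dots> \<le> 4 / \<delta>\<^sup>2 * (4 * b * (inner_w n w (mean 1 ?c1 ?c2) (mean 1 ?c1 ?c2) +
      inner_w n w (mean 1 ?c1 ?c2) (mean 1 ?c1 ?c2)) + 4 * b\<^sup>2)"
    by (intro mult_left_mono variance) (use \<alpha> in auto)
  also have "\<dots> = 16 * (b / \<delta>)\<^sup>2"
    unfolding inner0 by (simp add: power_divide)
  finally show ?thesis .
qed

text \<open>\<open>V\<close> is the squared scale on which an error is measured and \<open>N\<close>
  the size of the norms in its variance. The two conditions on \<open>V\<close> leave a bound in the
  ratio \<open>b / \<delta>\<close> alone.\<close>

lemma chebyshev_term:
  assumes "\<bar>c0\<bar> \<le> 1" "\<bar>c1\<bar> \<le> 1" "\<bar>c2\<bar> \<le> 1" "\<bar>d0\<bar> \<le> 1" "\<bar>d1\<bar> \<le> 1" "\<bar>d2\<bar> \<le> 1"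
    and N: "inner_w n w (mean c0 c1 c2) (mean c0 c1 c2) +
      inner_w n w (mean d0 d1 d2) (mean d0 d1 d2) \<le> 2 * N" "\<delta> * N \<le> V" "\<delta>\<^sup>2 \<le> V"
  shows "Expect BB (\<lambda>(x, y). (inner_w n w (comb_est m c0 c1 c2 x) (comb_est m d0 d1 d2 y) -
      inner_w n w (mean c0 c1 c2) (mean d0 d1 d2))\<^sup>2) / V \<le> 8 * (b / \<delta>) + 4 * (b / \<delta>)\<^sup>2"
proof -
  have V: "0 < V" using N(3) \<delta> by (smt (verit) zero_less_power)
  have "Expect BB (\<lambda>(x, y). (inner_w n w (comb_est m c0 c1 c2 x) (comb_est m d0 d1 d2 y) -
      inner_w n w (mean c0 c1 c2) (mean d0 d1 d2))\<^sup>2) / V \<le> (4 * b * (2 * N) + 4 * b\<^sup>2) / V"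
    using V b N(1)
    by (intro divide_right_mono order_trans[OF variance[OF assms(1-6)]] add_mono mult_left_mono) auto
  also have "\<dots> = 8 * b * (N / V) + 4 * b\<^sup>2 * (1 / V)"
    by (simp add: add_divide_distrib)
  also have "\<dots> \<le> 8 * b * (1 / \<delta>) + 4 * b\<^sup>2 * (1 / \<delta>\<^sup>2)"
    using V \<delta> N b by (intro add_mono mult_left_mono) (auto simp: field_simps)
  finally show ?thesis by (simp add: power_divide)
qed

text \<open>
  Expanding around the minimiser \<open>\<alpha>0\<close> turns the statistic into a quadratic polynomial in
  \<open>t = \<alpha> - \<alpha>0\<close> with three random coefficients, so controlling these controls all \<open>\<alpha>\<close> at once.
\<close>
lemma soundness:
  assumes far: "\<And>\<alpha>. \<alpha> \<in> {0..1} \<Longrightarrow> \<delta> \<le> inner_w n w (mean 1 (- (1 - \<alpha>)) (- \<alpha>)) (mean 1 (- (1 - \<alpha>)) (- \<alpha>))"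
  shows "measure_pmf.prob BB {(x, y). \<exists>\<alpha>\<in>{0..1}. statistic n m w \<alpha> x y \<le> \<delta> / 2}
    \<le> 832 * (8 * (b / \<delta>) + 4 * (b / \<delta>)\<^sup>2)"
proof -
  define Q where "Q \<alpha> = inner_w n w (mean 1 (- (1 - \<alpha>)) (- \<alpha>)) (mean 1 (- (1 - \<alpha>)) (- \<alpha>))" for \<alpha>
  have "continuous_on {0..1} Q"
    unfolding Q_def inner_w_def mean_def by (intro continuous_intros)
  then obtain \<alpha>0 where \<alpha>0: "\<alpha>0 \<in> {0..1}" and min: "\<And>\<alpha>. \<alpha> \<in> {0..1} \<Longrightarrow> Q \<alpha>0 \<le> Q \<alpha>"
    using continuous_attains_inf[of "{0..1::real}" Q] by auto
  let ?c1 = "- (1 - \<alpha>0)" and ?c2 = "- \<alpha>0"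
  define f where "f = mean 1 ?c1 ?c2"
  define v where "v = mean 0 (-1) 1"
  define F where "F = comb_est m 1 ?c1 ?c2"
  define V where "V = comb_est m 0 (-1) 1"
  define s0 where "s0 = inner_w n w f f"
  define s1 where "s1 = inner_w n w v v"
  define c where "c = inner_w n w f v"
  have s0: "\<delta> \<le> s0" using far[OF \<alpha>0] by (simp add: s0_def f_def)
  have s0p: "0 < s0" using s0 \<delta> by simp
  have s1: "0 \<le> s1" unfolding s1_def using w by (intro inner_w_nonneg) auto
  have shift: "mean 1 (- (1 - (\<alpha>0 + t))) (- (\<alpha>0 + t)) = (\<lambda>i. f i - t * v i)" for t
    by (auto simp: f_def v_def mean_def algebra_simps)
  have shift': "comb_est m 1 (- (1 - (\<alpha>0 + t))) (- (\<alpha>0 + t)) x = (\<lambda>i. F x i - t * V x i)" for t x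
    by (auto simp: F_def V_def comb_est_def case_prod_unfold algebra_simps)
  have Q: "Q (\<alpha>0 + t) = s0 - 2 * t * c + t\<^sup>2 * s1" for t
    unfolding Q_def shift inner_w_diff_scaled s0_def s1_def c_def
    by (simp add: inner_w_commute[of n w v f])
  \<comment> \<open>\<open>\<alpha>0\<close> may be an endpoint of the interval, where
    \<open>c\<close> need not vanish. Minimality along the segment to \<open>\<alpha>0 + t\<close>
    still fixes the sign of \<open>t * c\<close>.\<close>
  have growth: "s0 + t\<^sup>2 * s1 \<le> Q (\<alpha>0 + t)" if t: "\<alpha>0 + t \<in> {0..1}" for t
    unfolding Q
  proof (rule quadratic_growth_at_minimum[OF s1])
    fix \<eta> :: real assume \<eta>: "0 < \<eta>" "\<eta> \<le> 1"
    have "\<alpha>0 + \<eta> * t = (1 - \<eta>) * \<alpha>0 + \<eta> * (\<alpha>0 + t)" by (simp add: algebra_simps)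
    also have "\<dots> \<in> {0..1}"
      using \<eta> \<alpha>0 t convexD_alt[of "{0..1::real}" \<alpha>0 "\<alpha>0 + t" \<eta>] by simp
    finally have "Q \<alpha>0 \<le> Q (\<alpha>0 + \<eta> * t)" by (rule min)
    then show "s0 \<le> s0 - 2 * (\<eta> * t) * c + (\<eta> * t)\<^sup>2 * s1"
      using Q[of 0] Q[of "\<eta> * t"] by simp
  qed
  \<comment> \<open>The linear coefficient is a sum of two cross terms because \<open>x\<close> and
    \<open>y\<close> are different batches; hence four errors for three coefficients.\<close>
  define e1 where "e1 x y = inner_w n w (F x) (F y) - inner_w n w f f" for x y
  define e2 where "e2 x y = inner_w n w (F x) (V y) - inner_w n w f v" for x y
  define e3 where "e3 x y = inner_w n w (V x) (F y) - inner_w n w v f" for x y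
  define e4 where "e4 x y = inner_w n w (V x) (V y) - inner_w n w v v" for x y
  \<comment> \<open>\<open>s1\<close> may be zero; \<open>W\<close> is at least
    \<open>\<delta>\<close> and still satisfies
    \<open>t\<^sup>2 * W \<le> s0 + t\<^sup>2 * s1\<close> for \<open>\<bar>t\<bar> \<le> 1\<close>.
    The cross terms are measured on the geometric mean of \<open>s0\<close> and
    \<open>W\<close>.\<close>
  define W where "W = s0 + s1"
  have W: "s0 \<le> W" "0 < W" using s1 s0p by (simp_all add: W_def)
  \<comment> \<open>If \<open>g < 1\<close>, the errors are below \<open>s0 / 8\<close>, twice
    \<open>sqrt (s0 * W) / 16\<close>, and \<open>W / 16\<close>. The squared inverses of these
    fractions, \<open>64 + 3 * 256 = 832\<close>, give the constant of the statement.\<close>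
  define g where "g z = (case z of (x, y) \<Rightarrow> 64 * ((e1 x y)\<^sup>2 / s0\<^sup>2) + (256 * ((e2 x y)\<^sup>2 / (s0 * W)) +
      (256 * ((e3 x y)\<^sup>2 / (s0 * W)) + 256 * ((e4 x y)\<^sup>2 / W\<^sup>2))))" for z
  have g_nonneg: "0 \<le> 64 * ((e1 x y)\<^sup>2 / s0\<^sup>2)" "0 \<le> 256 * ((e2 x y)\<^sup>2 / (s0 * W))"
    "0 \<le> 256 * ((e3 x y)\<^sup>2 / (s0 * W))" "0 \<le> 256 * ((e4 x y)\<^sup>2 / W\<^sup>2)" for x y
    using s0p W by simp_all
  have good: "\<delta> / 2 < statistic n m w \<alpha> x y" if z: "g (x, y) < 1" and \<alpha>: "\<alpha> \<in> {0..1}" for x y \<alpha>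
  proof -
    define t where "t = \<alpha> - \<alpha>0"
    have t: "\<alpha> = \<alpha>0 + t" "\<bar>t\<bar> \<le> 1" using \<alpha> \<alpha>0 by (auto simp: t_def)
    have small: "64 * ((e1 x y)\<^sup>2 / s0\<^sup>2) < 1" "256 * ((e2 x y)\<^sup>2 / (s0 * W)) < 1"
      "256 * ((e3 x y)\<^sup>2 / (s0 * W)) < 1" "256 * ((e4 x y)\<^sup>2 / W\<^sup>2) < 1"
      using z g_nonneg[of x y] unfolding g_def prod.case by linarith+
    have "(8 * e1 x y)\<^sup>2 \<le> s0\<^sup>2" using small(1) s0p by (simp add: power_mult_distrib field_simps)
    then have e1: "8 * \<bar>e1 x y\<bar> \<le> s0" by (rule scaled_abs_le) (use s0p in simp_all)
    define r where "r = sqrt (s0 * W)"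
    have r: "0 \<le> r" "r\<^sup>2 = s0 * W" using s0p W by (simp_all add: r_def)
    have "(16 * e2 x y)\<^sup>2 \<le> r\<^sup>2" using small(2) s0p W r by (simp add: power_mult_distrib field_simps)
    then have e2: "16 * \<bar>e2 x y\<bar> \<le> r" by (rule scaled_abs_le) (use s0p r W in simp_all)
    have "(16 * e3 x y)\<^sup>2 \<le> r\<^sup>2" using small(3) s0p W r by (simp add: power_mult_distrib field_simps)
    then have e3: "16 * \<bar>e3 x y\<bar> \<le> r" by (rule scaled_abs_le) (use s0p r W in simp_all)
    have "(16 * e4 x y)\<^sup>2 \<le> W\<^sup>2" using small(4) W by (simp add: power_mult_distrib field_simps)
    then have e4: "16 * \<bar>e4 x y\<bar> \<le> W" by (rule scaled_abs_le) (use s0p r W in simp_all)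
    have t2: "t\<^sup>2 \<le> 1" using t(2) by (simp add: abs_square_le_1)
    \<comment> \<open>The inequality between arithmetic and geometric means for \<open>s0\<close>
      and \<open>t\<^sup>2 * W\<close>.\<close>
    have tr: "2 * (\<bar>t\<bar> * r) \<le> s0 + t\<^sup>2 * W"
    proof -
      have "(2 * (\<bar>t\<bar> * r))\<^sup>2 = 4 * (s0 * (t\<^sup>2 * W))" using r by (simp add: power_mult_distrib)
      also have "\<dots> \<le> (s0 + t\<^sup>2 * W)\<^sup>2"
        using zero_le_power2[of "s0 - t\<^sup>2 * W"] by (simp add: power2_eq_square algebra_simps)
      finally show ?thesis
        by (rule power2_le_imp_le) (use s0p W in simp)
    qed
    have tW: "t\<^sup>2 * W \<le> s0 + t\<^sup>2 * s1"
      using t2 s0p unfolding W_def by (simp add: distrib_left mult_left_le_one_le)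
    have "statistic n m w \<alpha> x y = inner_w n w (F x) (F y) -
        t * (inner_w n w (F x) (V y) + inner_w n w (V x) (F y)) + t\<^sup>2 * inner_w n w (V x) (V y)"
      unfolding statistic_def t(1) shift' by (rule inner_w_diff_scaled)
    also have "\<dots> = Q \<alpha> + e1 x y - t * (e2 x y + e3 x y) + t\<^sup>2 * e4 x y"
      unfolding t(1) Q e1_def e2_def e3_def e4_def s0_def s1_def c_def
      by (simp add: inner_w_commute[of n w v f] algebra_simps)
    finally have st: "statistic n m w \<alpha> x y = Q \<alpha> + e1 x y - t * (e2 x y + e3 x y) + t\<^sup>2 * e4 x y" .
    have key: "Q - s / 8 - (s + Z) / 16 - Z / 16 \<le> S"
      if "\<bar>X\<bar> \<le> R / 8" "\<bar>Y\<bar> \<le> Z / 16" "S = Q + e - X + Y" "8 * \<bar>e\<bar> \<le> s" "2 * R \<le> s + Z"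
      for Q s Z S X R Y e :: real
    proof -
      have "X \<le> R / 8" "- Y \<le> Z / 16" "- (8 * e) \<le> s" using that(1,2,4) by auto
      then show ?thesis using that(3,5) by (simp add: field_simps)
    qed
    have "\<bar>e2 x y + e3 x y\<bar> \<le> r / 8" using e2 e3 by linarith
    then have "\<bar>t * (e2 x y + e3 x y)\<bar> \<le> \<bar>t\<bar> * (r / 8)"
      unfolding abs_mult by (intro mult_left_mono) auto
    moreover have "\<bar>t\<^sup>2 * e4 x y\<bar> \<le> t\<^sup>2 * (W / 16)"
      unfolding abs_mult using e4 by (intro mult_mono) auto
    ultimately have "Q \<alpha> - s0 / 8 - (s0 + t\<^sup>2 * W) / 16 - t\<^sup>2 * W / 16 \<le> statistic n m w \<alpha> x y"
      using key[OF _ _ st e1 tr] by simp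
    moreover have "s0 + t\<^sup>2 * s1 \<le> Q \<alpha>" using growth[of t] \<alpha> t by simp
    moreover have "0 \<le> t\<^sup>2 * s1" using s1 by simp
    \<comment> \<open>Both \<open>s\<close> and \<open>Z\<close> are at most \<open>Q\<close>, so
      the losses amount to at most \<open>5/16\<close> of \<open>Q\<close>, and
      \<open>Q \<ge> \<delta>\<close>.\<close>
    moreover have "\<delta> / 2 < S"
      if "Q - s / 8 - (s + Z) / 16 - Z / 16 \<le> S" "s + u \<le> Q" "0 \<le> u" "Z \<le> s + u" "\<delta> \<le> s"
      for Q s Z S u :: real
    proof -
      have "16 * Q - 3 * s - 2 * Z \<le> 16 * S" using that(1) by (simp add: field_simps)
      then have "\<delta> < 2 * S" using that \<delta> by linarith
      then show ?thesis by simp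
    qed
    ultimately show ?thesis using tW s0 by blast
  qed
  have "measure_pmf.prob BB {(x, y). \<exists>\<alpha>\<in>{0..1}. statistic n m w \<alpha> x y \<le> \<delta> / 2} \<le> Expect BB g"
  proof (rule prob_le_Expect[OF finite_BB])
    show "0 \<le> g z" for z
      using g_nonneg unfolding g_def by (simp add: case_prod_unfold add_nonneg_nonneg)
    fix z assume "z \<in> {(x, y). \<exists>\<alpha>\<in>{0..1}. statistic n m w \<alpha> x y \<le> \<delta> / 2}"
    then show "1 \<le> g z" using good by (cases z) (force simp: not_le[symmetric])
  qed
  also have "Expect BB g = 64 * (Expect BB (\<lambda>(x, y). (e1 x y)\<^sup>2) / s0\<^sup>2) +
      (256 * (Expect BB (\<lambda>(x, y). (e2 x y)\<^sup>2) / (s0 * W)) +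
      (256 * (Expect BB (\<lambda>(x, y). (e3 x y)\<^sup>2) / (s0 * W)) +
       256 * (Expect BB (\<lambda>(x, y). (e4 x y)\<^sup>2) / W\<^sup>2)))"
    unfolding g_def[abs_def] case_prod_unfold by (simp add: Expect_add[OF finite_BB])
  also have "\<dots> \<le> 64 * (8 * (b / \<delta>) + 4 * (b / \<delta>)\<^sup>2) + (256 * (8 * (b / \<delta>) + 4 * (b / \<delta>)\<^sup>2) +
      (256 * (8 * (b / \<delta>) + 4 * (b / \<delta>)\<^sup>2) + 256 * (8 * (b / \<delta>) + 4 * (b / \<delta>)\<^sup>2)))"
  proof -
    have N1: "inner_w n w f f + inner_w n w f f \<le> 2 * s0"
      and N2: "inner_w n w f f + inner_w n w v v \<le> 2 * W"
      and N3: "inner_w n w v v + inner_w n w f f \<le> 2 * W"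
      and N4: "inner_w n w v v + inner_w n w v v \<le> 2 * W"
      using s0p s1 by (simp_all add: s0_def s1_def W_def)
    have V1: "\<delta> * s0 \<le> s0\<^sup>2" "\<delta>\<^sup>2 \<le> s0\<^sup>2"
      and V2: "\<delta> * W \<le> s0 * W" "\<delta>\<^sup>2 \<le> s0 * W"
      and V3: "\<delta> * W \<le> W\<^sup>2" "\<delta>\<^sup>2 \<le> W\<^sup>2"
      using s0 W \<delta> unfolding power2_eq_square by (auto intro!: mult_mono mult_right_mono)
    have coef: "\<bar>1\<bar> \<le> (1::real)" "\<bar>0\<bar> \<le> (1::real)" "\<bar>-1\<bar> \<le> (1::real)" "\<bar>?c1\<bar> \<le> 1" "\<bar>?c2\<bar> \<le> 1"
      using \<alpha>0 by auto
    note ch = chebyshev_term[OF coef(1) coef(4) coef(5) coef(1) coef(4) coef(5), folded f_def F_def, OF N1 V1]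
      chebyshev_term[OF coef(1) coef(4) coef(5) coef(2) coef(3) coef(1), folded f_def F_def v_def V_def, OF N2 V2]
      chebyshev_term[OF coef(2) coef(3) coef(1) coef(1) coef(4) coef(5), folded f_def F_def v_def V_def, OF N3 V2]
      chebyshev_term[OF coef(2) coef(3) coef(1) coef(2) coef(3) coef(1), folded v_def V_def, OF N4 V3]
    show ?thesis
      unfolding e1_def e2_def e3_def e4_def using ch by (intro add_mono mult_left_mono) auto
  qed
  finally show ?thesis by simp
qed

end

section \<open>Flattening: random weights from the counts of the first batch\<close>

lemma map_eq_pmf_bernoulli: "map_pmf (\<lambda>x. x = i) p = bernoulli_pmf (pmf p i)"
proof (rule pmf_eqI)
  fix b
  have True: "pmf (map_pmf (\<lambda>x. x = i) p) True = pmf p i"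
  proof -
    have "(\<lambda>x. x = i) -` {True} = {i}" by auto
    then show ?thesis by (simp add: pmf_map measure_pmf_single)
  qed
  moreover have "pmf (map_pmf (\<lambda>x. x = i) p) False = 1 - pmf p i"
  proof -
    have "(\<Sum>b\<in>UNIV. pmf (map_pmf (\<lambda>x. x = i) p) b) = 1"
      by (rule sum_pmf_eq_1) auto
    then show ?thesis using True by (simp add: UNIV_bool)
  qed
  ultimately show "pmf (map_pmf (\<lambda>x. x = i) p) b = pmf (bernoulli_pmf (pmf p i)) b"
    by (cases b) (simp_all add: pmf_le_1)
qed

lemma count_list_replicate_pmf:
  "map_pmf (\<lambda>xs. count_list xs i) (replicate_pmf k p) = binomial_pmf k (pmf p i)"
proof (induction k)
  case 0
  then show ?case by (simp add: binomial_pmf_0 pmf_le_1)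
next
  case (Suc k)
  have "map_pmf (\<lambda>xs. count_list xs i) (replicate_pmf (Suc k) p) =
      bind_pmf p (\<lambda>x. bind_pmf (replicate_pmf k p)
        (\<lambda>xs. return_pmf ((if x = i then 1 else 0) + count_list xs i)))"
    by (auto simp: map_bind_pmf intro!: bind_pmf_cong)
  also have "\<dots> = bind_pmf (map_pmf (\<lambda>x. x = i) p) (\<lambda>b.
      bind_pmf (map_pmf (\<lambda>xs. count_list xs i) (replicate_pmf k p))
        (\<lambda>j. return_pmf ((if b then 1 else 0) + j)))"
    by (simp add: bind_map_pmf)
  also have "\<dots> = binomial_pmf (Suc k) (pmf p i)"
    by (simp add: map_eq_pmf_bernoulli Suc binomial_pmf_Suc pmf_le_1)
  finally show ?case .
qed

text \<open>The identity \<open>(k + 1) * (k choose j) = (j + 1) * (Suc k choose Suc j)\<close>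
  turns the left side into \<open>1 / (k + 1)\<close> times the binomial expansion of
  \<open>(t + (1 - t)) ^ Suc k\<close> without its term for 0.\<close>

lemma expected_inverse_count:
  "pmf p i * Expect (replicate_pmf k p) (\<lambda>xs. 1 / (1 + real (count_list xs i))) \<le> 1 / (real k + 1)"
proof -
  define t where "t = pmf p i"
  have t: "0 \<le> t" "t \<le> 1" by (simp_all add: t_def pmf_le_1)
  have "Expect (replicate_pmf k p) (\<lambda>xs. 1 / (1 + real (count_list xs i))) =
      Expect (map_pmf (\<lambda>xs. count_list xs i) (replicate_pmf k p)) (\<lambda>j. 1 / (1 + real j))"
    by simp
  also have "\<dots> = Expect (binomial_pmf k t) (\<lambda>j. 1 / (1 + real j))"
    by (simp only: count_list_replicate_pmf t_def)
  also have "\<dots> = (\<Sum>j\<le>k. 1 / (1 + real j) * (real (k choose j) * t ^ j * (1 - t) ^ (k - j)))"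
    by (subst integral_measure_pmf_real[of "{..k}"]) (use t set_pmf_binomial_eq[of t k] in \<open>auto split: if_splits\<close>)
  finally have "t * Expect (replicate_pmf k p) (\<lambda>xs. 1 / (1 + real (count_list xs i))) =
      (\<Sum>j\<le>k. t * (1 / (1 + real j) * (real (k choose j) * t ^ j * (1 - t) ^ (k - j))))"
    by (simp add: sum_distrib_left)
  also have "\<dots> = (\<Sum>j\<le>k. 1 / (real k + 1) * (real (Suc k choose Suc j) * t ^ Suc j * (1 - t) ^ (Suc k - Suc j)))"
  proof (rule sum.cong[OF refl])
    fix j
    have "real (Suc k) * real (k choose j) = real (Suc k choose Suc j) * real (Suc j)"
      using Suc_times_binomial_eq[of k j] by (metis of_nat_mult)
    then have "real (k choose j) / (1 + real j) = real (Suc k choose Suc j) / (real k + 1)"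
      by (simp add: field_simps del: binomial_Suc_Suc)
    then have eq: "real (k choose j) / (1 + real j) = 1 / (real k + 1) * real (Suc k choose Suc j)"
      by simp
    have "t * (1 / (1 + real j) * (real (k choose j) * t ^ j * (1 - t) ^ (k - j))) =
        real (k choose j) / (1 + real j) * (t * t ^ j * (1 - t) ^ (k - j))"
      by simp
    also have "\<dots> = 1 / (real k + 1) * (real (Suc k choose Suc j) * t ^ Suc j * (1 - t) ^ (Suc k - Suc j))"
      unfolding eq by (simp only: power_Suc diff_Suc_Suc mult.assoc)
    finally show "t * (1 / (1 + real j) * (real (k choose j) * t ^ j * (1 - t) ^ (k - j))) =
        1 / (real k + 1) * (real (Suc k choose Suc j) * t ^ Suc j * (1 - t) ^ (Suc k - Suc j))" .
  qed
  also have "\<dots> = 1 / (real k + 1) * (\<Sum>j\<le>k. real (Suc k choose Suc j) * t ^ Suc j * (1 - t) ^ (Suc k - Suc j))"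
    by (simp only: sum_distrib_left)
  also have "\<dots> \<le> 1 / (real k + 1) * 1"
  proof (rule mult_left_mono)
    have "(\<Sum>j\<le>k. real (Suc k choose Suc j) * t ^ Suc j * (1 - t) ^ (Suc k - Suc j)) \<le>
        (\<Sum>j\<le>Suc k. real (Suc k choose j) * t ^ j * (1 - t) ^ (Suc k - j))"
      using t unfolding sum.atMost_Suc_shift by simp
    also have "\<dots> = (t + (1 - t)) ^ Suc k"
      by (simp only: binomial_ring)
    finally show "(\<Sum>j\<le>k. real (Suc k choose Suc j) * t ^ Suc j * (1 - t) ^ (Suc k - Suc j)) \<le> 1"
      by simp
  qed simp
  finally show ?thesis by (simp add: t_def)
qed

text \<open>
  Instead of splitting element \<open>i\<close> into \<open>1 + count\<close> equal parts (flattening), the squared distance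
  gets the weight \<open>1 / (1 + count)\<close>, which has the same effect on the \<open>\<ell>\<^sub>2\<close> geometry.
\<close>
definition flat_weight :: "batch \<Rightarrow> nat \<Rightarrow> real" where
  "flat_weight = (\<lambda>(xs, ys, zs) i.
     1 / (1 + real (count_list xs i) + real (count_list ys i) + real (count_list zs i)))"

lemma flat_weight_bounds: "0 < flat_weight a i" "flat_weight a i \<le> 1"
  by (auto simp: flat_weight_def case_prod_unfold field_simps add_pos_nonneg intro!: add_pos_nonneg)

lemma flat_weight_le:
  "flat_weight (xs, ys, zs) i \<le> 1 / (1 + real (count_list xs i))"
  "flat_weight (xs, ys, zs) i \<le> 1 / (1 + real (count_list ys i))"
  "flat_weight (xs, ys, zs) i \<le> 1 / (1 + real (count_list zs i))"
  unfolding flat_weight_def prod.case by (intro divide_left_mono mult_pos_pos; simp add: add_pos_nonneg)+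

lemma Expect_mult_left: "Expect p (\<lambda>x. c * f x) = c * Expect p f"
  by simp

text \<open>Each squared mass is damped by the counts from its own distribution: one factor
  \<open>pmf p i\<close> is absorbed by \<open>expected_inverse_count\<close>, the other sums to 1.
  The 9 is 3 from squaring a sum of three terms, times 3 distributions.\<close>

lemma expected_flat_norm:
  fixes m :: real
  assumes D: "p \<in> dists_on n" "q1 \<in> dists_on n" "q2 \<in> dists_on n" and m: "0 < m"
  defines "r \<equiv> \<lambda>i. (pmf p i + pmf q1 i + pmf q2 i) / m"
  shows "Expect (batch_pmf p q1 q2 k) (\<lambda>a. inner_w n (flat_weight a) r r) \<le> 9 / (m\<^sup>2 * (real k + 1))"
proof -
  let ?B = "batch_pmf p q1 q2 k"
  have fin: "finite (set_pmf p)" "finite (set_pmf q1)" "finite (set_pmf q2)"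
    using D by (auto intro: finite_dists_on)
  have finB: "finite (set_pmf ?B)" using fin by simp
  have marg: "Expect ?B (\<lambda>a. f (fst a)) = Expect (replicate_pmf k p) f"
    "Expect ?B (\<lambda>a. f (fst (snd a))) = Expect (replicate_pmf k q1) f"
    "Expect ?B (\<lambda>a. f (snd (snd a))) = Expect (replicate_pmf k q2) f" for f
    unfolding batch_pmf_def
    using expectation_pair_pmf_snd[of "replicate_pmf k p" "pair_pmf (replicate_pmf k q1) (replicate_pmf k q2)" "\<lambda>z. f (fst z)"]
      expectation_pair_pmf_snd[of "replicate_pmf k p" "pair_pmf (replicate_pmf k q1) (replicate_pmf k q2)" "\<lambda>z. f (snd z)"]
    by simp_all
  have marg': "Expect ?B (\<lambda>a. 1 / (1 + real (count_list (fst a) i))) =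
      Expect (replicate_pmf k p) (\<lambda>xs. 1 / (1 + real (count_list xs i)))"
    "Expect ?B (\<lambda>a. 1 / (1 + real (count_list (fst (snd a)) i))) =
      Expect (replicate_pmf k q1) (\<lambda>xs. 1 / (1 + real (count_list xs i)))"
    "Expect ?B (\<lambda>a. 1 / (1 + real (count_list (snd (snd a)) i))) =
      Expect (replicate_pmf k q2) (\<lambda>xs. 1 / (1 + real (count_list xs i)))" for i
    by (rule marg[of "\<lambda>xs. 1 / (1 + real (count_list xs i))"])+
  have ineq: "(s + t + u)\<^sup>2 \<le> 3 * (s\<^sup>2 + (t\<^sup>2 + u\<^sup>2))" for s t u :: real
    using zero_le_power2[of "s - t"] zero_le_power2[of "s - u"] zero_le_power2[of "t - u"]
    by (simp add: power2_eq_square algebra_simps)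
  have "Expect ?B (\<lambda>a. inner_w n (flat_weight a) r r) \<le>
      Expect ?B (\<lambda>a. \<Sum>i\<in>{1..n}. 3 / m\<^sup>2 * (
        (pmf p i)\<^sup>2 * (1 / (1 + real (count_list (fst a) i))) +
        ((pmf q1 i)\<^sup>2 * (1 / (1 + real (count_list (fst (snd a)) i))) +
         (pmf q2 i)\<^sup>2 * (1 / (1 + real (count_list (snd (snd a)) i))))))"
  proof (rule Expect_mono[OF finB])
    fix a :: batch
    show "inner_w n (flat_weight a) r r \<le> (\<Sum>i\<in>{1..n}. 3 / m\<^sup>2 * (
        (pmf p i)\<^sup>2 * (1 / (1 + real (count_list (fst a) i))) +
        ((pmf q1 i)\<^sup>2 * (1 / (1 + real (count_list (fst (snd a)) i))) +
         (pmf q2 i)\<^sup>2 * (1 / (1 + real (count_list (snd (snd a)) i))))))"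
      unfolding inner_w_def
    proof (rule sum_mono)
      fix i
      obtain xs ys zs where a: "a = (xs, ys, zs)" by (cases a)
      let ?w = "flat_weight a i"
      have "?w * r i * r i = 1 / m\<^sup>2 * (?w * (pmf p i + pmf q1 i + pmf q2 i)\<^sup>2)"
        by (simp add: r_def power2_eq_square)
      also have "\<dots> \<le> 1 / m\<^sup>2 * (?w * (3 * ((pmf p i)\<^sup>2 + ((pmf q1 i)\<^sup>2 + (pmf q2 i)\<^sup>2))))"
        using flat_weight_bounds[of a i] by (intro mult_left_mono ineq) auto
      also have "\<dots> = 3 / m\<^sup>2 * ((pmf p i)\<^sup>2 * ?w + ((pmf q1 i)\<^sup>2 * ?w + (pmf q2 i)\<^sup>2 * ?w))"
        by (simp add: algebra_simps)
      also have "\<dots> \<le> 3 / m\<^sup>2 * (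
          (pmf p i)\<^sup>2 * (1 / (1 + real (count_list (fst a) i))) +
          ((pmf q1 i)\<^sup>2 * (1 / (1 + real (count_list (fst (snd a)) i))) +
           (pmf q2 i)\<^sup>2 * (1 / (1 + real (count_list (snd (snd a)) i)))))"
        unfolding a fst_conv snd_conv by (intro mult_left_mono add_mono flat_weight_le) auto
      finally show "?w * r i * r i \<le> 3 / m\<^sup>2 * (
          (pmf p i)\<^sup>2 * (1 / (1 + real (count_list (fst a) i))) +
          ((pmf q1 i)\<^sup>2 * (1 / (1 + real (count_list (fst (snd a)) i))) +
           (pmf q2 i)\<^sup>2 * (1 / (1 + real (count_list (snd (snd a)) i)))))" .
    qed
  qed
  also have "\<dots> = (\<Sum>i\<in>{1..n}. 3 / m\<^sup>2 * (
        (pmf p i)\<^sup>2 * Expect (replicate_pmf k p) (\<lambda>xs. 1 / (1 + real (count_list xs i))) +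
        ((pmf q1 i)\<^sup>2 * Expect (replicate_pmf k q1) (\<lambda>xs. 1 / (1 + real (count_list xs i))) +
         (pmf q2 i)\<^sup>2 * Expect (replicate_pmf k q2) (\<lambda>xs. 1 / (1 + real (count_list xs i))))))"
    by (simp only: Expect_sum[OF finB] Expect_mult_left Expect_add[OF finB] marg')
  also have "\<dots> \<le> (\<Sum>i\<in>{1..n}. 3 / m\<^sup>2 * (pmf p i * (1 / (real k + 1)) +
        (pmf q1 i * (1 / (real k + 1)) + pmf q2 i * (1 / (real k + 1)))))"
    unfolding power2_eq_square[of "pmf _ _"] mult.assoc
    by (intro sum_mono mult_left_mono add_mono expected_inverse_count) auto
  also have "\<dots> = (\<Sum>i\<in>{1..n}. 3 / m\<^sup>2 * (1 / (real k + 1)) * (pmf p i + pmf q1 i + pmf q2 i))"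
    by (intro sum.cong refl) (simp add: add_divide_distrib distrib_left)
  also have "\<dots> = 3 / m\<^sup>2 * (1 / (real k + 1)) * 3"
  proof -
    have "(\<Sum>i\<in>{1..n}. pmf p' i) = 1" if "p' \<in> dists_on n" for p'
      using that by (intro sum_pmf_eq_1) (auto simp: dists_on_def)
    then have "(\<Sum>i\<in>{1..n}. pmf p i + pmf q1 i + pmf q2 i) = 3"
      using D by (simp only: sum.distrib)
    then show ?thesis by (simp only: sum_distrib_left[symmetric])
  qed
  finally show ?thesis by simp
qed

text \<open>Cauchy-Schwarz after writing \<open>\<bar>d i\<bar>\<close> as
  \<open>sqrt (w i) * \<bar>d i\<bar>\<close> times \<open>1 / sqrt (w i)\<close>. As
  \<open>1 / w i\<close> is one plus the counts, these inverses sum to \<open>n + 3 * k\<close>, and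
  \<open>k \<le> n\<close> gives the 4 in the bound.\<close>

lemma flat_weight_separation:
  assumes a: "a \<in> set_pmf (batch_pmf p q1 q2 k)"
    and D: "p \<in> dists_on n" "q1 \<in> dists_on n" "q2 \<in> dists_on n" and k: "k \<le> n" "0 < n"
    and far: "\<epsilon> \<le> (\<Sum>i\<in>{1..n}. \<bar>d i\<bar>)" "0 < \<epsilon>"
  shows "\<epsilon>\<^sup>2 / (4 * n) \<le> inner_w n (flat_weight a) d d"
proof -
  obtain xs ys zs where abc: "a = (xs, ys, zs)" by (cases a)
  have sub: "set xs \<subseteq> {1..n}" "set ys \<subseteq> {1..n}" "set zs \<subseteq> {1..n}"
    and len: "length xs = k" "length ys = k" "length zs = k"
    using a D by (auto simp: batch_pmf_def abc set_replicate_pmf dists_on_def)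
  let ?w = "flat_weight a"
  have w: "0 < ?w i" for i by (rule flat_weight_bounds)
  have "(\<Sum>i\<in>{1..n}. 1 / ?w i) = (\<Sum>i\<in>{1..n}. 1 + real (count_list xs i) + real (count_list ys i) + real (count_list zs i))"
    by (simp add: flat_weight_def abc)
  also have "\<dots> = n + real (\<Sum>i\<in>{1..n}. count_list xs i) + real (\<Sum>i\<in>{1..n}. count_list ys i) +
      real (\<Sum>i\<in>{1..n}. count_list zs i)"
    by (simp add: sum.distrib)
  also have "\<dots> = n + 3 * real k"
    using sub len by (simp only: sum_count_set finite_atLeastAtMost)
  also have "\<dots> \<le> 4 * n" using k by simp
  finally have W: "(\<Sum>i\<in>{1..n}. 1 / ?w i) \<le> 4 * n" .
  have "\<epsilon>\<^sup>2 \<le> (\<Sum>i\<in>{1..n}. \<bar>d i\<bar>)\<^sup>2" using far by (intro power_mono) auto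
  also have "\<dots> = (\<Sum>i\<in>{1..n}. (sqrt (?w i) * \<bar>d i\<bar>) * (1 / sqrt (?w i)))\<^sup>2"
    by (intro arg_cong[of _ _ "\<lambda>x. x\<^sup>2"] sum.cong refl) (use w in \<open>simp add: less_imp_neq[OF w, symmetric]\<close>)
  also have "\<dots> \<le> (\<Sum>i\<in>{1..n}. (sqrt (?w i) * \<bar>d i\<bar>)\<^sup>2) * (\<Sum>i\<in>{1..n}. (1 / sqrt (?w i))\<^sup>2)"
    by (rule Cauchy_Schwarz_ineq_sum)
  also have "(\<Sum>i\<in>{1..n}. (sqrt (?w i) * \<bar>d i\<bar>)\<^sup>2) = inner_w n ?w d d"
    unfolding inner_w_def
    by (intro sum.cong refl) (use less_imp_le[OF w] in \<open>simp add: power_mult_distrib power2_eq_square[of "d _"]\<close>)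
  also have "(\<Sum>i\<in>{1..n}. (1 / sqrt (?w i))\<^sup>2) = (\<Sum>i\<in>{1..n}. 1 / ?w i)"
    by (intro sum.cong refl) (use less_imp_le[OF w] in \<open>simp add: power_divide\<close>)
  also have "inner_w n ?w d d * (\<Sum>i\<in>{1..n}. 1 / ?w i) \<le> inner_w n ?w d d * (4 * n)"
    using W w by (intro mult_left_mono inner_w_nonneg) (auto intro: less_imp_le)
  finally show ?thesis using k by (simp add: divide_le_eq)
qed

section \<open>Choice of the batch sizes and the upper bound\<close>

definition mixture_test :: "nat \<Rightarrow> real \<Rightarrow> nat \<Rightarrow> nat \<Rightarrow> algorithm" where
  "mixture_test n \<epsilon> k m = three_batch_test k m (\<lambda>a x y.
     \<exists>\<alpha>\<in>{0..1}. statistic n m (flat_weight a) \<alpha> x y \<le> \<epsilon>\<^sup>2 / (4 * n) / 2)"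

text \<open>Serves completeness and soundness alike, \<open>P\<close> being the bad event. Given the
  first batch \<open>a\<close>, the noise level \<open>sqrt (N a)\<close> is random and only its
  square has a controlled mean; so the linear term in \<open>b / \<delta>\<close> is traded for a
  constant \<open>1/6\<close> plus a multiple of the square before averaging over
  \<open>a\<close>.\<close>

lemma failure_probability:
  assumes D: "p \<in> dists_on n" "q1 \<in> dists_on n" "q2 \<in> dists_on n"
    and k: "k \<le> n" and n: "0 < n" and m: "0 < m" and \<epsilon>: "0 < \<epsilon>"
    and budget: "250000 * n \<le> m * \<epsilon>\<^sup>2 * sqrt k"
    and fail: "\<And>a b. a \<in> set_pmf (batch_pmf p q1 q2 k) \<Longrightarrow>
      flattened n m p q1 q2 (flat_weight a) b (\<epsilon>\<^sup>2 / (4 * n)) \<Longrightarrow>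
      measure_pmf.prob (pair_pmf (batch_pmf p q1 q2 m) (batch_pmf p q1 q2 m)) {z. P a z} \<le>
        832 * (8 * (b / (\<epsilon>\<^sup>2 / (4 * n))) + 4 * (b / (\<epsilon>\<^sup>2 / (4 * n)))\<^sup>2)"
  shows "measure_pmf.prob (pair_pmf (batch_pmf p q1 q2 k)
      (pair_pmf (batch_pmf p q1 q2 m) (batch_pmf p q1 q2 m))) {(a, z). P a z} \<le> 1/3"
proof -
  define \<delta> where "\<delta> = \<epsilon>\<^sup>2 / (4 * real n)"
  have \<delta>: "0 < \<delta>" using \<epsilon> n by (simp add: \<delta>_def)
  let ?A = "batch_pmf p q1 q2 k"
  let ?BB = "pair_pmf (batch_pmf p q1 q2 m) (batch_pmf p q1 q2 m)"
  have fin: "finite (set_pmf ?A)" "finite (set_pmf ?BB)"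
    using D[THEN finite_dists_on] by simp_all
  define r where "r = (\<lambda>i. (pmf p i + pmf q1 i + pmf q2 i) / real m)"
  define N where "N a = inner_w n (flat_weight a) r r" for a
  have N0: "0 \<le> N a" for a
    unfolding N_def by (rule inner_w_nonneg) (rule less_imp_le[OF flat_weight_bounds(1)])
  have cond: "measure_pmf.prob ?BB {z. P a z} \<le> 1/6 + 70000000 / \<delta>\<^sup>2 * N a"
    if a: "a \<in> set_pmf ?A" for a
  proof -
    define b where "b = sqrt (N a)"
    have b2: "b\<^sup>2 = N a" using N0 by (simp add: b_def)
    have "flattened n m p q1 q2 (flat_weight a) b \<delta>"
    proof
      show "0 \<le> b" using N0 by (simp add: b_def)
      show "inner_w n (flat_weight a) (\<lambda>i. (pmf p i + pmf q1 i + pmf q2 i) / real m)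
          (\<lambda>i. (pmf p i + pmf q1 i + pmf q2 i) / real m) \<le> b\<^sup>2"
        unfolding b2 N_def r_def by simp
      show "0 \<le> flat_weight a i \<and> flat_weight a i \<le> 1" for i
        using flat_weight_bounds[of a i] by simp
    qed (use D m \<delta> in auto)
    from fail[OF a this[unfolded \<delta>_def], folded \<delta>_def]
    have "measure_pmf.prob ?BB {z. P a z} \<le> 832 * (8 * (b / \<delta>) + 4 * (b / \<delta>)\<^sup>2)" .
    also have "\<dots> \<le> 1/6 + 70000000 * (b / \<delta>)\<^sup>2"
    proof -
      \<comment> \<open>Completing the square after multiplication by 6: \<open>19968\<close> is
        half of \<open>6 * 832 * 8\<close>.\<close>
      have "832 * (8 * x + 4 * x\<^sup>2) \<le> 1/6 + 70000000 * x\<^sup>2" for x :: real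
      proof -
        have "39936 * x \<le> 398721024 * x\<^sup>2 + 1"
          using zero_le_power2[of "19968 * x - 1"] by (simp add: power2_diff power_mult_distrib)
        moreover have "4992 * (8 * x + 4 * x\<^sup>2) = 39936 * x + 19968 * x\<^sup>2"
          by (simp add: distrib_left)
        moreover have "398721024 * x\<^sup>2 + 19968 * x\<^sup>2 \<le> 420000000 * x\<^sup>2"
          unfolding distrib_right[symmetric] by (intro mult_right_mono) auto
        ultimately have "4992 * (8 * x + 4 * x\<^sup>2) \<le> 1 + 420000000 * x\<^sup>2"
          by linarith
        then show ?thesis by simp
      qed
      then show ?thesis .
    qed
    finally show ?thesis by (simp add: power_divide b2)
  qed
  have "measure_pmf.prob (pair_pmf ?A ?BB) {(a, z). P a z} =
      Expect ?A (\<lambda>a. measure_pmf.prob ?BB {z. P a z})"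
    by (rule prob_pair[OF fin])
  also have "\<dots> \<le> Expect ?A (\<lambda>a. 1/6 + 70000000 / \<delta>\<^sup>2 * N a)"
    by (rule Expect_mono[OF fin(1) cond])
  also have "\<dots> = 1/6 + 70000000 / \<delta>\<^sup>2 * Expect ?A N"
    by (simp add: Expect_add[OF fin(1)])
  also have "\<dots> \<le> 1/6 + 70000000 / \<delta>\<^sup>2 * (9 / ((real m)\<^sup>2 * (real k + 1)))"
    unfolding N_def r_def using m by (intro add_left_mono mult_left_mono expected_flat_norm D) auto
  also have "\<dots> \<le> 1/3"
  proof -
    \<comment> \<open>The budget constant is chosen so that \<open>250000^2 / 16\<close> exceeds
      \<open>6 * 9 * 70000000\<close>.\<close>
    have "(250000 * real n)\<^sup>2 \<le> (real m * \<epsilon>\<^sup>2 * sqrt (real k))\<^sup>2"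
      using budget by (intro power_mono) auto
    also have "\<dots> = (real m)\<^sup>2 * \<epsilon> ^ 4 * real k"
      by (simp add: power_mult_distrib power_mult[symmetric])
    also have "\<dots> \<le> (real m)\<^sup>2 * \<epsilon> ^ 4 * (real k + 1)"
      by (intro mult_left_mono) auto
    also have "\<epsilon> ^ 4 = 16 * (real n)\<^sup>2 * \<delta>\<^sup>2"
      using n by (simp add: \<delta>_def power_divide power_mult_distrib power_mult[symmetric])
    finally have "62500000000 * (real n)\<^sup>2 \<le> (16 * ((real m)\<^sup>2 * (\<delta>\<^sup>2 * (real k + 1)))) * (real n)\<^sup>2"
      by (simp add: power_mult_distrib mult_ac)
    then have "62500000000 \<le> 16 * ((real m)\<^sup>2 * (\<delta>\<^sup>2 * (real k + 1)))"
      using n by (simp only: mult_le_cancel_right) auto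
    then have "630000000 / (\<delta>\<^sup>2 * ((real m)\<^sup>2 * (real k + 1))) \<le> 1/6"
      using m \<delta> by (simp add: divide_le_eq mult_ac)
    then show ?thesis by simp
  qed
  finally show ?thesis .
qed

lemma tester_mixture_test:
  assumes k: "k \<le> n" and n: "0 < n" and m: "0 < m" and \<epsilon>: "0 < \<epsilon>"
    and budget: "250000 * n \<le> m * \<epsilon>\<^sup>2 * sqrt k"
  shows "noisy_closeness_tester n \<epsilon> (mixture_test n \<epsilon> k m)"
  unfolding noisy_closeness_tester_def
proof (intro ballI conjI impI)
  fix p q1 q2 assume D: "p \<in> dists_on n" "q1 \<in> dists_on n" "q2 \<in> dists_on n"
  let ?T = "mixture_test n \<epsilon> k m"
  let ?\<delta> = "\<epsilon>\<^sup>2 / (4 * real n)"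
  have accept_reject: "prob_verdict ?T p q1 q2 Accept + prob_verdict ?T p q1 q2 Reject = 1"
    by (rule prob_verdict_Accept_Reject)
  {
    assume "\<exists>\<alpha>\<in>{0..1}. pmf p = mixture \<alpha> q1 q2"
    then obtain \<alpha> where \<alpha>: "\<alpha> \<in> {0..1}" "pmf p = mixture \<alpha> q1 q2" by blast
    have "prob_verdict ?T p q1 q2 Reject = measure_pmf.prob (pair_pmf (batch_pmf p q1 q2 k)
        (pair_pmf (batch_pmf p q1 q2 m) (batch_pmf p q1 q2 m)))
        {(a, z). case z of (x, y) \<Rightarrow> \<not> (\<exists>\<alpha>\<in>{0..1}. statistic n m (flat_weight a) \<alpha> x y \<le> ?\<delta> / 2)}"
      unfolding mixture_test_def prob_verdict_three_batch_test by (simp add: case_prod_unfold)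
    also have "\<dots> \<le> 1/3"
    proof (rule failure_probability[OF D k n m \<epsilon> budget])
      fix a b assume "flattened n m p q1 q2 (flat_weight a) b ?\<delta>"
      then interpret flattened n m p q1 q2 "flat_weight a" b ?\<delta> .
      have "measure_pmf.prob BB {z. case z of (x, y) \<Rightarrow>
          \<not> (\<exists>\<alpha>\<in>{0..1}. statistic n m (flat_weight a) \<alpha> x y \<le> ?\<delta> / 2)} \<le> 16 * (b / ?\<delta>)\<^sup>2"
        using completeness[OF \<alpha>] by simp
      also have "\<dots> \<le> 832 * (8 * (b / ?\<delta>) + 4 * (b / ?\<delta>)\<^sup>2)"
      proof -
        have "0 \<le> b / ?\<delta>" using b \<delta> by simp
        then have "16 * x \<le> 832 * (8 * (b / ?\<delta>) + 4 * x)" if "0 \<le> x" for x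
          using that by simp
        then show ?thesis by simp
      qed
      finally show "measure_pmf.prob BB {z. case z of (x, y) \<Rightarrow>
          \<not> (\<exists>\<alpha>\<in>{0..1}. statistic n m (flat_weight a) \<alpha> x y \<le> ?\<delta> / 2)}
          \<le> 832 * (8 * (b / ?\<delta>) + 4 * (b / ?\<delta>)\<^sup>2)" .
    qed
    finally show "2/3 \<le> prob_verdict ?T p q1 q2 Accept" using accept_reject by simp
  next
    assume far: "\<forall>\<alpha>\<in>{0..1}. \<epsilon> \<le> l1_dist n (pmf p) (mixture \<alpha> q1 q2)"
    have "prob_verdict ?T p q1 q2 Accept = measure_pmf.prob (pair_pmf (batch_pmf p q1 q2 k)
        (pair_pmf (batch_pmf p q1 q2 m) (batch_pmf p q1 q2 m)))
        {(a, z). case z of (x, y) \<Rightarrow> \<exists>\<alpha>\<in>{0..1}. statistic n m (flat_weight a) \<alpha> x y \<le> ?\<delta> / 2}"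
      unfolding mixture_test_def prob_verdict_three_batch_test by (simp add: case_prod_unfold)
    also have "\<dots> \<le> 1/3"
    proof (rule failure_probability[OF D k n m \<epsilon> budget])
      fix a b assume a: "a \<in> set_pmf (batch_pmf p q1 q2 k)"
        and fl: "flattened n m p q1 q2 (flat_weight a) b ?\<delta>"
      interpret flattened n m p q1 q2 "flat_weight a" b ?\<delta> by (rule fl)
      have "?\<delta> \<le> inner_w n (flat_weight a) (mean 1 (- (1 - \<alpha>)) (- \<alpha>)) (mean 1 (- (1 - \<alpha>)) (- \<alpha>))"
        if "\<alpha> \<in> {0..1}" for \<alpha>
      proof (rule flat_weight_separation[OF a D k n _ \<epsilon>])
        have "mean 1 (- (1 - \<alpha>)) (- \<alpha>) i = pmf p i - mixture \<alpha> q1 q2 i" for i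
          by (simp add: mean_def mixture_def algebra_simps)
        then show "\<epsilon> \<le> (\<Sum>i\<in>{1..n}. \<bar>mean 1 (- (1 - \<alpha>)) (- \<alpha>) i\<bar>)"
          using far that unfolding l1_dist_def by simp
      qed
      from soundness[OF this]
      show "measure_pmf.prob BB {z. case z of (x, y) \<Rightarrow>
          \<exists>\<alpha>\<in>{0..1}. statistic n m (flat_weight a) \<alpha> x y \<le> ?\<delta> / 2}
          \<le> 832 * (8 * (b / ?\<delta>) + 4 * (b / ?\<delta>)\<^sup>2)" by simp
    qed
    finally show "2/3 \<le> prob_verdict ?T p q1 q2 Reject" using accept_reject by simp
  }
qed

text \<open>The l1 distance of two distributions is at most 2, so no input is far. This case is
  separate because the rate tends to 0 as \<open>\<epsilon>\<close> grows, and a sampling tester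
  draws at least one sample.\<close>

lemma tester_trivial:
  assumes "2 < \<epsilon>"
  shows "noisy_closeness_tester n \<epsilon> (Output Accept)"
  unfolding noisy_closeness_tester_def
proof (intro ballI conjI impI)
  fix p q1 q2 assume D: "p \<in> dists_on n" "q1 \<in> dists_on n" "q2 \<in> dists_on n"
  show "2/3 \<le> prob_verdict (Output Accept) p q1 q2 Accept"
    by (simp add: prob_verdict_eq)
  assume "\<forall>\<alpha>\<in>{0..1}. \<epsilon> \<le> l1_dist n (pmf p) (mixture \<alpha> q1 q2)"
  then have "\<epsilon> \<le> l1_dist n (pmf p) (mixture 0 q1 q2)" by simp
  also have "\<dots> \<le> (\<Sum>i\<in>{1..n}. pmf p i + pmf q1 i)"
    unfolding l1_dist_def
  proof (rule sum_mono)
    fix i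
    show "\<bar>pmf p i - mixture 0 q1 q2 i\<bar> \<le> pmf p i + pmf q1 i"
      unfolding mixture_def using pmf_nonneg[of p i] pmf_nonneg[of q1 i] by (auto simp: abs_le_iff intro: order_trans[of _ 0])
  qed
  also have "\<dots> = 2"
  proof -
    have "(\<Sum>i\<in>{1..n}. pmf p' i) = 1" if "p' \<in> dists_on n" for p'
      using that by (intro sum_pmf_eq_1) (auto simp: dists_on_def)
    then show ?thesis using D by (simp only: sum.distrib)
  qed
  finally show "2/3 \<le> prob_verdict (Output Accept) p q1 q2 Reject" using assms by simp
qed

lemma tester_upper_bound:
  assumes n: "1 \<le> n" and \<epsilon>: "0 < \<epsilon>"
  shows "\<exists>A. noisy_closeness_tester n \<epsilon> A \<and> uses_at_most n A (1600000 * sample_rate n \<epsilon>)"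
proof (cases "2 < \<epsilon>")
  case True
  have "uses_at_most n (Output Accept) (1600000 * sample_rate n \<epsilon>)"
    using \<epsilon> by (simp add: uses_at_most_def sample_rate_def)
  then show ?thesis using tester_trivial[OF True] by blast
next
  case False
  define s where "s = sqrt (real n) / \<epsilon>\<^sup>2"
  define y where "y = real n powr (2/3) / \<epsilon> powr (4/3)"
  have n0: "0 < real n" using n by simp
  have s0: "0 < s" using n0 \<epsilon> by (simp add: s_def)
  have y0: "0 < y" using n0 \<epsilon> by (simp add: y_def)
  have y3: "y ^ 3 = (real n / \<epsilon>\<^sup>2)\<^sup>2"
    using n0 \<epsilon> by (simp add: y_def power_divide powr_power power_mult[symmetric])
  have "(y * sqrt y)\<^sup>2 = y ^ 3"
    using y0 by (simp add: power_mult_distrib power2_eq_square power3_eq_cube)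
  \<comment> \<open>\<open>y\<close> is the balanced size: it solves
    \<open>y = n / (\<epsilon>\<^sup>2 * sqrt y)\<close>.\<close>
  then have ysqrt: "y * sqrt y = real n / \<epsilon>\<^sup>2"
    using y3 y0 \<epsilon> by (simp add: power2_eq_iff_nonneg)
  define k where "k = min n (nat \<lceil>y\<rceil>)"
  define c where "c = real n / (\<epsilon>\<^sup>2 * sqrt k)"
  define m where "m = nat \<lceil>250000 * c\<rceil>"
  have k: "k \<le> n" "0 < k" using n y0 by (auto simp: k_def)
  have k_le: "real k \<le> y + 1"
  proof -
    have "real k \<le> real (nat \<lceil>y\<rceil>)" by (simp add: k_def)
    also have "\<dots> \<le> y + 1" using y0 by linarith
    finally show ?thesis .
  qed
  have c0: "0 < c" using n0 \<epsilon> k by (simp add: c_def)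
  \<comment> \<open>With the cap active \<open>c\<close> equals \<open>s\<close>; otherwise
    \<open>k \<ge> y\<close> and the balance equation bounds \<open>c\<close> by
    \<open>y\<close>.\<close>
  have c_le: "c \<le> s + y"
  proof (cases "n \<le> nat \<lceil>y\<rceil>")
    case True
    then have "k = n" by (simp add: k_def)
    then have "c = s"
      using n0 \<epsilon> by (simp add: c_def s_def field_simps)
    then show ?thesis using y0 by simp
  next
    case False
    then have "k = nat \<lceil>y\<rceil>" by (simp add: k_def)
    then have "y \<le> real k" by (simp add: real_nat_ceiling_ge)
    then have "c \<le> real n / (\<epsilon>\<^sup>2 * sqrt y)"
      unfolding c_def using y0 \<epsilon> by (intro divide_left_mono mult_left_mono mult_pos_pos) auto
    also have "\<dots> = (y * sqrt y) / sqrt y"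
      unfolding ysqrt by simp
    also have "\<dots> = y" using y0 by simp
    finally show ?thesis using s0 by simp
  qed
  have m: "250000 * c \<le> m" "real m \<le> 250000 * c + 1" "0 < m"
    using c0 unfolding m_def by linarith+
  have "250000 * real n = 250000 * c * (\<epsilon>\<^sup>2 * sqrt k)"
    using \<epsilon> k by (simp add: c_def)
  also have "\<dots> \<le> m * (\<epsilon>\<^sup>2 * sqrt k)"
    using m by (intro mult_right_mono) auto
  finally have budget: "250000 * n \<le> m * \<epsilon>\<^sup>2 * sqrt k" by (simp add: mult.assoc)
  \<comment> \<open>A constant lower bound on the rate, which absorbs the additive terms from
    rounding \<open>k\<close> and \<open>m\<close> up.\<close>
  have s_ge: "1/4 \<le> s"
  proof -
    have "\<epsilon>\<^sup>2 \<le> 2\<^sup>2" using False \<epsilon> by (intro power_mono) auto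
    moreover have "1 \<le> sqrt n" using n by simp
    ultimately have "1 / 4 \<le> sqrt n / \<epsilon>\<^sup>2"
      using \<epsilon> by (intro frac_le) auto
    then show ?thesis by (simp add: s_def)
  qed
  have "real (3 * k + 6 * m) \<le> 1600000 * (s + y)"
    using k_le m(2) c_le s_ge s0 y0 by simp
  then have "uses_at_most n (mixture_test n \<epsilon> k m) (1600000 * sample_rate n \<epsilon>)"
    unfolding mixture_test_def sample_rate_def s_def y_def by (rule uses_at_most_three_batch_test)
  moreover have "noisy_closeness_tester n \<epsilon> (mixture_test n \<epsilon> k m)"
    using k n m \<epsilon> budget by (intro tester_mixture_test) auto
  ultimately show ?thesis by blast
qed

section \<open>Adaptive algorithms on a fixed tape of samples\<close>

definition acc_prob :: "algorithm \<Rightarrow> (source \<Rightarrow> nat pmf) \<Rightarrow> real" where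
  "acc_prob A D = pmf (map_pmf fst (run D A)) Accept"

lemma map_fst_run_Sample:
  "map_pmf fst (run D (Sample s k)) = bind_pmf (D s) (\<lambda>x. map_pmf fst (run D (k x)))"
  by (simp add: map_bind_pmf pmf.map_comp o_def case_prod_unfold)

lemma map_fst_run_Randomize:
  "map_pmf fst (run D (Randomize r)) = bind_pmf r (\<lambda>A. map_pmf fst (run D A))"
  by (simp add: join_eq_bind_pmf map_bind_pmf bind_map_pmf)

lemma acc_prob_Output: "acc_prob (Output v) D = (if v = Accept then 1 else 0)"
  by (simp add: acc_prob_def)

lemma acc_prob_Sample:
  assumes "finite Y" "set_pmf (D s) \<subseteq> Y"
  shows "acc_prob (Sample s k) D = (\<Sum>y\<in>Y. pmf (D s) y * acc_prob (k y) D)"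
  unfolding acc_prob_def map_fst_run_Sample pmf_bind
  by (subst integral_measure_pmf_real[OF assms(1)]) (use assms in \<open>auto simp: mult.commute\<close>)

lemma acc_prob_Randomize:
  "acc_prob (Randomize r) D = measure_pmf.expectation r (\<lambda>A. acc_prob A D)"
  unfolding acc_prob_def map_fst_run_Randomize pmf_bind ..

text \<open>
  The tape \<open>x\<close> holds one sample \<open>x (t, s)\<close> per time \<open>t\<close> and source \<open>s\<close>; an adaptive algorithm
  reads a single one of the three entries available at each time.  The point is that \<open>F\<close> does
  not depend on the distributions \<open>D\<close>.
\<close>
definition tape_rep_by :: "nat set \<Rightarrow> (nat \<times> source) set \<Rightarrow>
    ((nat \<times> source \<Rightarrow> nat) \<Rightarrow> real) \<Rightarrow> ((source \<Rightarrow> nat pmf) \<Rightarrow> real) \<Rightarrow> bool" where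
  "tape_rep_by Y I F g \<longleftrightarrow> (\<forall>x. 0 \<le> F x \<and> F x \<le> 1) \<and>
     (\<forall>D. (\<forall>s. set_pmf (D s) \<subseteq> Y) \<longrightarrow>
        g D = (\<Sum>x\<in>PiE I (\<lambda>_. Y). (\<Prod>j\<in>I. pmf (D (snd j)) (x j)) * F x))"

definition tape_rep ::
    "nat set \<Rightarrow> (nat \<times> source) set \<Rightarrow> ((source \<Rightarrow> nat pmf) \<Rightarrow> real) \<Rightarrow> bool" where
  "tape_rep Y I g \<longleftrightarrow> (\<exists>F. tape_rep_by Y I F g)"

lemma tape_rep_cong:
  assumes "tape_rep Y I g" "\<And>D. (\<And>s. set_pmf (D s) \<subseteq> Y) \<Longrightarrow> g D = h D"
  shows "tape_rep Y I h"
  using assms(1) unfolding tape_rep_def tape_rep_by_def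
  by (elim ex_forward conj_mono[rule_format, rotated -1]) (simp_all add: assms(2)[symmetric])

lemma tape_rep_const:
  assumes "finite Y" "0 \<le> c" "c \<le> 1"
  shows "tape_rep Y {} (\<lambda>_. c)"
  unfolding tape_rep_def tape_rep_by_def by (rule exI[of _ "\<lambda>_. c"]) (use assms in simp)

text \<open>A sampling step: \<open>F'\<close> reads the fresh entry \<open>j\<close> and runs the
  branch it selects on the rest of the tape. Since \<open>j \<notin> I\<close>, the product weight
  splits off the factor of \<open>j\<close>.\<close>

lemma tape_rep_insert:
  assumes Y: "finite Y" and I: "finite I" "j \<notin> I"
    and g: "\<And>y. y \<in> Y \<Longrightarrow> tape_rep Y I (g y)"
  shows "tape_rep Y (insert j I) (\<lambda>D. \<Sum>y\<in>Y. pmf (D (snd j)) y * g y D)"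
proof -
  have "\<forall>y\<in>Y. \<exists>F. tape_rep_by Y I F (g y)"
    using g by (simp add: tape_rep_def)
  from bchoice[OF this] obtain F where rep: "\<forall>y\<in>Y. tape_rep_by Y I (F y) (g y)" ..
  have F: "\<And>y x. y \<in> Y \<Longrightarrow> 0 \<le> F y x \<and> F y x \<le> 1"
       "\<And>y D. y \<in> Y \<Longrightarrow> (\<forall>s. set_pmf (D s) \<subseteq> Y) \<Longrightarrow>
          g y D = (\<Sum>x\<in>PiE I (\<lambda>_. Y). (\<Prod>i\<in>I. pmf (D (snd i)) (x i)) * F y x)"
    using rep unfolding tape_rep_by_def by simp_all
  \<comment> \<open>The value 0 keeps \<open>F'\<close> within \<open>[0, 1]\<close> for entries
    outside \<open>Y\<close>, where nothing is known about \<open>F\<close>.\<close>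
  define F' where "F' x = (if x j \<in> Y then F (x j) (restrict x I) else 0)" for x
  have "(\<Sum>y\<in>Y. pmf (D (snd j)) y * g y D) =
      (\<Sum>x\<in>PiE (insert j I) (\<lambda>_. Y). (\<Prod>i\<in>insert j I. pmf (D (snd i)) (x i)) * F' x)"
    if D: "\<forall>s. set_pmf (D s) \<subseteq> Y" for D
  proof -
    have "(\<Sum>x\<in>PiE (insert j I) (\<lambda>_. Y). (\<Prod>i\<in>insert j I. pmf (D (snd i)) (x i)) * F' x)
        = (\<Sum>(y, x)\<in>Y \<times> PiE I (\<lambda>_. Y).
            (\<Prod>i\<in>insert j I. pmf (D (snd i)) ((x(j := y)) i)) * F' (x(j := y)))"
      unfolding PiE_insert_eq
      by (subst sum.reindex) (use inj_combinator[OF I(2)] in \<open>auto simp: case_prod_unfold\<close>)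
    also have "\<dots> = (\<Sum>(y, x)\<in>Y \<times> PiE I (\<lambda>_. Y).
            pmf (D (snd j)) y * ((\<Prod>i\<in>I. pmf (D (snd i)) (x i)) * F y x))"
    proof (intro sum.cong refl, clarify)
      fix y x assume yx: "y \<in> Y" "x \<in> PiE I (\<lambda>_. Y)"
      have "restrict (x(j := y)) I = x"
      proof
        fix t show "restrict (x(j := y)) I t = x t"
          using I(2) PiE_arb[OF yx(2), of t] by (cases "t \<in> I") auto
      qed
      moreover have "(\<Prod>i\<in>I. pmf (D (snd i)) ((x(j := y)) i)) = (\<Prod>i\<in>I. pmf (D (snd i)) (x i))"
        by (intro prod.cong) (use I(2) in auto)
      ultimately show "(\<Prod>i\<in>insert j I. pmf (D (snd i)) ((x(j := y)) i)) * F' (x(j := y)) =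
          pmf (D (snd j)) y * ((\<Prod>i\<in>I. pmf (D (snd i)) (x i)) * F y x)"
        using I yx by (simp add: F'_def)
    qed
    also have "\<dots> = (\<Sum>y\<in>Y. pmf (D (snd j)) y * g y D)"
      unfolding sum.cartesian_product[symmetric]
      by (intro sum.cong refl) (simp add: F(2) D sum_distrib_left)
    finally show ?thesis ..
  qed
  moreover have "0 \<le> F' x \<and> F' x \<le> 1" for x
    using F(1) by (auto simp: F'_def)
  ultimately show ?thesis
    unfolding tape_rep_def tape_rep_by_def by (intro exI[of _ F']) simp
qed

text \<open>Unread entries have total mass 1, so they can be added one at a time through branches
  that ignore them. This brings all branches of an algorithm to a common tape.\<close>

lemma tape_rep_mono:
  assumes Y: "finite Y" and I: "finite I'" "I \<subseteq> I'" and g: "tape_rep Y I g"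
  shows "tape_rep Y I' g"
proof -
  have "finite J \<Longrightarrow> J \<inter> I = {} \<Longrightarrow> tape_rep Y (J \<union> I) g" for J
  proof (induction J rule: finite_induct)
    case empty
    then show ?case using g by simp
  next
    case (insert j J)
    have fin: "finite (J \<union> I)" using insert I by (auto intro: finite_subset)
    have "tape_rep Y (insert j (J \<union> I)) (\<lambda>D. \<Sum>y\<in>Y. pmf (D (snd j)) y * g D)"
      by (rule tape_rep_insert) (use insert Y fin in auto)
    then have "tape_rep Y (insert j (J \<union> I)) g"
      by (rule tape_rep_cong) (simp add: sum_distrib_right[symmetric] sum_pmf_eq_1 Y)
    then show ?case by simp
  qed
  moreover have "(I' - I) \<union> I = I'" "finite (I' - I)" "(I' - I) \<inter> I = {}"
    using I by auto
  ultimately show ?thesis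
    by metis
qed

text \<open>Internal coins average the tape functions. Here the support may be infinite, and the
  bounds 0 and 1 supply integrability.\<close>

lemma tape_rep_expectation:
  fixes r :: "'a pmf"
  assumes Y: "finite Y" and I: "finite I"
    and g: "\<And>a. a \<in> set_pmf r \<Longrightarrow> tape_rep Y I (g a)"
  shows "tape_rep Y I (\<lambda>D. measure_pmf.expectation r (\<lambda>a. g a D))"
proof -
  have "\<forall>a\<in>set_pmf r. \<exists>F. tape_rep_by Y I F (g a)"
    using g by (simp add: tape_rep_def)
  from bchoice[OF this] obtain F where rep: "\<forall>a\<in>set_pmf r. tape_rep_by Y I (F a) (g a)" ..
  have F: "\<And>a x. a \<in> set_pmf r \<Longrightarrow> 0 \<le> F a x \<and> F a x \<le> 1"
       "\<And>a D. a \<in> set_pmf r \<Longrightarrow> (\<forall>s. set_pmf (D s) \<subseteq> Y) \<Longrightarrow>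
          g a D = (\<Sum>x\<in>PiE I (\<lambda>_. Y). (\<Prod>i\<in>I. pmf (D (snd i)) (x i)) * F a x)"
    using rep unfolding tape_rep_by_def by simp_all
  define F' where "F' x = measure_pmf.expectation r (\<lambda>a. F a x)" for x
  have int: "integrable (measure_pmf r) (\<lambda>a. F a x)" for x
    by (rule measure_pmf.integrable_const_bound[of _ 1])
       (use F(1) in \<open>auto simp: AE_measure_pmf_iff\<close>)
  have "0 \<le> F' x \<and> F' x \<le> 1" for x
  proof
    show "0 \<le> F' x" unfolding F'_def
      by (rule integral_nonneg_AE) (use F(1) in \<open>auto simp: AE_measure_pmf_iff\<close>)
    show "F' x \<le> 1" unfolding F'_def
      by (rule measure_pmf.integral_le_const[OF int]) (use F(1) in \<open>auto simp: AE_measure_pmf_iff\<close>)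
  qed
  moreover have "measure_pmf.expectation r (\<lambda>a. g a D) =
      (\<Sum>x\<in>PiE I (\<lambda>_. Y). (\<Prod>i\<in>I. pmf (D (snd i)) (x i)) * F' x)"
    if D: "\<forall>s. set_pmf (D s) \<subseteq> Y" for D
  proof -
    have "measure_pmf.expectation r (\<lambda>a. g a D) = measure_pmf.expectation r
        (\<lambda>a. \<Sum>x\<in>PiE I (\<lambda>_. Y). (\<Prod>i\<in>I. pmf (D (snd i)) (x i)) * F a x)"
      by (rule integral_cong_AE) (use F(2) D in \<open>auto simp: AE_measure_pmf_iff\<close>)
    also have "\<dots> = (\<Sum>x\<in>PiE I (\<lambda>_. Y). (\<Prod>i\<in>I. pmf (D (snd i)) (x i)) * F' x)"
      by (subst Bochner_Integration.integral_sum) (auto simp: F'_def int)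
    finally show ?thesis .
  qed
  ultimately show ?thesis
    unfolding tape_rep_def tape_rep_by_def by (intro exI[of _ F']) simp
qed

lemma UNIV_source: "UNIV = {FromP, FromQ1, FromQ2}"
  using source.exhaust by auto

instance source :: finite
  by standard (simp add: UNIV_source)

text \<open>Induction on the computation tree, with times counted downwards: under budget
  \<open>Suc m'\<close> the first sample is the entry at time \<open>m'\<close>, leaving the times
  below \<open>m'\<close> to the subtrees. The budget is measured on uniform sources because they
  reach every branch that any source supported in \<open>Y\<close> can reach.\<close>

lemma tape_rep_acc_prob:
  assumes Y: "finite Y" "Y \<noteq> {}"
    and "\<And>v c. (v, c) \<in> set_pmf (run (\<lambda>_. pmf_of_set Y) A) \<Longrightarrow> c \<le> m"
  shows "tape_rep Y ({..<m} \<times> UNIV) (acc_prob A)"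
  using assms(3)
proof (induction A arbitrary: m)
  case (Output v)
  have "tape_rep Y {} (\<lambda>_. if v = Accept then 1 else 0)"
    by (rule tape_rep_const) (use Y in auto)
  then have "tape_rep Y ({..<m} \<times> UNIV) (\<lambda>_. if v = Accept then 1 else 0)"
    using Y by (elim tape_rep_mono[rotated -1]) auto
  then show ?case by (rule tape_rep_cong) (simp add: acc_prob_Output)
next
  case (Sample s k)
  have set: "(v, Suc c) \<in> set_pmf (run (\<lambda>_. pmf_of_set Y) (Sample s k))"
    if "y \<in> Y" "(v, c) \<in> set_pmf (run (\<lambda>_. pmf_of_set Y) (k y))" for y v c
    using that Y by (force simp: image_iff)
  \<comment> \<open>Following one branch shows that at least one sample is drawn, so
    \<open>m\<close> is a successor.\<close>
  obtain y0 where y0: "y0 \<in> Y" using Y by auto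
  obtain v0 c0 where "(v0, c0) \<in> set_pmf (run (\<lambda>_. pmf_of_set Y) (k y0))"
    by (metis all_not_in_conv set_pmf_not_empty surj_pair)
  from Sample.prems[OF set[OF y0 this]] obtain m' where m: "m = Suc m'"
    by (cases m) auto
  have IH: "tape_rep Y ({..<m'} \<times> UNIV) (acc_prob (k y))" if "y \<in> Y" for y
    by (rule Sample.IH) (use Sample.prems[OF set[OF that]] m in auto)
  have "tape_rep Y (insert (m', s) ({..<m'} \<times> UNIV))
      (\<lambda>D. \<Sum>y\<in>Y. pmf (D (snd (m', s))) y * acc_prob (k y) D)"
    by (rule tape_rep_insert) (use Y IH in auto)
  then have "tape_rep Y ({..<m} \<times> UNIV) 
      (\<lambda>D. \<Sum>y\<in>Y. pmf (D (snd (m', s))) y * acc_prob (k y) D)"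
    by (rule tape_rep_mono[rotated -1]) (use Y m in auto)
  then show ?case
    by (rule tape_rep_cong) (simp add: acc_prob_Sample[OF Y(1)])
next
  case (Randomize r)
  have "tape_rep Y ({..<m} \<times> UNIV) (\<lambda>D. measure_pmf.expectation r (\<lambda>A. acc_prob A D))"
  proof (rule tape_rep_expectation)
    fix A assume A: "A \<in> set_pmf r"
    show "tape_rep Y ({..<m} \<times> UNIV) (acc_prob A)"
      by (rule Randomize.IH[OF A]) (use Randomize.prems A in \<open>auto simp: join_eq_bind_pmf\<close>)
  qed (use Y in auto)
  then show ?case by (simp add: acc_prob_Randomize[abs_def])
qed

section \<open>Second moment of the likelihood ratio\<close>

text \<open>
  The element \<open>y\<close> of \<open>{1..2 * L}\<close> stands for a pair index below \<open>L\<close> together with a bit \<open>\<plusminus>1\<close>.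
  Bits are fair under the null hypothesis; under the alternative the bit of pair \<open>i\<close> is biased
  towards \<open>\<zeta> i\<close> in samples from \<open>p\<close> and towards \<open>- \<zeta> i\<close> in samples from \<open>q1 = q2\<close>.
\<close>
definition pair_of :: "nat \<Rightarrow> nat" where
  "pair_of y = (y - 1) div 2"

definition bit_of :: "nat \<Rightarrow> real" where
  "bit_of y = (if even y then 1 else - 1)"

lemma pair_bit_simps [simp]:
  "pair_of (Suc (2 * i)) = i" "pair_of (Suc (Suc (2 * i))) = i"
  "bit_of (Suc (2 * i)) = -1" "bit_of (Suc (Suc (2 * i))) = 1"
  by (auto simp: pair_of_def bit_of_def)

lemma pair_of_less: "y \<in> {1..2 * L} \<Longrightarrow> pair_of y < L"
  by (auto simp: pair_of_def)

lemma pair_fiber: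
  assumes "i < L"
  shows "{y \<in> {1..2 * L}. pair_of y = i} = {2 * i + 1, 2 * i + 2}"
proof -
  have "y = 2 * ((y - 1) div 2) + 1 \<or> y = 2 * ((y - 1) div 2) + 2" if "y \<ge> 1" for y :: nat
    using that by presburger
  then show ?thesis
    using assms by (fastforce simp: pair_of_def)
qed

lemma sum_pairs:
  fixes g :: "nat \<Rightarrow> 'a :: comm_monoid_add"
  shows "(\<Sum>y\<in>{1..2 * L}. g y) = (\<Sum>i<L. g (2 * i + 1) + g (2 * i + 2))"
proof (induction L)
  case (Suc L)
  have "{1..2 * Suc L} = insert (2 * L + 2) (insert (2 * L + 1) {1..2 * L})"
    by auto
  then show ?case using Suc by (simp add: add_ac)
qed simp

definition signs :: "nat \<Rightarrow> (nat \<Rightarrow> real) set" where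
  "signs L = PiE {..<L} (\<lambda>_. {-1, 1})"

lemma finite_signs [simp]: "finite (signs L)"
  by (simp add: signs_def finite_PiE)

lemma card_signs: "card (signs L) = 2 ^ L"
  by (simp add: signs_def card_PiE numeral_2_eq_2)

lemma signs_values: "\<zeta> \<in> signs L \<Longrightarrow> i < L \<Longrightarrow> \<zeta> i = 1 \<or> \<zeta> i = -1"
  by (auto simp: signs_def PiE_def Pi_def)

lemma sum_signs_prod:
  "(\<Sum>\<zeta>\<in>signs L. \<Prod>i<L. h i (\<zeta> i)) = (\<Prod>i<L. h i (-1) + h i 1 :: real)"
  unfolding signs_def by (subst prod_sum_PiE[symmetric]) auto

text \<open>Coordinatewise multiplication by \<open>\<zeta>\<close> is an involution of
  \<open>signs L\<close>. The condition on \<open>f\<close> is there because the unrestricted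
  product is not extensional outside \<open>{..<L}\<close>.\<close>

lemma sum_signs_mult:
  fixes f :: "(nat \<Rightarrow> real) \<Rightarrow> real"
  assumes \<zeta>: "\<zeta> \<in> signs L"
    and f: "\<And>\<eta> \<eta>'. (\<And>i. i < L \<Longrightarrow> \<eta> i = \<eta>' i) \<Longrightarrow> f \<eta> = f \<eta>'"
  shows "(\<Sum>\<eta>\<in>signs L. f (\<lambda>i. \<zeta> i * \<eta> i)) = (\<Sum>\<eta>\<in>signs L. f \<eta>)"
proof (rule sum.reindex_bij_witness[of _
    "\<lambda>\<eta>. restrict (\<lambda>i. \<zeta> i * \<eta> i) {..<L}" "\<lambda>\<eta>. restrict (\<lambda>i. \<zeta> i * \<eta> i) {..<L}"])
  have *: "restrict (\<lambda>i. \<zeta> i * \<eta> i) {..<L} \<in> signs L" if "\<eta> \<in> signs L" for \<eta>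
    using signs_values[OF \<zeta>] signs_values[OF that] by (fastforce simp: signs_def)
  have **: "restrict (\<lambda>i. \<zeta> i * restrict (\<lambda>i. \<zeta> i * \<eta> i) {..<L} i) {..<L} = \<eta>"
    if "\<eta> \<in> signs L" for \<eta>
  proof
    fix i
    show "restrict (\<lambda>i. \<zeta> i * restrict (\<lambda>i. \<zeta> i * \<eta> i) {..<L} i) {..<L} i = \<eta> i"
      using signs_values[OF \<zeta>, of i] PiE_arb[OF that[unfolded signs_def], of i]
      by (cases "i < L") auto
  qed
  fix \<eta> assume \<eta>: "\<eta> \<in> signs L"
  show "restrict (\<lambda>i. \<zeta> i * \<eta> i) {..<L} \<in> signs L" by (rule *[OF \<eta>])
  show "restrict (\<lambda>i. \<zeta> i * \<eta> i) {..<L} \<in> signs L" by (rule *[OF \<eta>])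
  show "restrict (\<lambda>i. \<zeta> i * restrict (\<lambda>i. \<zeta> i * \<eta> i) {..<L} i) {..<L} = \<eta>" by (rule **[OF \<eta>])
  show "restrict (\<lambda>i. \<zeta> i * restrict (\<lambda>i. \<zeta> i * \<eta> i) {..<L} i) {..<L} = \<eta>" by (rule **[OF \<eta>])
  show "f (restrict (\<lambda>i. \<zeta> i * \<eta> i) {..<L}) = f (\<lambda>i. \<zeta> i * \<eta> i)"
    by (rule f) simp
qed

text \<open>With \<open>v\<close> the product of two tilts, this is what remains of the overlap of
  two perturbed hypotheses, relative to the fair one, after the bits are summed out and the signs
  averaged.\<close>

definition corr :: "nat \<Rightarrow> 'b set \<Rightarrow> (nat \<Rightarrow> real) \<Rightarrow> ('b \<Rightarrow> nat) \<Rightarrow> real" where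
  "corr L I v i = (\<Sum>\<zeta>\<in>signs L. \<Prod>t\<in>I. 1 + v (i t) * \<zeta> (i t)) / 2 ^ L"

lemma sum_signs_signs:
  assumes "\<And>t. t \<in> I \<Longrightarrow> i t < L"
  shows "(\<Sum>\<zeta>\<in>signs L. \<Sum>\<zeta>'\<in>signs L. \<Prod>t\<in>I. 1 + v (i t) * (\<zeta> (i t) * \<zeta>' (i t)))
       = (2 ^ L)\<^sup>2 * corr L I v i"
proof -
  have "(\<Sum>\<zeta>'\<in>signs L. \<Prod>t\<in>I. 1 + v (i t) * (\<zeta> (i t) * \<zeta>' (i t))) = 2 ^ L * corr L I v i"
    if "\<zeta> \<in> signs L" for \<zeta>
  proof -
    have "(\<Sum>\<zeta>'\<in>signs L. \<Prod>t\<in>I. 1 + v (i t) * (\<zeta> (i t) * \<zeta>' (i t)))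
        = (\<Sum>\<zeta>'\<in>signs L. \<Prod>t\<in>I. 1 + v (i t) * \<zeta>' (i t))"
      by (rule sum_signs_mult[OF that, of "\<lambda>\<zeta>'. \<Prod>t\<in>I. 1 + v (i t) * \<zeta>' (i t)"])
         (use assms in \<open>auto intro!: prod.cong\<close>)
    then show ?thesis by (simp add: corr_def)
  qed
  then show ?thesis by (simp add: card_signs power2_eq_square)
qed

text \<open>Terms linear in the bit cancel within a pair. The source sign \<open>c\<close> enters
  only as \<open>c * c\<close>, so the opposite tilts of \<open>p\<close> and \<open>q1\<close>
  become invisible to the second moment.\<close>

lemma sum_bits:
  fixes a b c :: real
  assumes "c * c = 1" "i < L"
  shows "(\<Sum>y\<in>{y \<in> {1..2 * L}. pair_of y = i}.
      b / 2 * (1 + u * (c * z) * bit_of y) * (b' / 2 * (1 + u' * (c * z') * bit_of y)))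
    = b * b' / 2 * (1 + u * u' * (z * z'))"
proof -
  have "(\<Sum>y\<in>{y \<in> {1..2 * L}. pair_of y = i}.
      b / 2 * (1 + u * (c * z) * bit_of y) * (b' / 2 * (1 + u' * (c * z') * bit_of y)))
      = b * b' / 2 * (1 + u * u' * (z * z') * (c * c))"
    unfolding pair_fiber[OF assms(2)] by (simp, simp add: field_simps)
  then show ?thesis by (simp add: assms(1))
qed

text \<open>The null hypothesis is itself a mixture: the hidden parameter \<open>S\<close>, uniform
  on \<open>\<Theta>\<close>, sets the pair masses. This composite form is what later hides the
  heavy set.\<close>

definition tape_null :: "'a set \<Rightarrow> ('a \<Rightarrow> nat \<Rightarrow> real) \<Rightarrow> 'b set \<Rightarrow> ('b \<Rightarrow> nat) \<Rightarrow> real" where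
  "tape_null \<Theta> \<beta> I x = (\<Sum>S\<in>\<Theta>. \<Prod>t\<in>I. \<beta> S (pair_of (x t)) / 2) / card \<Theta>"

definition tape_alt ::
    "nat \<Rightarrow> 'a set \<Rightarrow> ('a \<Rightarrow> nat \<Rightarrow> real) \<Rightarrow> ('a \<Rightarrow> nat \<Rightarrow> real) \<Rightarrow> ('b \<Rightarrow> real) \<Rightarrow> 'b set \<Rightarrow>
      ('b \<Rightarrow> nat) \<Rightarrow> real" where
  "tape_alt L \<Theta> \<beta> u \<sigma> I x = (\<Sum>(S, \<zeta>)\<in>\<Theta> \<times> signs L. \<Prod>t\<in>I. \<beta> S (pair_of (x t)) / 2 *
      (1 + u S (pair_of (x t)) * (\<sigma> t * \<zeta> (pair_of (x t))) * bit_of (x t))) / (card \<Theta> * 2 ^ L)"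

text \<open>
  The null likelihood depends on the pair indices \<open>i\<close> only, so the bits can be summed out first;
  the product of two sign vectors is again a uniform sign vector.
\<close>
lemma fiber_second_moment:
  fixes \<beta> u :: "'a \<Rightarrow> nat \<Rightarrow> real"
  assumes I: "finite I" and i: "i \<in> PiE I (\<lambda>_. {..<L})"
    and \<sigma>: "\<And>t. t \<in> I \<Longrightarrow> \<sigma> t * \<sigma> t = 1"
  shows "(\<Sum>x\<in>PiE I (\<lambda>t. {y \<in> {1..2 * L}. pair_of y = i t}). (tape_alt L \<Theta> \<beta> u \<sigma> I x)\<^sup>2) =
     (\<Sum>S\<in>\<Theta>. \<Sum>S'\<in>\<Theta>. (\<Prod>t\<in>I. \<beta> S (i t)) * (\<Prod>t\<in>I. \<beta> S' (i t)) *
        corr L I (\<lambda>j. u S j * u S' j) i) / ((card \<Theta>)\<^sup>2 * 2 ^ card I)"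
proof -
  define X where "X = PiE I (\<lambda>t. {y \<in> {1..2 * L}. pair_of y = i t})"
  define g where "g = (\<lambda>(S, \<zeta>) t y. \<beta> S (i t) / 2 * (1 + u S (i t) * (\<sigma> t * \<zeta> (i t)) * bit_of y))"
  have iL: "i t < L" if "t \<in> I" for t
    using i that by auto
  have alt: "tape_alt L \<Theta> \<beta> u \<sigma> I x =
      (\<Sum>p\<in>\<Theta> \<times> signs L. \<Prod>t\<in>I. g p t (x t)) / (card \<Theta> * 2 ^ L)" if "x \<in> X" for x
  proof -
    have "pair_of (x t) = i t" if "t \<in> I" for t
      using \<open>x \<in> X\<close> that unfolding X_def by auto
    then show ?thesis
      unfolding tape_alt_def g_def
      by (intro arg_cong2[of _ _ _ _ "(/)"] sum.cong refl) (auto intro!: prod.cong)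
  qed
  have "(\<Sum>x\<in>X. (tape_alt L \<Theta> \<beta> u \<sigma> I x)\<^sup>2) =
      (\<Sum>x\<in>X. (\<Sum>p\<in>\<Theta> \<times> signs L. \<Prod>t\<in>I. g p t (x t))\<^sup>2) / (card \<Theta> * 2 ^ L)\<^sup>2"
    unfolding sum_divide_distrib by (intro sum.cong refl) (simp add: alt power_divide)
  also have "(\<Sum>x\<in>X. (\<Sum>p\<in>\<Theta> \<times> signs L. \<Prod>t\<in>I. g p t (x t))\<^sup>2) =
      (\<Sum>x\<in>X. \<Sum>p\<in>\<Theta> \<times> signs L. \<Sum>p'\<in>\<Theta> \<times> signs L. \<Prod>t\<in>I. g p t (x t) * g p' t (x t))"
    by (simp add: power2_eq_square sum_product prod.distrib)
  also have "\<dots> = (\<Sum>p\<in>\<Theta> \<times> signs L. \<Sum>x\<in>X. \<Sum>p'\<in>\<Theta> \<times> signs L. \<Prod>t\<in>I. g p t (x t) * g p' t (x t))"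
    by (rule sum.swap)
  also have "\<dots> = (\<Sum>p\<in>\<Theta> \<times> signs L. \<Sum>p'\<in>\<Theta> \<times> signs L. \<Sum>x\<in>X. \<Prod>t\<in>I. g p t (x t) * g p' t (x t))"
    by (intro sum.cong refl sum.swap)
  also have "\<dots> = (\<Sum>p\<in>\<Theta> \<times> signs L. \<Sum>p'\<in>\<Theta> \<times> signs L. \<Prod>t\<in>I.
      \<Sum>y\<in>{y \<in> {1..2 * L}. pair_of y = i t}. g p t y * g p' t y)"
    unfolding X_def using I by (intro sum.cong refl prod_sum_PiE[symmetric]) auto
  also have "\<dots> = (\<Sum>(S, \<zeta>)\<in>\<Theta> \<times> signs L. \<Sum>(S', \<zeta>')\<in>\<Theta> \<times> signs L. \<Prod>t\<in>I.
      \<beta> S (i t) * \<beta> S' (i t) / 2 * (1 + u S (i t) * u S' (i t) * (\<zeta> (i t) * \<zeta>' (i t))))"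
    unfolding g_def case_prod_unfold
    by (intro sum.cong refl prod.cong) (simp only: sum_bits[OF \<sigma> iL])
  also have "\<dots> = (\<Sum>S\<in>\<Theta>. \<Sum>\<zeta>\<in>signs L. \<Sum>S'\<in>\<Theta>. \<Sum>\<zeta>'\<in>signs L. \<Prod>t\<in>I.
      \<beta> S (i t) * \<beta> S' (i t) / 2 * (1 + u S (i t) * u S' (i t) * (\<zeta> (i t) * \<zeta>' (i t))))"
    by (simp only: sum.cartesian_product[symmetric])
  also have "\<dots> = (\<Sum>S\<in>\<Theta>. \<Sum>S'\<in>\<Theta>. \<Sum>\<zeta>\<in>signs L. \<Sum>\<zeta>'\<in>signs L. \<Prod>t\<in>I.
      \<beta> S (i t) * \<beta> S' (i t) / 2 * (1 + u S (i t) * u S' (i t) * (\<zeta> (i t) * \<zeta>' (i t))))"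
    by (intro sum.cong refl sum.swap)
  also have "\<dots> = (\<Sum>S\<in>\<Theta>. \<Sum>S'\<in>\<Theta>. (\<Prod>t\<in>I. \<beta> S (i t) * \<beta> S' (i t) / 2) *
      (\<Sum>\<zeta>\<in>signs L. \<Sum>\<zeta>'\<in>signs L. \<Prod>t\<in>I. 1 + u S (i t) * u S' (i t) * (\<zeta> (i t) * \<zeta>' (i t))))"
    by (simp only: prod.distrib sum_distrib_left)
  also have "\<dots> = (\<Sum>S\<in>\<Theta>. \<Sum>S'\<in>\<Theta>. (\<Prod>t\<in>I. \<beta> S (i t) * \<beta> S' (i t) / 2) *
      ((2 ^ L)\<^sup>2 * corr L I (\<lambda>j. u S j * u S' j) i))"
    by (intro sum.cong refl arg_cong2[of _ _ _ _ "(*)"]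
        sum_signs_signs[of I i L "\<lambda>j. u _ j * u _ j"] iL) 
  also have "\<dots> = (\<Sum>S\<in>\<Theta>. \<Sum>S'\<in>\<Theta>. (\<Prod>t\<in>I. \<beta> S (i t)) * (\<Prod>t\<in>I. \<beta> S' (i t)) *
      corr L I (\<lambda>j. u S j * u S' j) i) * ((2 ^ L)\<^sup>2 / 2 ^ card I)"
    unfolding sum_distrib_right by (intro sum.cong refl) (simp add: prod.distrib prod_dividef)
  finally show ?thesis
    unfolding X_def by (simp add: power_mult_distrib field_simps)
qed

lemma sum_tapes_by_pairs:
  assumes "finite I"
  shows "(\<Sum>x\<in>PiE I (\<lambda>_. {1..2 * L}). h x) =
    (\<Sum>i\<in>PiE I (\<lambda>_. {..<L}). \<Sum>x\<in>PiE I (\<lambda>t. {y \<in> {1..2 * L}. pair_of y = i t}). h x :: real)"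
proof -
  define p where "p x = restrict (\<lambda>t. pair_of (x t)) I" for x :: "'a \<Rightarrow> nat"
  have fib: "{x \<in> PiE I (\<lambda>_. {1..2 * L}). p x = i} = PiE I (\<lambda>t. {y \<in> {1..2 * L}. pair_of y = i t})"
    if "i \<in> PiE I (\<lambda>_. {..<L})" for i
  proof -
    have "p x = i \<longleftrightarrow> (\<forall>t\<in>I. pair_of (x t) = i t)" for x
      using that unfolding p_def
      by (auto simp: fun_eq_iff restrict_def PiE_arb[OF that])
    then show ?thesis by (auto simp: PiE_def Pi_def)
  qed
  have "(\<Sum>x\<in>PiE I (\<lambda>_. {1..2 * L}). h x) =
      (\<Sum>i\<in>PiE I (\<lambda>_. {..<L}). \<Sum>x\<in>{x \<in> PiE I (\<lambda>_. {1..2 * L}). p x = i}. h x)"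
  proof (rule sum.group[symmetric])
    have "pair_of (x t) < L" if "x \<in> PiE I (\<lambda>_. {1..2 * L})" "t \<in> I" for x t
      using PiE_mem[OF that] by (rule pair_of_less)
    then show "p ` PiE I (\<lambda>_. {1..2 * L}) \<subseteq> PiE I (\<lambda>_. {..<L})"
      by (auto simp: p_def)
  qed (use assms in \<open>auto simp: finite_PiE\<close>)
  also have "\<dots> = (\<Sum>i\<in>PiE I (\<lambda>_. {..<L}).
      \<Sum>x\<in>PiE I (\<lambda>t. {y \<in> {1..2 * L}. pair_of y = i t}). h x)"
    by (intro sum.cong fib refl)
  finally show ?thesis .
qed

text \<open>The null likelihood is constant on the tapes with given pair indices, so it leaves the
  inner sum, and the powers of 2 cancel against \<open>fiber_second_moment\<close>.\<close>

lemma tape_second_moment: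
  fixes \<beta> u :: "'a \<Rightarrow> nat \<Rightarrow> real"
  assumes I: "finite I" and \<sigma>: "\<And>t. t \<in> I \<Longrightarrow> \<sigma> t * \<sigma> t = 1"
    and \<Theta>: "finite \<Theta>" "\<Theta> \<noteq> {}"
  shows "(\<Sum>x\<in>PiE I (\<lambda>_. {1..2 * L}). (tape_alt L \<Theta> \<beta> u \<sigma> I x)\<^sup>2 / tape_null \<Theta> \<beta> I x) =
    (\<Sum>i\<in>PiE I (\<lambda>_. {..<L}). (\<Sum>S\<in>\<Theta>. \<Sum>S'\<in>\<Theta>. (\<Prod>t\<in>I. \<beta> S (i t)) * (\<Prod>t\<in>I. \<beta> S' (i t)) *
        corr L I (\<lambda>j. u S j * u S' j) i) / (card \<Theta> * (\<Sum>S\<in>\<Theta>. \<Prod>t\<in>I. \<beta> S (i t))))"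
proof -
  have "(\<Sum>x\<in>PiE I (\<lambda>t. {y \<in> {1..2 * L}. pair_of y = i t}).
        (tape_alt L \<Theta> \<beta> u \<sigma> I x)\<^sup>2 / tape_null \<Theta> \<beta> I x) =
      (\<Sum>S\<in>\<Theta>. \<Sum>S'\<in>\<Theta>. (\<Prod>t\<in>I. \<beta> S (i t)) * (\<Prod>t\<in>I. \<beta> S' (i t)) *
        corr L I (\<lambda>j. u S j * u S' j) i) / (card \<Theta> * (\<Sum>S\<in>\<Theta>. \<Prod>t\<in>I. \<beta> S (i t)))"
    if i: "i \<in> PiE I (\<lambda>_. {..<L})" for i
  proof -
    have null: "tape_null \<Theta> \<beta> I x = (\<Sum>S\<in>\<Theta>. \<Prod>t\<in>I. \<beta> S (i t)) / (card \<Theta> * 2 ^ card I)"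
      if "x \<in> PiE I (\<lambda>t. {y \<in> {1..2 * L}. pair_of y = i t})" for x
    proof -
      have "pair_of (x t) = i t" if "t \<in> I" for t
        using \<open>x \<in> _\<close> that by auto
      then show ?thesis
        by (simp add: tape_null_def prod_dividef sum_divide_distrib mult.commute)
    qed
    have "(\<Sum>x\<in>PiE I (\<lambda>t. {y \<in> {1..2 * L}. pair_of y = i t}).
        (tape_alt L \<Theta> \<beta> u \<sigma> I x)\<^sup>2 / tape_null \<Theta> \<beta> I x) =
      (\<Sum>x\<in>PiE I (\<lambda>t. {y \<in> {1..2 * L}. pair_of y = i t}). (tape_alt L \<Theta> \<beta> u \<sigma> I x)\<^sup>2) /
        ((\<Sum>S\<in>\<Theta>. \<Prod>t\<in>I. \<beta> S (i t)) / (card \<Theta> * 2 ^ card I))"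
      by (subst sum_divide_distrib) (intro sum.cong refl, simp only: null)
    also note fiber_second_moment[OF I i \<sigma>]
    finally show ?thesis
      using \<Theta> by (simp add: power2_eq_square)
  qed
  then show ?thesis
    unfolding sum_tapes_by_pairs[OF I] by (intro sum.cong refl) simp
qed

text \<open>Cauchy-Schwarz for the gap \<open>1/3\<close>, with \<open>sqrt (N x)\<close> as the
  splitting weight, gives chi-square distance at least \<open>1/9\<close>; the right-hand sum is 1
  plus that distance.\<close>

lemma chi_square_testing:
  fixes N A F :: "'a \<Rightarrow> real"
  assumes N: "\<And>x. x \<in> X \<Longrightarrow> N x > 0" "sum N X = 1" and A: "sum A X = 1"
    and F: "\<And>x. x \<in> X \<Longrightarrow> 0 \<le> F x \<and> F x \<le> 1"
    and gap: "(\<Sum>x\<in>X. N x * F x) \<ge> 2/3" "(\<Sum>x\<in>X. A x * F x) \<le> 1/3"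
  shows "10/9 \<le> (\<Sum>x\<in>X. (A x)\<^sup>2 / N x)"
proof -
  have "1/3 \<le> (\<Sum>x\<in>X. (N x - A x) * F x)"
    using gap by (simp add: left_diff_distrib sum_subtractf)
  then have "(1/3)\<^sup>2 \<le> (\<Sum>x\<in>X. (N x - A x) * F x)\<^sup>2"
    by (rule power_mono) simp
  also have "\<dots> = (\<Sum>x\<in>X. ((N x - A x) / sqrt (N x)) * (sqrt (N x) * F x))\<^sup>2"
    by (intro arg_cong[of _ _ "\<lambda>x. x\<^sup>2"] sum.cong refl) (use N(1) in force)
  also have "\<dots> \<le> (\<Sum>x\<in>X. ((N x - A x) / sqrt (N x))\<^sup>2) * (\<Sum>x\<in>X. (sqrt (N x) * F x)\<^sup>2)"
    by (rule Cauchy_Schwarz_ineq_sum)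
  also have "\<dots> \<le> (\<Sum>x\<in>X. ((N x - A x) / sqrt (N x))\<^sup>2) * 1"
  proof (rule mult_left_mono)
    have "(\<Sum>x\<in>X. (sqrt (N x) * F x)\<^sup>2) \<le> sum N X"
    proof (rule sum_mono)
      fix x assume x: "x \<in> X"
      have "(F x)\<^sup>2 \<le> 1"
        using F[OF x] by (simp add: power_le_one)
      then show "(sqrt (N x) * F x)\<^sup>2 \<le> N x"
        using N(1)[OF x] by (simp add: power_mult_distrib)
    qed
    then show "(\<Sum>x\<in>X. (sqrt (N x) * F x)\<^sup>2) \<le> 1" using N by simp
  qed (simp add: sum_nonneg)
  also have "(\<Sum>x\<in>X. ((N x - A x) / sqrt (N x))\<^sup>2) = (\<Sum>x\<in>X. (A x)\<^sup>2 / N x - 2 * A x + N x)"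
  proof (rule sum.cong[OF refl])
    fix x assume "x \<in> X"
    then have "N x > 0" by (rule N)
    then show "((N x - A x) / sqrt (N x))\<^sup>2 = (A x)\<^sup>2 / N x - 2 * A x + N x"
      by (simp add: power_divide power2_diff field_simps power2_eq_square)
  qed
  also have "\<dots> = (\<Sum>x\<in>X. (A x)\<^sup>2 / N x) - 1"
    using N A by (simp add: sum.distrib sum_subtractf sum_distrib_left[symmetric])
  finally show ?thesis by (simp add: power2_eq_square)
qed

section \<open>The hard instances and the second moment forced by a correct tester\<close>

definition perturbed :: "nat \<Rightarrow> (nat \<Rightarrow> real) \<Rightarrow> (nat \<Rightarrow> real) \<Rightarrow> (nat \<Rightarrow> real) \<Rightarrow> nat pmf" where
  "perturbed L \<beta> u z = embed_pmf (\<lambda>y. if y \<in> {1..2 * L}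
     then \<beta> (pair_of y) / 2 * (1 + u (pair_of y) * z (pair_of y) * bit_of y) else 0)"

lemma pmf_perturbed:
  assumes \<beta>: "\<And>i. i < L \<Longrightarrow> 0 \<le> \<beta> i" "(\<Sum>i<L. \<beta> i) = 1"
    and u: "\<And>i. i < L \<Longrightarrow> \<bar>u i * z i\<bar> \<le> 1"
  shows "pmf (perturbed L \<beta> u z) y = (if y \<in> {1..2 * L}
     then \<beta> (pair_of y) / 2 * (1 + u (pair_of y) * z (pair_of y) * bit_of y) else 0)"
  unfolding perturbed_def
proof (rule pmf_embed_pmf)
  let ?f = "\<lambda>y. if y \<in> {1..2 * L}
     then \<beta> (pair_of y) / 2 * (1 + u (pair_of y) * z (pair_of y) * bit_of y) else 0"
  show nonneg: "0 \<le> ?f y" for y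
  proof (cases "y \<in> {1..2 * L}")
    case True
    have "\<bar>u (pair_of y) * z (pair_of y) * bit_of y\<bar> \<le> 1"
      using u[OF pair_of_less[OF True]] by (simp add: bit_of_def)
    then show ?thesis
      using \<beta>(1)[OF pair_of_less[OF True]] True by (auto intro!: mult_nonneg_nonneg)
  qed auto
  have "(\<integral>\<^sup>+ y. ennreal (?f y) \<partial>count_space UNIV) = (\<Sum>y\<in>{1..2 * L}. ennreal (?f y))"
    by (rule nn_integral_count_space') auto
  also have "\<dots> = ennreal (\<Sum>y\<in>{1..2 * L}. ?f y)"
    by (rule sum_ennreal) (rule nonneg)
  also have "(\<Sum>y\<in>{1..2 * L}. ?f y) = (\<Sum>y\<in>{1..2 * L}.
      \<beta> (pair_of y) / 2 * (1 + u (pair_of y) * z (pair_of y) * bit_of y))"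
    by (intro sum.cong) auto
  also have "\<dots> = (\<Sum>i<L. \<beta> i)"
    unfolding sum_pairs by (intro sum.cong refl) (simp, simp add: field_simps)
  finally show "(\<integral>\<^sup>+ y. ennreal (?f y) \<partial>count_space UNIV) = 1"
    by (simp add: \<beta>)
qed

lemma set_pmf_perturbed:
  assumes "\<And>i. i < L \<Longrightarrow> 0 \<le> \<beta> i" "(\<Sum>i<L. \<beta> i) = 1"
    "\<And>i. i < L \<Longrightarrow> \<bar>u i * z i\<bar> \<le> 1"
  shows "set_pmf (perturbed L \<beta> u z) \<subseteq> {1..2 * L}"
  by (auto simp: set_pmf_iff pmf_perturbed[where \<beta> = \<beta>, OF assms] split: if_splits)

text \<open>Both noise sources receive the same sign, so \<open>q1\<close> and \<open>q2\<close>
  coincide and every mixture of them is \<open>q1\<close>.\<close>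

definition source_sign :: "source \<Rightarrow> real" where
  "source_sign s = (if s = FromP then 1 else - 1)"

lemma acc_prob_source_dist:
  assumes "D FromP = p" "D FromQ1 = q1" "D FromQ2 = q2"
  shows "acc_prob A D = prob_verdict A p q1 q2 Accept"
proof -
  have "D s = source_dist p q1 q2 s" for s
    using assms by (cases s) auto
  then have "D = source_dist p q1 q2" ..
  then show ?thesis by (simp add: acc_prob_def prob_verdict_eq)
qed

lemma mixture_same: "mixture \<alpha> q q = pmf q"
  by (simp add: mixture_def fun_eq_iff algebra_simps)

text \<open>The tape function does not know the input, so averaging the two guarantees over
  \<open>\<Theta>\<close> and the signs yields the gap for \<open>chi_square_testing\<close>. Under
  the null all three distributions agree; under the alternative each of the two elements of pair
  \<open>i\<close> adds \<open>\<beta> S i * u S i\<close> to the distance of \<open>p\<close> from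
  every mixture.\<close>

lemma tester_second_moment:
  fixes \<beta> u :: "'a \<Rightarrow> nat \<Rightarrow> real" and \<epsilon> :: real
  assumes A: "noisy_closeness_tester n \<epsilon> A" and rep: "tape_rep {1..2 * L} I (acc_prob A)"
    and I: "finite I" and L: "2 * L \<le> n" and \<Theta>: "finite \<Theta>" "\<Theta> \<noteq> {}"
    and \<beta>: "\<And>S i. S \<in> \<Theta> \<Longrightarrow> i < L \<Longrightarrow> 0 < \<beta> S i" "\<And>S. S \<in> \<Theta> \<Longrightarrow> (\<Sum>i<L. \<beta> S i) = 1"
    and u: "\<And>S i. S \<in> \<Theta> \<Longrightarrow> i < L \<Longrightarrow> 0 \<le> u S i \<and> u S i \<le> 1"
    and far: "\<And>S. S \<in> \<Theta> \<Longrightarrow> \<epsilon> \<le> (\<Sum>i<L. 2 * \<beta> S i * u S i)"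
  shows "10/9 \<le> (\<Sum>x\<in>PiE I (\<lambda>_. {1..2 * L}).
      (tape_alt L \<Theta> \<beta> u (\<lambda>t. source_sign (snd t)) I x)\<^sup>2 / tape_null \<Theta> \<beta> I x)"
proof -
  let ?Y = "{1..2 * L}"
  let ?X = "PiE I (\<lambda>_. ?Y)"
  from rep obtain F where F: "\<And>x. 0 \<le> F x \<and> F x \<le> 1"
    and acc: "\<And>D. (\<forall>s. set_pmf (D s) \<subseteq> ?Y) \<Longrightarrow>
      acc_prob A D = (\<Sum>x\<in>?X. (\<Prod>j\<in>I. pmf (D (snd j)) (x j)) * F x)"
    unfolding tape_rep_def tape_rep_by_def by blast
  define D0 :: "'a \<Rightarrow> source \<Rightarrow> nat pmf"
    where "D0 S s = perturbed L (\<beta> S) (u S) (\<lambda>_. 0)" for S s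
  define D :: "'a \<times> (nat \<Rightarrow> real) \<Rightarrow> source \<Rightarrow> nat pmf"
    where "D = (\<lambda>(S, \<zeta>) s. perturbed L (\<beta> S) (u S) (\<lambda>i. source_sign s * \<zeta> i))"
  have \<beta>0: "0 \<le> \<beta> S i" if "S \<in> \<Theta>" "i < L" for S i
    using \<beta>(1)[OF that] by simp
  have uz: "\<bar>u S i * (source_sign s * \<zeta> i)\<bar> \<le> 1" if "S \<in> \<Theta>" "\<zeta> \<in> signs L" "i < L" for S \<zeta> s i
    using u[OF that(1,3)] signs_values[OF that(2,3)] by (auto simp: source_sign_def)
  have D0: "pmf (D0 S s) y = (if y \<in> ?Y then \<beta> S (pair_of y) / 2 else 0)" if "S \<in> \<Theta>" for S s y
    unfolding D0_def by (subst pmf_perturbed) (use \<beta>0 \<beta> that in auto)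
  have set_D0: "set_pmf (D0 S s) \<subseteq> ?Y" if "S \<in> \<Theta>" for S s
    unfolding D0_def by (rule set_pmf_perturbed) (use \<beta>0 \<beta> that in auto)
  have D: "pmf (D (S, \<zeta>) s) y = (if y \<in> ?Y then \<beta> S (pair_of y) / 2 *
      (1 + u S (pair_of y) * (source_sign s * \<zeta> (pair_of y)) * bit_of y) else 0)"
    if "S \<in> \<Theta>" "\<zeta> \<in> signs L" for S \<zeta> s y
    unfolding D_def prod.case by (rule pmf_perturbed) (use \<beta>0 \<beta> uz that in auto)
  have set_D: "set_pmf (D (S, \<zeta>) s) \<subseteq> ?Y" if "S \<in> \<Theta>" "\<zeta> \<in> signs L" for S \<zeta> s
    unfolding D_def prod.case by (rule set_pmf_perturbed) (use \<beta>0 \<beta> uz that in auto)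
  have total: "(\<Sum>x\<in>?X. \<Prod>j\<in>I. pmf (D' (snd j)) (x j)) = 1"
    if "\<And>s. set_pmf (D' s) \<subseteq> ?Y" for D' :: "source \<Rightarrow> nat pmf"
    using I that by (subst prod_sum_PiE[symmetric]) (auto simp: sum_pmf_eq_1)
  have dists: "p \<in> dists_on n" if "set_pmf p \<subseteq> ?Y" for p
    using that L by (auto simp: dists_on_def)
  define c where "c = real (card \<Theta>)"
  have c: "c > 0" using \<Theta> by (simp add: c_def card_gt_0_iff)
  define c' where "c' = real (card (\<Theta> \<times> signs L))"
  have c': "c' = c * 2 ^ L" by (simp add: c'_def c_def card_cartesian_product card_signs)
  have c'0: "c' > 0" using c by (simp add: c')
  have null: "tape_null \<Theta> \<beta> I x = (\<Sum>S\<in>\<Theta>. \<Prod>j\<in>I. pmf (D0 S (snd j)) (x j)) / c" if "x \<in> ?X" for x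
    unfolding tape_null_def c_def
    by (intro arg_cong2[of _ _ _ _ "(/)"] sum.cong prod.cong refl) (use that in \<open>auto simp: D0\<close>)
  have alt: "tape_alt L \<Theta> \<beta> u (\<lambda>t. source_sign (snd t)) I x =
      (\<Sum>p\<in>\<Theta> \<times> signs L. \<Prod>j\<in>I. pmf (D p (snd j)) (x j)) / c'" if x: "x \<in> ?X" for x
  proof -
    have "x j \<in> ?Y" if "j \<in> I" for j using x that by auto
    then show ?thesis
      unfolding tape_alt_def c' c_def
      by (intro arg_cong2[of _ _ _ _ "(/)"] sum.cong refl) (auto simp: D intro!: prod.cong)
  qed
  have null_acc: "acc_prob A (D0 S) \<ge> 2/3" if S: "S \<in> \<Theta>" for S
  proof -
    let ?p = "D0 S FromP"
    have "acc_prob A (D0 S) = prob_verdict A ?p ?p ?p Accept"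
      by (rule acc_prob_source_dist) (auto simp: D0_def)
    moreover have "\<exists>\<alpha>\<in>{0..1}. pmf ?p = mixture \<alpha> ?p ?p"
      by (intro bexI[of _ 0]) (auto simp: mixture_same)
    ultimately show ?thesis
      using A dists[OF set_D0[OF S]] unfolding noisy_closeness_tester_def by simp
  qed
  have alt_acc: "acc_prob A (D (S, \<zeta>)) \<le> 1/3" if S: "S \<in> \<Theta>" and \<zeta>: "\<zeta> \<in> signs L" for S \<zeta>
  proof -
    let ?p = "D (S, \<zeta>) FromP" and ?q = "D (S, \<zeta>) FromQ1"
    have "D (S, \<zeta>) FromQ2 = ?q" by (simp add: D_def source_sign_def)
    then have acc: "acc_prob A (D (S, \<zeta>)) = prob_verdict A ?p ?q ?q Accept"
      by (intro acc_prob_source_dist) auto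
    have "l1_dist n (pmf ?p) (pmf ?q) = (\<Sum>y\<in>?Y. \<bar>pmf ?p y - pmf ?q y\<bar>)"
      unfolding l1_dist_def using L by (intro sum.mono_neutral_right) (auto simp: D[OF S \<zeta>])
    also have "\<dots> = (\<Sum>y\<in>?Y. \<beta> S (pair_of y) * u S (pair_of y))"
    proof (rule sum.cong[OF refl])
      fix y assume y: "y \<in> ?Y"
      note b = \<beta>0[OF S pair_of_less[OF y]] u[OF S pair_of_less[OF y]]
        signs_values[OF \<zeta> pair_of_less[OF y]]
      have "pmf ?p y - pmf ?q y = \<beta> S (pair_of y) * u S (pair_of y) * (\<zeta> (pair_of y) * bit_of y)"
        using y by (simp add: D[OF S \<zeta>] source_sign_def field_simps)
      moreover have "\<bar>\<zeta> (pair_of y) * bit_of y\<bar> = 1"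
        using b by (auto simp: bit_of_def)
      ultimately show "\<bar>pmf ?p y - pmf ?q y\<bar> = \<beta> S (pair_of y) * u S (pair_of y)"
        using b by (simp add: abs_mult)
    qed
    also have "\<dots> = (\<Sum>i<L. 2 * \<beta> S i * u S i)"
      unfolding sum_pairs by (intro sum.cong) auto
    finally have "l1_dist n (pmf ?p) (mixture \<alpha> ?q ?q) \<ge> \<epsilon>" for \<alpha>
      using far[OF S] by (simp add: mixture_same)
    then have "prob_verdict A ?p ?q ?q Reject \<ge> 2/3"
      using A dists[OF set_D[OF S \<zeta>]] unfolding noisy_closeness_tester_def by simp
    then show ?thesis
      using prob_verdict_Accept_Reject[of A ?p ?q ?q] acc by simp
  qed
  show ?thesis
  proof (rule chi_square_testing[where F = F])
    show "tape_null \<Theta> \<beta> I x > 0" if "x \<in> ?X" for x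
    proof -
      have "x j \<in> ?Y" if "j \<in> I" for j using \<open>x \<in> ?X\<close> that by auto
      then show ?thesis
        unfolding tape_null_def using \<Theta> \<beta>(1) pair_of_less
        by (intro divide_pos_pos sum_pos prod_pos) (auto simp: card_gt_0_iff)
    qed
    have "(\<Sum>x\<in>?X. \<Sum>S\<in>\<Theta>. \<Prod>j\<in>I. pmf (D0 S (snd j)) (x j)) =
        (\<Sum>S\<in>\<Theta>. \<Sum>x\<in>?X. \<Prod>j\<in>I. pmf (D0 S (snd j)) (x j))"
      by (rule sum.swap)
    also have "\<dots> = (\<Sum>S\<in>\<Theta>. 1)"
      by (intro sum.cong refl total) (use set_D0 in auto)
    finally show "sum (tape_null \<Theta> \<beta> I) ?X = 1"
      using c by (simp add: null sum_divide_distrib[symmetric] c_def)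
    have "(\<Sum>x\<in>?X. \<Sum>p\<in>\<Theta> \<times> signs L. \<Prod>j\<in>I. pmf (D p (snd j)) (x j)) =
        (\<Sum>p\<in>\<Theta> \<times> signs L. \<Sum>x\<in>?X. \<Prod>j\<in>I. pmf (D p (snd j)) (x j))"
      by (rule sum.swap)
    also have "\<dots> = (\<Sum>p\<in>\<Theta> \<times> signs L. 1)"
      by (intro sum.cong refl total) (use set_D in auto)
    finally show "sum (tape_alt L \<Theta> \<beta> u (\<lambda>t. source_sign (snd t)) I) ?X = 1"
      using c'0 by (simp add: alt sum_divide_distrib[symmetric] c'_def)
    show "0 \<le> F x \<and> F x \<le> 1" for x by (rule F)
    have "(\<Sum>x\<in>?X. tape_null \<Theta> \<beta> I x * F x) =
        (\<Sum>x\<in>?X. \<Sum>S\<in>\<Theta>. (\<Prod>j\<in>I. pmf (D0 S (snd j)) (x j)) * F x) / c"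
      by (simp add: null sum_divide_distrib[symmetric] sum_distrib_right)
    also have "(\<Sum>x\<in>?X. \<Sum>S\<in>\<Theta>. (\<Prod>j\<in>I. pmf (D0 S (snd j)) (x j)) * F x) =
        (\<Sum>S\<in>\<Theta>. \<Sum>x\<in>?X. (\<Prod>j\<in>I. pmf (D0 S (snd j)) (x j)) * F x)"
      by (rule sum.swap)
    also have "\<dots> = (\<Sum>S\<in>\<Theta>. acc_prob A (D0 S))"
      by (intro sum.cong refl acc[symmetric]) (use set_D0 in auto)
    also have "(\<Sum>S\<in>\<Theta>. acc_prob A (D0 S)) / c \<ge> (\<Sum>S\<in>\<Theta>. 2/3) / c"
      using c null_acc by (intro divide_right_mono sum_mono) auto
    finally show "2/3 \<le> (\<Sum>x\<in>?X. tape_null \<Theta> \<beta> I x * F x)"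
      using c by (simp add: c_def)
    have "(\<Sum>x\<in>?X. tape_alt L \<Theta> \<beta> u (\<lambda>t. source_sign (snd t)) I x * F x) =
        (\<Sum>x\<in>?X. \<Sum>p\<in>\<Theta> \<times> signs L. (\<Prod>j\<in>I. pmf (D p (snd j)) (x j)) * F x) / c'"
      by (simp add: alt sum_divide_distrib[symmetric] sum_distrib_right)
    also have "(\<Sum>x\<in>?X. \<Sum>p\<in>\<Theta> \<times> signs L. (\<Prod>j\<in>I. pmf (D p (snd j)) (x j)) * F x) =
        (\<Sum>p\<in>\<Theta> \<times> signs L. \<Sum>x\<in>?X. (\<Prod>j\<in>I. pmf (D p (snd j)) (x j)) * F x)"
      by (rule sum.swap)
    also have "\<dots> = (\<Sum>p\<in>\<Theta> \<times> signs L. acc_prob A (D p))"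
      by (intro sum.cong refl acc[symmetric]) (use set_D in auto)
    also have "(\<Sum>p\<in>\<Theta> \<times> signs L. acc_prob A (D p)) / c' \<le> (\<Sum>p\<in>\<Theta> \<times> signs L. 1/3) / c'"
      using c'0 alt_acc by (intro divide_right_mono sum_mono) auto
    finally show "(\<Sum>x\<in>?X. tape_alt L \<Theta> \<beta> u (\<lambda>t. source_sign (snd t)) I x * F x) \<le> 1/3"
      using c'0 by (simp add: c'_def)
  qed
qed

section \<open>The two lower bounds\<close>

text \<open>A crude form of \<open>cosh a \<le> exp (a^2 / 2)\<close>: quadratic bounds up to 1, and
  \<open>a \<le> a^2\<close> beyond.\<close>

lemma exp_add_exp_minus_le:
  fixes a :: real
  assumes "0 \<le> a"
  shows "exp (- a) + exp a \<le> 2 * exp (a\<^sup>2)"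
proof (cases "a \<le> 1")
  case True
  have "exp a \<le> 1 + a + a\<^sup>2"
    using assms True by (rule exp_bound)
  moreover have "exp (- a) \<le> 1 - a + a\<^sup>2"
  proof -
    have "exp (- a) = 1 / exp a" by (simp add: exp_minus inverse_eq_divide)
    also have "\<dots> \<le> 1 / (1 + a)"
      using assms by (intro divide_left_mono) auto
    also have "\<dots> \<le> 1 - a + a\<^sup>2"
    proof -
      have "1 \<le> (1 - a + a\<^sup>2) * (1 + a)"
        using assms by (simp add: algebra_simps power2_eq_square)
      then show ?thesis using assms by (simp add: divide_le_eq)
    qed
    finally show ?thesis .
  qed
  moreover have "1 + a\<^sup>2 \<le> exp (a\<^sup>2)" by simp
  ultimately show ?thesis by linarith
next
  case False
  then have "a \<le> a\<^sup>2" using assms by (simp add: power2_eq_square)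
  then have "exp a \<le> exp (a\<^sup>2)" "exp (- a) \<le> exp (a\<^sup>2)"
    using assms False by simp_all
  then show ?thesis by linarith
qed

lemma ln_10_9: "1/10 \<le> ln (10/9 :: real)"
proof -
  have "1 - 1 / (10/9) \<le> ln (10/9 :: real)"
    using ln_one_minus_pos_upper_bound[of "1/10"] by (simp add: ln_div)
  then show ?thesis by simp
qed

text \<open>Equal masses \<open>1 / L\<close> and tilt \<open>\<epsilon> / 2\<close> give distance
  exactly \<open>\<epsilon>\<close>. Summing over the pair indices first leaves the mean over
  \<open>\<zeta>\<close> of an \<open>M\<close>-th power, dominated by the moment generating
  function of a sum of \<open>L\<close> fair signs and hence by \<open>exp (L * a\<^sup>2)\<close>.
  A tester forces \<open>L * a\<^sup>2\<close>, which is
  \<open>M\<^sup>2 * \<epsilon> ^ 4 / (16 * L)\<close>, to be at least \<open>1/10\<close>.\<close>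

lemma uniform_lower_bound:
  fixes \<epsilon> :: real
  assumes A: "noisy_closeness_tester n \<epsilon> A" and rep: "tape_rep {1..2 * L} I (acc_prob A)"
    and I: "finite I" and L: "2 * L \<le> n" "0 < L" and \<epsilon>: "0 < \<epsilon>" "\<epsilon> \<le> 1"
  shows "8 * L \<le> 5 * (card I)\<^sup>2 * \<epsilon> ^ 4"
proof -
  define M where "M = card I"
  define u where "u = \<epsilon> / 2"
  define a where "a = M * u\<^sup>2 / L"
  have u: "0 < u" "u \<le> 1" using \<epsilon> by (simp_all add: u_def)
  have u2: "u\<^sup>2 \<le> 1" using u by (simp add: power_le_one)
  have a: "a \<ge> 0" by (simp add: a_def)
  have sm: "10/9 \<le> (\<Sum>x\<in>PiE I (\<lambda>_. {1..2 * L}). (tape_alt L {()} (\<lambda>_ _. 1 / L) (\<lambda>_ _. u)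
      (\<lambda>t. source_sign (snd t)) I x)\<^sup>2 / tape_null {()} (\<lambda>_ _. 1 / L) I x)"
    by (rule tester_second_moment[OF A rep I L(1)]) (use L u in \<open>auto simp: u_def\<close>)
  also have "\<dots> = (\<Sum>i\<in>PiE I (\<lambda>_. {..<L}). (1 / L) ^ M * corr L I (\<lambda>_. u\<^sup>2) i)"
    using L by (subst tape_second_moment[OF I])
      (auto simp: source_sign_def M_def power2_eq_square field_simps)
  also have "\<dots> = (\<Sum>i\<in>PiE I (\<lambda>_. {..<L}). \<Sum>\<zeta>\<in>signs L. \<Prod>t\<in>I. (1 / L) * (1 + u\<^sup>2 * \<zeta> (i t))) / 2 ^ L"
    by (simp only: corr_def sum_divide_distrib sum_distrib_left times_divide_eq_right
        prod.distrib prod_constant M_def)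
  also have "(\<Sum>i\<in>PiE I (\<lambda>_. {..<L}). \<Sum>\<zeta>\<in>signs L. \<Prod>t\<in>I. (1 / L) * (1 + u\<^sup>2 * \<zeta> (i t))) =
      (\<Sum>\<zeta>\<in>signs L. \<Sum>i\<in>PiE I (\<lambda>_. {..<L}). \<Prod>t\<in>I. (1 / L) * (1 + u\<^sup>2 * \<zeta> (i t)))"
    by (rule sum.swap)
  also have "\<dots> = (\<Sum>\<zeta>\<in>signs L. (\<Sum>j<L. (1 / L) * (1 + u\<^sup>2 * \<zeta> j)) ^ M)"
  proof (rule sum.cong[OF refl])
    fix \<zeta> assume "\<zeta> \<in> signs L"
    have "(\<Sum>i\<in>PiE I (\<lambda>_. {..<L}). \<Prod>t\<in>I. (1 / L) * (1 + u\<^sup>2 * \<zeta> (i t))) =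
        (\<Prod>t\<in>I. \<Sum>j<L. (1 / L) * (1 + u\<^sup>2 * \<zeta> j))"
      by (rule prod_sum_PiE[OF I, symmetric]) simp
    then show "(\<Sum>i\<in>PiE I (\<lambda>_. {..<L}). \<Prod>t\<in>I. (1 / L) * (1 + u\<^sup>2 * \<zeta> (i t))) =
        (\<Sum>j<L. (1 / L) * (1 + u\<^sup>2 * \<zeta> j)) ^ M"
      by (simp only: prod_constant M_def)
  qed
  also have "\<dots> \<le> (\<Sum>\<zeta>\<in>signs L. \<Prod>j<L. exp (a * \<zeta> j))"
  proof (rule sum_mono)
    fix \<zeta> assume \<zeta>: "\<zeta> \<in> signs L"
    have "0 \<le> (\<Sum>j<L. (1 / L) * (1 + u\<^sup>2 * \<zeta> j))"
    proof (intro sum_nonneg mult_nonneg_nonneg)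
      fix j assume "j \<in> {..<L}"
      then show "0 \<le> 1 + u\<^sup>2 * \<zeta> j"
        using signs_values[OF \<zeta>, of j] u2 by auto
    qed simp
    moreover have "(\<Sum>j<L. (1 / L) * (1 + u\<^sup>2 * \<zeta> j)) = 1 + (u\<^sup>2 / L) * (\<Sum>j<L. \<zeta> j)"
    proof -
      have "(\<Sum>j<L. (1 / L) * (1 + u\<^sup>2 * \<zeta> j)) = (1 / L) * (\<Sum>j<L. 1 + u\<^sup>2 * \<zeta> j)"
        by (simp only: sum_distrib_left)
      also have "(\<Sum>j<L. 1 + u\<^sup>2 * \<zeta> j) = L + u\<^sup>2 * (\<Sum>j<L. \<zeta> j)"
        by (simp add: sum.distrib sum_distrib_left)
      finally show ?thesis using L by (simp add: field_simps)
    qed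
    moreover have "1 + (u\<^sup>2 / L) * (\<Sum>j<L. \<zeta> j) \<le> exp ((u\<^sup>2 / L) * (\<Sum>j<L. \<zeta> j))"
      by (rule exp_ge_add_one_self)
    ultimately have "(\<Sum>j<L. (1 / L) * (1 + u\<^sup>2 * \<zeta> j)) ^ M \<le> exp ((u\<^sup>2 / L) * (\<Sum>j<L. \<zeta> j)) ^ M"
      by (intro power_mono) auto
    also have "\<dots> = exp (a * (\<Sum>j<L. \<zeta> j))"
      by (simp add: exp_of_nat_mult[symmetric] a_def)
    also have "\<dots> = (\<Prod>j<L. exp (a * \<zeta> j))"
      by (simp add: sum_distrib_left exp_sum)
    finally show "(\<Sum>j<L. (1 / L) * (1 + u\<^sup>2 * \<zeta> j)) ^ M \<le> (\<Prod>j<L. exp (a * \<zeta> j))" .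
  qed
  also have "(\<Sum>\<zeta>\<in>signs L. \<Prod>j<L. exp (a * \<zeta> j)) = (exp (- a) + exp a) ^ L"
    using sum_signs_prod[where h = "\<lambda>_ x. exp (a * x)"] by simp
  also have "\<dots> \<le> (2 * exp (a\<^sup>2)) ^ L"
    by (intro power_mono exp_add_exp_minus_le a) (simp add: add_nonneg_nonneg)
  also have "(2 * exp (a\<^sup>2)) ^ L = 2 ^ L * exp (L * a\<^sup>2)"
    by (simp add: power_mult_distrib exp_of_nat_mult)
  finally have "10/9 \<le> exp (L * a\<^sup>2)"
    by (simp add: divide_right_mono)
  then have "ln (10/9) \<le> L * a\<^sup>2"
    by (subst exp_le_cancel_iff[symmetric]) simp
  then have "1/10 \<le> L * a\<^sup>2" using ln_10_9 by linarith
  also have "L * a\<^sup>2 = M\<^sup>2 * \<epsilon> ^ 4 / (16 * L)"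
    using L by (simp add: a_def u_def power2_eq_square field_simps eval_nat_numeral)
  finally show ?thesis
    using L by (simp add: field_simps M_def)
qed

section \<open>Collisions and the posterior of the hidden heavy set\<close>

definition hits :: "'b set \<Rightarrow> ('b \<Rightarrow> nat) \<Rightarrow> nat \<Rightarrow> nat" where
  "hits I i j = card {t \<in> I. i t = j}"

lemma prod_by_hits:
  fixes f :: "nat \<Rightarrow> real"
  assumes "finite I" "\<And>t. t \<in> I \<Longrightarrow> i t < L"
  shows "(\<Prod>t\<in>I. f (i t)) = (\<Prod>j<L. f j ^ hits I i j)"
proof -
  have "(\<Prod>t\<in>I. f (i t)) = (\<Prod>j\<in>{..<L}. \<Prod>t\<in>{t \<in> I. i t = j}. f (i t))"
    by (rule prod.group[symmetric]) (use assms in auto)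
  also have "\<dots> = (\<Prod>j<L. f j ^ hits I i j)"
    by (intro prod.cong refl) (simp add: hits_def)
  finally show ?thesis .
qed

text \<open>The mean of \<open>(1 + z) ^ n\<close> over a fair sign \<open>z\<close>, which is the
  second-moment factor of a fully tilted pair hit \<open>n\<close> times. With
  \<open>0 ^ 0 = 1\<close> it equals 1 for at most one hit.\<close>

definition coll_factor :: "nat \<Rightarrow> real" where
  "coll_factor n = (0 ^ n + 2 ^ n) / 2"

lemma coll_factor_simps [simp]: "coll_factor 0 = 1" "coll_factor (Suc 0) = 1"
  by (simp_all add: coll_factor_def)

lemma coll_factor_ge_1: "1 \<le> coll_factor n"
proof (cases n)
  case (Suc m)
  have "(1::real) \<le> 2 ^ m" by simp
  then show ?thesis by (simp add: Suc coll_factor_def)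
qed simp

text \<open>Signs of distinct pairs are independent, so the average factorises over pairs; untilted
  pairs and pairs hit at most once contribute 1.\<close>

lemma corr_indicator:
  assumes "finite I" "\<And>t. t \<in> I \<Longrightarrow> i t < L"
  shows "corr L I (\<lambda>j. if j \<in> T then 0 else 1) i = (\<Prod>j\<in>{j. j < L \<and> 2 \<le> hits I i j} - T. coll_factor (hits I i j))"
proof -
  let ?v = "\<lambda>j. if j \<in> T then 0 else 1 :: real"
  have "corr L I ?v i = (\<Sum>\<zeta>\<in>signs L. \<Prod>j<L. (1 + ?v j * \<zeta> j) ^ hits I i j) / 2 ^ L"
    unfolding corr_def by (intro arg_cong2[of _ _ _ _ "(/)"] sum.cong refl prod_by_hits assms)
  also have "(\<Sum>\<zeta>\<in>signs L. \<Prod>j<L. (1 + ?v j * \<zeta> j) ^ hits I i j) =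
      (\<Prod>j<L. (1 + ?v j * (-1)) ^ hits I i j + (1 + ?v j * 1) ^ hits I i j)"
    by (rule sum_signs_prod[where h = "\<lambda>j x. (1 + ?v j * x) ^ hits I i j"])
  also have "\<dots> / 2 ^ L = (\<Prod>j<L. ((1 + ?v j * (-1)) ^ hits I i j + (1 + ?v j * 1) ^ hits I i j) / 2)"
    by (simp add: prod_dividef)
  also have "\<dots> = (\<Prod>j<L. if j \<in> T then 1 else coll_factor (hits I i j))"
    by (intro prod.cong refl) (simp add: coll_factor_def)
  also have "\<dots> = (\<Prod>j\<in>{j. j < L \<and> 2 \<le> hits I i j} - T. coll_factor (hits I i j))"
  proof (rule prod.mono_neutral_cong_right)
    show "\<forall>j\<in>{..<L} - ({j. j < L \<and> 2 \<le> hits I i j} - T).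
        (if j \<in> T then 1 else coll_factor (hits I i j)) = 1"
    proof
      fix j assume j: "j \<in> {..<L} - ({j. j < L \<and> 2 \<le> hits I i j} - T)"
      then have "j \<in> T \<or> hits I i j = 0 \<or> hits I i j = Suc 0" by auto
      then show "(if j \<in> T then 1 else coll_factor (hits I i j)) = 1"
        using coll_factor_simps by metis
    qed
  qed auto
  finally show ?thesis .
qed

text \<open>Expands a product over pairs outside \<open>S \<union> S'\<close> into sets
  \<open>C\<close> disjoint from both, where the sums over \<open>S\<close> and \<open>S'\<close>
  decouple; read backwards it resums the bounds.\<close>

lemma prod_as_subset_sum:
  fixes f :: "'a \<Rightarrow> real"
  assumes "finite K"
  shows "(\<Prod>j\<in>K. f j) = (\<Sum>C\<in>Pow K. \<Prod>j\<in>C. f j - 1)"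
  using prod_add[OF assms, of "\<lambda>j. f j - 1" "\<lambda>_. 1"] by simp

text \<open>
  \<open>S\<close> is a uniformly random set of \<open>k\<close> heavy pairs (mass \<open>a\<close> each, unperturbed), the other pairs
  are light (mass \<open>b\<close>, fully perturbed).  Given the pair indices \<open>i\<close> of all samples, a pair hit
  \<open>h\<close> times is light with posterior probability at most \<open>\<tau> h\<close>, because there are at least twice
  as many heavy pairs as samples.  Hence collisions, the only informative events, come almost
  always from heavy pairs.
\<close>
locale heavy_light =
  fixes L k :: nat and a b :: real and I :: "'b set" and i :: "'b \<Rightarrow> nat"
  assumes I: "finite I" and iL: "\<And>t. t \<in> I \<Longrightarrow> i t < L"
    and k: "2 * card I \<le> k" "0 < k"
    and ab: "0 < a" "0 < b" "2 * b\<^sup>2 \<le> a\<^sup>2"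
begin

definition weight :: "nat set \<Rightarrow> real" where
  "weight S = (\<Prod>t\<in>I. if i t \<in> S then a else b)"

definition heavies :: "nat set set" where
  "heavies = {S. S \<subseteq> {..<L} \<and> card S = k}"

text \<open>An unnormalised posterior: \<open>avoid C / avoid {}\<close> is the probability, given
  the indices \<open>i\<close>, that all pairs in \<open>C\<close> are light.\<close>

definition avoid :: "nat set \<Rightarrow> real" where
  "avoid C = (\<Sum>S\<in>{S \<in> heavies. S \<inter> C = {}}. weight S)"

text \<open>\<open>(a / b) ^ h\<close> is the likelihood gained by declaring a pair with
  \<open>h\<close> hits heavy; \<open>2 * L / k\<close> is the counting loss of the exchange in
  \<open>avoid_insert\<close>.\<close>

definition \<tau> :: "nat \<Rightarrow> real" where
  "\<tau> h = 2 * L / (k * (a / b) ^ h)"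

lemma weight_pos: "weight S > 0"
  unfolding weight_def using ab by (intro prod_pos) auto

lemma finite_heavies: "finite heavies"
  unfolding heavies_def by simp

lemma avoid_nonneg: "avoid C \<ge> 0"
  unfolding avoid_def using weight_pos by (intro sum_nonneg) (auto intro: less_imp_le)

lemma weight_swap:
  assumes "j0 \<notin> S" "j \<in> S" "hits I i j = 0"
  shows "weight (insert j0 (S - {j})) = (a / b) ^ hits I i j0 * weight S"
proof -
  have "i t \<noteq> j" if "t \<in> I" for t
    using assms(3) that I unfolding hits_def by auto
  then have "weight (insert j0 (S - {j})) =
      (\<Prod>t\<in>I. (if i t = j0 then a / b else 1) * (if i t \<in> S then a else b))"
    unfolding weight_def using assms ab by (intro prod.cong refl) auto
  also have "\<dots> = (\<Prod>t\<in>I. if i t = j0 then a / b else 1) * weight S"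
    unfolding weight_def by (rule prod.distrib)
  also have "(\<Prod>t\<in>I. if i t = j0 then a / b else 1) = (a / b) ^ hits I i j0"
  proof -
    have "(\<Prod>t\<in>I. if i t = j0 then a / b else 1) = (\<Prod>t\<in>{t \<in> I. i t = j0}. a / b)"
      using I by (intro prod.mono_neutral_cong_right) auto
    then show ?thesis by (simp add: hits_def)
  qed
  finally show ?thesis .
qed

text \<open>At most \<open>card I \<le> k / 2\<close> pairs are hit at all.\<close>

lemma many_unhit:
  assumes "S \<in> heavies"
  shows "k \<le> 2 * card {j \<in> S. hits I i j = 0}"
proof -
  have S: "finite S" "card S = k"
    using assms by (auto simp: heavies_def intro: finite_subset)
  have "S - i ` I \<subseteq> {j \<in> S. hits I i j = 0}"
    by (auto simp: hits_def card_eq_0_iff)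
  then have "card (S - i ` I) \<le> card {j \<in> S. hits I i j = 0}"
    using S by (intro card_mono) auto
  moreover have "card S - card (i ` I) \<le> card (S - i ` I)"
    using I by (intro diff_card_le_card_Diff) auto
  moreover have "card (i ` I) \<le> card I" using I by (rule card_image_le)
  ultimately show ?thesis using S k by linarith
qed

text \<open>Replace an unhit heavy pair by the pair \<open>j0\<close>: at least \<open>k / 2\<close> choices, and every
  set is reached at most \<open>L\<close> times.\<close>
lemma avoid_insert:
  assumes j0: "j0 < L" "j0 \<notin> C"
  shows "avoid (insert j0 C) \<le> \<tau> (hits I i j0) * avoid C"
proof -
  define R where "R = (a / b) ^ hits I i j0"
  have R: "R > 0" using ab by (simp add: R_def)
  let ?A = "{S \<in> heavies. S \<inter> insert j0 C = {}}"
  let ?B = "{S \<in> heavies. S \<inter> C = {}}"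
  define P where "P = Sigma ?A (\<lambda>S. {j \<in> S. hits I i j = 0})"
  define f where "f = (\<lambda>(S, j). (insert j0 (S - {j}), j :: nat))"
  have sub: "S \<subseteq> {..<L}" "card S = k" "finite S" if "S \<in> heavies" for S
    using that by (auto simp: heavies_def intro: finite_subset)
  have finA: "finite ?A" "finite ?B" using finite_heavies by auto
  have finP: "finite P"
    unfolding P_def using finA sub by (intro finite_SigmaI) auto
  \<comment> \<open>The removed pair \<open>j\<close> is recorded, so \<open>S\<close> is recovered
    by dropping \<open>j0\<close> and putting \<open>j\<close> back.\<close>
  have inj: "inj_on f P"
  proof (rule inj_onI)
    fix x y assume xy: "x \<in> P" "y \<in> P" "f x = f y"
    obtain S j S' j' where *: "x = (S, j)" "y = (S', j')" by (cases x, cases y)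
    have j: "j = j'" and eq: "insert j0 (S - {j}) = insert j0 (S' - {j})"
      using xy(3) by (auto simp: f_def *)
    have "S = insert j (insert j0 (S - {j}) - {j0})"
      using xy(1) by (auto simp: P_def *)
    also have "\<dots> = insert j (insert j0 (S' - {j}) - {j0})" by (simp only: eq)
    also have "\<dots> = S'"
      using xy(2) by (auto simp: P_def * j)
    finally show "x = y" by (simp add: * j)
  qed
  have img: "f ` P \<subseteq> ?B \<times> {..<L}"
  proof
    fix x assume "x \<in> f ` P"
    then obtain S j T where x: "x = (T, j)" and S: "S \<in> heavies" "S \<inter> insert j0 C = {}" "j \<in> S"
        "T = insert j0 (S - {j})"
      by (auto simp: f_def P_def)
    have "card T = k"
      using S sub[OF S(1)] by (simp add: card_Diff_singleton) (metis Suc_pred card_gt_0_iff empty_iff)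
    then have "T \<in> ?B"
      using S sub[OF S(1)] j0 by (auto simp: heavies_def)
    then show "x \<in> ?B \<times> {..<L}" using S sub[OF S(1)] by (auto simp: x)
  qed
  have "avoid (insert j0 C) * (k / 2) * R = (\<Sum>S\<in>?A. (k / 2) * (R * weight S))"
    by (simp add: avoid_def sum_distrib_left sum_distrib_right mult_ac)
  also have "\<dots> \<le> (\<Sum>S\<in>?A. card {j \<in> S. hits I i j = 0} * (R * weight S))"
  proof (intro sum_mono mult_right_mono)
    fix S assume "S \<in> ?A"
    then have "k \<le> 2 * card {j \<in> S. hits I i j = 0}" by (auto intro: many_unhit)
    then have "real k \<le> real (2 * card {j \<in> S. hits I i j = 0})" by (simp only: of_nat_le_iff)
    then show "k / 2 \<le> card {j \<in> S. hits I i j = 0}" by simp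
    show "0 \<le> R * weight S" using R weight_pos[of S] by simp
  qed
  also have "\<dots> = (\<Sum>S\<in>?A. \<Sum>j\<in>{j \<in> S. hits I i j = 0}. weight (fst (f (S, j))))"
  proof (intro sum.cong refl)
    fix S assume S: "S \<in> ?A"
    have "weight (fst (f (S, j))) = R * weight S" if "j \<in> {j \<in> S. hits I i j = 0}" for j
      using weight_swap[of j0 S j] S that by (simp add: f_def R_def)
    then show "card {j \<in> S. hits I i j = 0} * (R * weight S) =
        (\<Sum>j\<in>{j \<in> S. hits I i j = 0}. weight (fst (f (S, j))))"
      by simp
  qed
  also have "\<dots> = (\<Sum>x\<in>P. weight (fst (f x)))"
    unfolding P_def using finA sub by (subst sum.Sigma) (auto simp: case_prod_unfold)
  also have "\<dots> = (\<Sum>y\<in>f ` P. weight (fst y))"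
    by (simp add: sum.reindex[OF inj])
  also have "\<dots> \<le> (\<Sum>y\<in>?B \<times> {..<L}. weight (fst y))"
    using img finA weight_pos by (intro sum_mono2) (auto intro: less_imp_le)
  also have "\<dots> = (\<Sum>T\<in>?B. \<Sum>j<L. weight T)"
    by (simp only: sum.cartesian_product case_prod_unfold)
  also have "\<dots> = L * avoid C"
    by (simp add: avoid_def sum_distrib_left)
  finally have "avoid (insert j0 C) * (k / 2) * R \<le> L * avoid C" .
  then show ?thesis
    using R k unfolding \<tau>_def R_def[symmetric] by (simp add: field_simps)
qed

lemma \<tau>_nonneg: "\<tau> h \<ge> 0"
  using ab by (simp add: \<tau>_def)

lemma avoid_le:
  assumes "finite C" "C \<subseteq> {..<L}"
  shows "avoid C \<le> (\<Prod>j\<in>C. \<tau> (hits I i j)) * avoid {}"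
  using assms
proof (induction C rule: finite_induct)
  case (insert j C)
  have "avoid (insert j C) \<le> \<tau> (hits I i j) * avoid C"
    using insert by (intro avoid_insert) auto
  also have "\<dots> \<le> \<tau> (hits I i j) * ((\<Prod>j\<in>C. \<tau> (hits I i j)) * avoid {})"
    using insert \<tau>_nonneg by (intro mult_left_mono) auto
  finally show ?case using insert by simp
qed simp

text \<open>
  A set \<open>C\<close> of collided pairs that is light in both posterior copies contributes
  \<open>\<Prod>j\<in>C. (coll_factor h - 1) * (\<tau> h)\<^sup>2\<close>, so this bounds the contribution of one pair,
  uniformly in the observed indices.
\<close>
definition excess :: real where
  "excess = 16 * L\<^sup>2 / (k\<^sup>2 * (a / b) ^ 4)"

lemma excess_nonneg: "excess \<ge> 0"
  using ab by (simp add: excess_def)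

text \<open>A collision gains at most \<open>2 ^ h\<close>, while two posterior factors lose
  \<open>(a / b) ^ (2 * h)\<close>. As \<open>2 * b\<^sup>2 \<le> a\<^sup>2\<close>, the quotient
  decreases in \<open>h\<close>, so two hits are the worst case.\<close>

lemma coll_factor_\<tau>:
  assumes "2 \<le> h"
  shows "(coll_factor h - 1) * (\<tau> h)\<^sup>2 \<le> excess"
proof -
  have R: "0 < a / b" "2 / (a / b)\<^sup>2 \<le> 1"
    using ab by (simp_all add: power_divide field_simps)
  have "coll_factor h = 2 ^ h / 2" "(0::real) \<le> 2 ^ h"
    using assms by (simp_all add: coll_factor_def power_0_left)
  then have "coll_factor h - 1 \<le> 2 ^ h" by linarith
  then have "(coll_factor h - 1) * (\<tau> h)\<^sup>2 \<le> 2 ^ h * (\<tau> h)\<^sup>2"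
    by (intro mult_right_mono) auto
  also have "\<dots> = 4 * L\<^sup>2 / k\<^sup>2 * (2 / (a / b)\<^sup>2) ^ h"
    using R by (simp add: \<tau>_def power_divide power_mult_distrib power_mult[symmetric] mult.commute
        flip: divide_divide_eq_left)
  also have "\<dots> \<le> 4 * L\<^sup>2 / k\<^sup>2 * (2 / (a / b)\<^sup>2) ^ 2"
    using R assms by (intro mult_left_mono power_decreasing) auto
  also have "\<dots> = excess"
    by (simp add: excess_def power_divide power_mult[symmetric])
  finally show ?thesis .
qed

text \<open>A collided pair matters only if it is light in both copies \<open>S\<close> and
  \<open>S'\<close>. Expanding over sets \<open>C\<close> of such pairs decouples the copies into
  the square of \<open>avoid C\<close>; after \<open>avoid_le\<close> the sum closes up to a product
  with a factor at most \<open>exp excess\<close> for each collided pair, of which there are at most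
  \<open>card I\<close>.\<close>

lemma correlated_weights:
  "(\<Sum>S\<in>heavies. \<Sum>S'\<in>heavies. weight S * weight S' *
      corr L I (\<lambda>j. if j \<in> S \<union> S' then 0 else 1) i)
    \<le> (\<Sum>S\<in>heavies. weight S)\<^sup>2 * exp (card I * excess)"
proof -
  define K where "K = {j. j < L \<and> 2 \<le> hits I i j}"
  define \<phi> where "\<phi> j = coll_factor (hits I i j) - 1" for j
  have \<phi>: "\<phi> j \<ge> 0" for j by (simp add: \<phi>_def coll_factor_ge_1)
  have K: "finite K" by (simp add: K_def)
  have corr: "corr L I (\<lambda>j. if j \<in> S \<union> S' then 0 else 1) i =
      (\<Sum>C\<in>Pow K. (\<Prod>j\<in>C. \<phi> j) * of_bool (S \<inter> C = {}) * of_bool (S' \<inter> C = {}))" for S S'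
  proof -
    have "corr L I (\<lambda>j. if j \<in> S \<union> S' then 0 else 1) i =
        (\<Prod>j\<in>K - (S \<union> S'). coll_factor (hits I i j))"
      unfolding K_def by (rule corr_indicator[OF I iL])
    also have "\<dots> = (\<Sum>C\<in>Pow (K - (S \<union> S')). \<Prod>j\<in>C. \<phi> j)"
      unfolding \<phi>_def using K by (intro prod_as_subset_sum) auto
    also have "\<dots> = (\<Sum>C\<in>Pow K. (\<Prod>j\<in>C. \<phi> j) * of_bool (S \<inter> C = {}) * of_bool (S' \<inter> C = {}))"
      using K by (intro sum.mono_neutral_cong_left) auto
    finally show ?thesis .
  qed
  have av: "avoid C = (\<Sum>S\<in>heavies. weight S * of_bool (S \<inter> C = {}))" for C
    unfolding avoid_def using finite_heavies by (intro sum.mono_neutral_cong_left) auto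
  have "(\<Sum>S\<in>heavies. \<Sum>S'\<in>heavies. weight S * weight S' *
      corr L I (\<lambda>j. if j \<in> S \<union> S' then 0 else 1) i) =
    (\<Sum>S\<in>heavies. \<Sum>S'\<in>heavies. \<Sum>C\<in>Pow K. (\<Prod>j\<in>C. \<phi> j) *
      ((weight S * of_bool (S \<inter> C = {})) * (weight S' * of_bool (S' \<inter> C = {}))))"
    unfolding corr sum_distrib_left by (simp add: mult_ac)
  also have "\<dots> = (\<Sum>S\<in>heavies. \<Sum>C\<in>Pow K. \<Sum>S'\<in>heavies. (\<Prod>j\<in>C. \<phi> j) *
      ((weight S * of_bool (S \<inter> C = {})) * (weight S' * of_bool (S' \<inter> C = {}))))"
    by (intro sum.cong refl sum.swap)
  also have "\<dots> = (\<Sum>C\<in>Pow K. \<Sum>S\<in>heavies. \<Sum>S'\<in>heavies. (\<Prod>j\<in>C. \<phi> j) *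
      ((weight S * of_bool (S \<inter> C = {})) * (weight S' * of_bool (S' \<inter> C = {}))))"
    by (rule sum.swap)
  also have "\<dots> = (\<Sum>C\<in>Pow K. (\<Prod>j\<in>C. \<phi> j) * (avoid C)\<^sup>2)"
    by (simp only: av power2_eq_square sum_product) (simp only: sum_distrib_left)
  also have "\<dots> \<le> (\<Sum>C\<in>Pow K. (\<Prod>j\<in>C. \<phi> j) * ((\<Prod>j\<in>C. \<tau> (hits I i j)) * avoid {})\<^sup>2)"
  proof (intro sum_mono mult_left_mono power_mono avoid_le avoid_nonneg)
    fix C assume "C \<in> Pow K"
    then show "finite C" "C \<subseteq> {..<L}" using K by (auto simp: K_def intro: finite_subset)
    show "0 \<le> (\<Prod>j\<in>C. \<phi> j)" using \<phi> by (intro prod_nonneg) auto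
  qed
  also have "\<dots> = (avoid {})\<^sup>2 * (\<Sum>C\<in>Pow K. \<Prod>j\<in>C. \<phi> j * (\<tau> (hits I i j))\<^sup>2)"
    by (simp add: power_mult_distrib prod.distrib prod_power_distrib sum_distrib_left mult_ac)
  also have "(\<Sum>C\<in>Pow K. \<Prod>j\<in>C. \<phi> j * (\<tau> (hits I i j))\<^sup>2) = (\<Prod>j\<in>K. 1 + \<phi> j * (\<tau> (hits I i j))\<^sup>2)"
    using prod_as_subset_sum[OF K, of "\<lambda>j. 1 + \<phi> j * (\<tau> (hits I i j))\<^sup>2"] by simp
  also have "\<dots> \<le> (\<Prod>j\<in>K. exp excess)"
  proof (rule prod_mono)
    fix j assume "j \<in> K"
    then have "\<phi> j * (\<tau> (hits I i j))\<^sup>2 \<le> excess"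
      unfolding \<phi>_def by (intro coll_factor_\<tau>) (simp add: K_def)
    then have "1 + \<phi> j * (\<tau> (hits I i j))\<^sup>2 \<le> exp excess"
      using exp_ge_add_one_self[of excess] by linarith
    then show "0 \<le> 1 + \<phi> j * (\<tau> (hits I i j))\<^sup>2 \<and> 1 + \<phi> j * (\<tau> (hits I i j))\<^sup>2 \<le> exp excess"
      using \<phi>[of j] by simp
  qed
  also have "\<dots> = exp (card K * excess)"
    by (simp add: exp_of_nat_mult)
  also have "\<dots> \<le> exp (card I * excess)"
  proof -
    have "K \<subseteq> i ` I"
    proof
      fix j assume "j \<in> K"
      then have "card {t \<in> I. i t = j} \<noteq> 0" by (simp add: K_def hits_def)
      then have "{t \<in> I. i t = j} \<noteq> {}" by (metis card.empty)
      then show "j \<in> i ` I" by auto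
    qed
    then have "card K \<le> card I"
      using I by (meson card_image_le card_mono finite_imageI le_trans)
    then show ?thesis using excess_nonneg by (simp add: mult_right_mono)
  qed
  finally show ?thesis
    by (simp add: mult_left_mono avoid_def)
qed

end

lemma sum_if_mem:
  fixes a b :: real and S :: "nat set"
  assumes "S \<subseteq> {..<L}" "card S = k"
  shows "(\<Sum>j<L. if j \<in> S then a else b) = k * a + real (L - k) * b"
proof -
  have S: "finite S" using assms(1) by (rule finite_subset) simp
  have "(\<Sum>j<L. if j \<in> S then a else b) = (\<Sum>j\<in>{..<L} \<inter> {j. j \<in> S}. a) + (\<Sum>j\<in>{..<L} \<inter> - {j. j \<in> S}. b)"
    by (rule sum.If_cases) simp
  also have "{..<L} \<inter> {j. j \<in> S} = S" using assms by auto
  also have "{..<L} \<inter> - {j. j \<in> S} = {..<L} - S" by auto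
  finally show ?thesis
    using assms S by (simp add: card_Diff_subset)
qed

text \<open>The \<open>2 * card I\<close> heavy pairs share mass \<open>1 - \<epsilon> / 2\<close>,
  the light ones the rest; tilting all light mass fully gives distance \<open>\<epsilon>\<close>.
  Then \<open>a / b \<ge> L / (4 * k * e)\<close> bounds \<open>excess\<close> by
  \<open>256 * k\<^sup>2 * \<epsilon> ^ 4 / L\<^sup>2\<close>, and a tester forces
  \<open>card I\<close> times this to be at least \<open>1/10\<close>.\<close>

lemma collision_lower_bound:
  fixes \<epsilon> :: real
  assumes A: "noisy_closeness_tester n \<epsilon> A" and rep: "tape_rep {1..2 * L} I (acc_prob A)"
    and I: "finite I" and L: "2 * L \<le> n" and \<epsilon>: "0 < \<epsilon>" "\<epsilon> \<le> 1"
    and M: "0 < card I" "8 * card I \<le> L"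
  shows "L\<^sup>2 \<le> 10240 * card I ^ 3 * \<epsilon> ^ 4"
proof -
  define k where "k = 2 * card I"
  define e where "e = \<epsilon> / 2"
  define a where "a = (1 - e) / k"
  define b where "b = e / (L - k)"
  have e: "0 < e" "e \<le> 1/2" using \<epsilon> by (simp_all add: e_def)
  have k: "0 < k" "4 * k \<le> L" using M by (simp_all add: k_def)
  have kL: "real (L - k) = real L - real k" using k by simp
  have kr: "0 < real k" "4 * real k \<le> real L" using k by linarith+
  have ab: "0 < a" "0 < b" using e k by (simp_all add: a_def b_def)
  have "L / (4 * (k * e)) = (1/2) * (L / 2) / (k * e)" by simp
  also have "\<dots> \<le> (1 - e) * (L - k) / (k * e)"
    using e kr kL by (intro divide_right_mono mult_mono) auto
  also have "\<dots> = a / b" using e k by (simp add: a_def b_def field_simps)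
  finally have R: "L / (4 * (k * e)) \<le> a / b" .
  have "2 \<le> L / (4 * (k * e))"
  proof -
    have "k * e \<le> k * (1/2)"
      using e kr by (intro mult_left_mono) auto
    then have "8 * (k * e) \<le> L" using kr by linarith
    then show ?thesis using e kr by (simp add: le_divide_eq)
  qed
  then have "2 \<le> a / b" using R by linarith
  then have "2 * b \<le> a" using ab by (simp add: le_divide_eq)
  then have "(2 * b)\<^sup>2 \<le> a\<^sup>2" using ab by (intro power_mono) auto
  then have "4 * b\<^sup>2 \<le> a\<^sup>2" by (simp add: power_mult_distrib)
  then have ab2: "2 * b\<^sup>2 \<le> a\<^sup>2"
    using zero_le_power2[of b] by linarith
  define \<Theta> where "\<Theta> = {S. S \<subseteq> {..<L} \<and> card S = k}"
  define \<beta> where "\<beta> S j = (if j \<in> S then a else b)" for S and j :: nat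
  define u where "u S j = (if j \<in> S then 0 else 1 :: real)" for S and j :: nat
  have \<Theta>: "finite \<Theta>" "\<Theta> \<noteq> {}"
  proof -
    show "finite \<Theta>" by (simp add: \<Theta>_def)
    have "{..<k} \<in> \<Theta>" using k by (auto simp: \<Theta>_def)
    then show "\<Theta> \<noteq> {}" by blast
  qed
  have \<beta>_sum: "(\<Sum>j<L. \<beta> S j) = 1" if "S \<in> \<Theta>" for S
    using that k unfolding \<beta>_def \<Theta>_def
    by (subst sum_if_mem[where k = k]) (auto simp: a_def b_def)
  define Wt where "Wt i = (\<Sum>S\<in>\<Theta>. \<Prod>t\<in>I. \<beta> S (i t))" for i
  define x where "x = heavy_light.excess L k a b"
  have "10/9 \<le> (\<Sum>x\<in>PiE I (\<lambda>_. {1..2 * L}). (tape_alt L \<Theta> \<beta> u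
      (\<lambda>t. source_sign (snd t)) I x)\<^sup>2 / tape_null \<Theta> \<beta> I x)"
  proof (rule tester_second_moment[OF A rep I L \<Theta>])
    show "0 < \<beta> S i" for S i using ab by (simp add: \<beta>_def)
    show "(\<Sum>j<L. \<beta> S j) = 1" if "S \<in> \<Theta>" for S by (rule \<beta>_sum[OF that])
    show "0 \<le> u S i \<and> u S i \<le> 1" for S i by (simp add: u_def)
    fix S assume S: "S \<in> \<Theta>"
    have "(\<Sum>j<L. 2 * \<beta> S j * u S j) = (\<Sum>j<L. if j \<in> S then 0 else 2 * b)"
      by (intro sum.cong) (auto simp: \<beta>_def u_def)
    also have "\<dots> = 2 * e"
      using S k unfolding \<Theta>_def by (subst sum_if_mem[where k = k]) (auto simp: b_def)
    finally show "\<epsilon> \<le> (\<Sum>j<L. 2 * \<beta> S j * u S j)" by (simp add: e_def)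
  qed
  also have "\<dots> = (\<Sum>i\<in>PiE I (\<lambda>_. {..<L}). (\<Sum>S\<in>\<Theta>. \<Sum>S'\<in>\<Theta>. (\<Prod>t\<in>I. \<beta> S (i t)) *
      (\<Prod>t\<in>I. \<beta> S' (i t)) * corr L I (\<lambda>j. u S j * u S' j) i) / (card \<Theta> * Wt i))"
    unfolding Wt_def by (rule tape_second_moment[OF I _ \<Theta>]) (simp add: source_sign_def)
  also have "\<dots> \<le> (\<Sum>i\<in>PiE I (\<lambda>_. {..<L}). Wt i * (exp (card I * x) / card \<Theta>))"
  proof (rule sum_mono)
    fix i assume i: "i \<in> PiE I (\<lambda>_. {..<L})"
    interpret heavy_light L k a b I i
      by unfold_locales (use I i k ab ab2 in \<open>auto simp: k_def\<close>)
    have heavies: "heavies = \<Theta>" by (simp add: heavies_def \<Theta>_def)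
    have weight: "weight S = (\<Prod>t\<in>I. \<beta> S (i t))" for S by (simp add: weight_def \<beta>_def)
    have Wt: "Wt i = (\<Sum>S\<in>heavies. weight S)" by (simp add: Wt_def heavies weight)
    have Wt0: "Wt i > 0"
      unfolding Wt heavies using \<Theta> weight_pos by (intro sum_pos) auto
    have uu: "(\<lambda>j. u S j * u S' j) = (\<lambda>j. if j \<in> S \<union> S' then 0 else 1)" for S S'
      by (auto simp: u_def)
    have "(\<Sum>S\<in>\<Theta>. \<Sum>S'\<in>\<Theta>. (\<Prod>t\<in>I. \<beta> S (i t)) * (\<Prod>t\<in>I. \<beta> S' (i t)) *
        corr L I (\<lambda>j. u S j * u S' j) i) \<le> (Wt i)\<^sup>2 * exp (card I * x)"
      using correlated_weights unfolding Wt x_def heavies weight uu .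
    then have "(\<Sum>S\<in>\<Theta>. \<Sum>S'\<in>\<Theta>. (\<Prod>t\<in>I. \<beta> S (i t)) * (\<Prod>t\<in>I. \<beta> S' (i t)) *
        corr L I (\<lambda>j. u S j * u S' j) i) / (card \<Theta> * Wt i) \<le>
        (Wt i)\<^sup>2 * exp (card I * x) / (card \<Theta> * Wt i)"
      using Wt0 by (intro divide_right_mono) auto
    also have "\<dots> = Wt i * (exp (card I * x) / card \<Theta>)"
      using Wt0 by (simp add: power2_eq_square)
    finally show "(\<Sum>S\<in>\<Theta>. \<Sum>S'\<in>\<Theta>. (\<Prod>t\<in>I. \<beta> S (i t)) * (\<Prod>t\<in>I. \<beta> S' (i t)) *
        corr L I (\<lambda>j. u S j * u S' j) i) / (card \<Theta> * Wt i) \<le> Wt i * (exp (card I * x) / card \<Theta>)" .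
  qed
  also have "\<dots> = (\<Sum>i\<in>PiE I (\<lambda>_. {..<L}). Wt i) * (exp (card I * x) / card \<Theta>)"
    by (rule sum_distrib_right[symmetric])
  \<comment> \<open>For each \<open>S\<close> the weights are the probabilities of the index vectors
    and sum to 1.\<close>
  also have "(\<Sum>i\<in>PiE I (\<lambda>_. {..<L}). Wt i) = card \<Theta>"
  proof -
    have "(\<Sum>i\<in>PiE I (\<lambda>_. {..<L}). Wt i) = (\<Sum>S\<in>\<Theta>. \<Sum>i\<in>PiE I (\<lambda>_. {..<L}). \<Prod>t\<in>I. \<beta> S (i t))"
      unfolding Wt_def by (rule sum.swap)
    also have "\<dots> = (\<Sum>S\<in>\<Theta>. \<Prod>t\<in>I. \<Sum>j<L. \<beta> S j)"
      using I by (intro sum.cong refl prod_sum_PiE[symmetric]) auto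
    also have "\<dots> = card \<Theta>" by (simp add: \<beta>_sum)
    finally show ?thesis .
  qed
  finally have "10/9 \<le> exp (card I * x)"
    using \<Theta> by simp
  then have "ln (10/9) \<le> card I * x"
    by (subst exp_le_cancel_iff[symmetric]) simp
  then have "1/10 \<le> card I * x" using ln_10_9 by linarith
  also have "x \<le> 16 * L\<^sup>2 / (k\<^sup>2 * (L / (4 * (k * e))) ^ 4)"
  proof -
    \<comment> \<open>\<open>excess\<close> depends on neither \<open>I\<close> nor
      \<open>i\<close>, so an instance with an empty sample set suffices to unfold it.\<close>
    have hl: "heavy_light L k a b {} (\<lambda>_. 0)"
      by unfold_locales (use k ab ab2 in auto)
    have "x = 16 * L\<^sup>2 / (k\<^sup>2 * (a / b) ^ 4)"
      unfolding x_def by (rule heavy_light.excess_def[OF hl])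
    also have "\<dots> \<le> 16 * L\<^sup>2 / (k\<^sup>2 * (L / (4 * (k * e))) ^ 4)"
      using R ab e kr by (intro divide_left_mono mult_left_mono power_mono mult_pos_pos) auto
    finally show ?thesis .
  qed
  also have "16 * L\<^sup>2 / (k\<^sup>2 * (L / (4 * (k * e))) ^ 4) = 256 * k\<^sup>2 * \<epsilon> ^ 4 / L\<^sup>2"
    using e kr by (simp add: e_def field_simps eval_nat_numeral)
  also have "card I * (256 * k\<^sup>2 * \<epsilon> ^ 4 / L\<^sup>2) = 1024 * card I ^ 3 * \<epsilon> ^ 4 / L\<^sup>2"
    by (simp add: k_def power2_eq_square power3_eq_cube)
  finally have "1/10 \<le> 1024 * card I ^ 3 * \<epsilon> ^ 4 / L\<^sup>2"
    by (simp add: mult_left_mono)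
  then show ?thesis
    using kr by (simp add: field_simps)
qed

text \<open>The tape has \<open>M = 3 * N\<close> entries with \<open>N \<le> m\<close>. The two
  bounds give \<open>s \<le> 2 * M\<close> and \<open>y \<le> 46 * M\<close>, so the rate is at most
  \<open>48 * M \<le> 144 * m\<close>; 300 leaves slack.\<close>

lemma tester_lower_bound:
  fixes \<epsilon> m :: real
  assumes n: "n \<ge> 2" and \<epsilon>: "0 < \<epsilon>" "\<epsilon> \<le> 1"
    and A: "noisy_closeness_tester n \<epsilon> A" and uses: "uses_at_most n A m"
  shows "sample_rate n \<epsilon> / 300 \<le> m"
proof -
  \<comment> \<open>For odd \<open>n\<close> the last element gets no mass; \<open>n \<ge> 2\<close>
    still gives \<open>n \<le> 3 * L\<close>.\<close>
  define L where "L = n div 2"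
  define N where "N = nat \<lfloor>m\<rfloor>"
  define I where "I = {..<N} \<times> (UNIV :: source set)"
  define M where "M = card I"
  have L: "2 * L \<le> n" "0 < L" "n \<le> 3 * L" using n by (auto simp: L_def)
  have Lr: "real n \<le> 3 * real L" "0 < real n" using L n by linarith+
  have U: "pmf_of_set {1..2 * L} \<in> dists_on n"
    using L by (auto simp: dists_on_def)
  have src: "source_dist q q q = (\<lambda>_. q)" for q
    by (rule ext, rule source_dist.elims[OF refl]) auto
  have bound: "c \<le> m" if "(v, c) \<in> set_pmf (run (\<lambda>_. pmf_of_set {1..2 * L}) A)" for v c
    using uses U that unfolding uses_at_most_def src[symmetric] by blast
  obtain v c where "(v, c) \<in> set_pmf (run (\<lambda>_. pmf_of_set {1..2 * L}) A)"
    by (metis all_not_in_conv set_pmf_not_empty surj_pair)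
  from bound[OF this] have m0: "0 \<le> m" by linarith
  have rep: "tape_rep {1..2 * L} I (acc_prob A)"
    unfolding I_def
  proof (rule tape_rep_acc_prob)
    fix v c assume "(v, c) \<in> set_pmf (run (\<lambda>_. pmf_of_set {1..2 * L}) A)"
    then have "real c \<le> m" by (rule bound)
    then show "c \<le> N" by (simp add: N_def le_nat_floor)
  qed (use L in auto)
  have I: "finite I" by (simp add: I_def)
  have "card (UNIV :: source set) = 3"
    by (simp add: UNIV_source)
  then have "M = 3 * N" by (simp add: M_def I_def card_cartesian_product)
  moreover have "real N \<le> m" using m0 by (simp add: N_def)
  ultimately have M: "real M \<le> 3 * m" by simp
  define s where "s = sqrt (real n) / \<epsilon>\<^sup>2"
  define y where "y = real n powr (2/3) / \<epsilon> powr (4/3)"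
  have s0: "0 < s" using Lr \<epsilon> by (simp add: s_def)
  have y0: "0 < y" using Lr \<epsilon> by (simp add: y_def)
  have s2: "s\<^sup>2 = n / \<epsilon> ^ 4"
    by (simp add: s_def power_divide power_mult[symmetric])
  have y3: "y ^ 3 = n\<^sup>2 / \<epsilon> ^ 4"
    using Lr \<epsilon> by (simp add: y_def power_divide powr_power)
  have unif: "8 * L \<le> 5 * M\<^sup>2 * \<epsilon> ^ 4"
    using uniform_lower_bound[OF A rep I L(1,2) \<epsilon>] by (simp add: M_def)
  have sM: "s\<^sup>2 \<le> (2 * real M)\<^sup>2"
  proof -
    have "n \<le> (2 * real M)\<^sup>2 * \<epsilon> ^ 4"
      using unif Lr by (simp add: power_mult_distrib)
    then show ?thesis using \<epsilon> by (simp add: s2 field_simps)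
  qed
  then have s_le: "s \<le> 2 * real M" by (rule power2_le_imp_le) simp
  then have Mpos: "0 < M" using s0 by (cases M) auto
  \<comment> \<open>The collision bound applies when \<open>8 * M \<le> L\<close>, and
    \<open>46 ^ 3\<close> exceeds \<open>9 * 10240\<close>. Otherwise \<open>n \<le> 24 * M\<close>,
    and the uniform bound suffices since \<open>y ^ 3 = s\<^sup>2 * n\<close>.\<close>
  have "y ^ 3 \<le> (46 * real M) ^ 3"
  proof (cases "8 * M \<le> L")
    case True
    have "L\<^sup>2 \<le> 10240 * real M ^ 3 * \<epsilon> ^ 4"
      using collision_lower_bound[OF A rep I L(1) \<epsilon> Mpos[unfolded M_def] True[unfolded M_def]]
      by (simp add: M_def)
    moreover have "(real n)\<^sup>2 \<le> (3 * real L)\<^sup>2" using Lr by (intro power_mono) auto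
    ultimately have "(real n)\<^sup>2 \<le> 92160 * real M ^ 3 * \<epsilon> ^ 4"
      by (simp add: power_mult_distrib)
    then have "y ^ 3 \<le> 92160 * real M ^ 3"
      using \<epsilon> by (simp add: y3 field_simps)
    also have "\<dots> \<le> (46 * real M) ^ 3" by (simp add: power_mult_distrib)
    finally show ?thesis .
  next
    case False
    then have n_le: "real n \<le> 24 * real M" using L by linarith
    have "y ^ 3 = s\<^sup>2 * n" unfolding s2 y3 by (simp add: power2_eq_square)
    also have "\<dots> \<le> (2 * real M)\<^sup>2 * (24 * real M)"
      using sM n_le by (intro mult_mono) auto
    also have "\<dots> \<le> (46 * real M) ^ 3"
      by (simp add: power_mult_distrib power2_eq_square power3_eq_cube)
    finally show ?thesis .
  qed
  then have "y \<le> 46 * real M"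
    by (subst (asm) power_mono_iff) (use y0 in auto)
  then have "sample_rate n \<epsilon> \<le> 48 * M"
    using s_le by (simp add: sample_rate_def s_def y_def)
  then show ?thesis using M m0 by simp
qed

theorem theorem3p2:
  "(\<exists>(T :: nat \<Rightarrow> real \<Rightarrow> algorithm) (C :: real). C > 0 \<and>
      (\<forall>(n::nat) (\<epsilon>::real). n \<ge> 1 \<and> \<epsilon> > 0 \<longrightarrow>
         noisy_closeness_tester n \<epsilon> (T n \<epsilon>) \<and>
         uses_at_most n (T n \<epsilon>) (C * sample_rate n \<epsilon>))) \<and>
   (\<exists>c::real. c > 0 \<and>
      (\<forall>(n::nat) (\<epsilon>::real) (A :: algorithm) (m::real).
         n \<ge> 2 \<and> 0 < \<epsilon> \<and> \<epsilon> \<le> 1 \<and>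
         noisy_closeness_tester n \<epsilon> A \<and> uses_at_most n A m \<longrightarrow>
         m \<ge> c * sample_rate n \<epsilon>))"
proof
  let ?good = "\<lambda>n \<epsilon> A. noisy_closeness_tester n \<epsilon> A \<and> uses_at_most n A (1600000 * sample_rate n \<epsilon>)"
  define T where "T n \<epsilon> = (SOME A. ?good n \<epsilon> A)" for n \<epsilon>
  have "?good n \<epsilon> (T n \<epsilon>)" if "n \<ge> 1" "\<epsilon> > 0" for n and \<epsilon> :: real
    unfolding T_def by (rule someI_ex[OF tester_upper_bound[OF that]])
  then show "\<exists>(T :: nat \<Rightarrow> real \<Rightarrow> algorithm) (C :: real). C > 0 \<and>
      (\<forall>(n::nat) (\<epsilon>::real). n \<ge> 1 \<and> \<epsilon> > 0 \<longrightarrow>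
         noisy_closeness_tester n \<epsilon> (T n \<epsilon>) \<and>
         uses_at_most n (T n \<epsilon>) (C * sample_rate n \<epsilon>))"
    by (intro exI[of _ T] exI[of _ 1600000]) simp
next
  show "\<exists>c::real. c > 0 \<and>
      (\<forall>(n::nat) (\<epsilon>::real) (A :: algorithm) (m::real).
         n \<ge> 2 \<and> 0 < \<epsilon> \<and> \<epsilon> \<le> 1 \<and>
         noisy_closeness_tester n \<epsilon> A \<and> uses_at_most n A m \<longrightarrow>
         m \<ge> c * sample_rate n \<epsilon>)"
    by (intro exI[of _ "1/300"]) (use tester_lower_bound in auto)
qed

end
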